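(* Let $D$ be a division ring, $n$ a positive integer, and $G$ an almost subnormal subgroup of $\mathrm{GL}_n(D)$. In case $n\ge 2$, assume that $D$ is not a locally finite field. If $G$ is periodic, then $G$ is central, i.e. $G$ is contained in the center of $\mathrm{GL}_n(D)$.
   Context: $\mathrm{GL}_n(D)$ is the group of invertible $n\times n$ matrices over $D$ (so $\mathrm{GL}_1(D)=D^*$). A subgroup $H$ of a group $X$ is almost subnormal in $X$ if there is a finite chain $H=H_0\le H_1\le\cdots\le H_r=X$ such that for each $i$ either $H_i$ is normal in $H_{i+1}$ or the index $[H_{i+1}:H_i]$ is finite. A group is periodic if each of its elements has finite order. A locally finite field is a field in which every finite subset generates a finite subfield (equivalently, an algebraic extension of a finite field). *)

theory Defs
  imports "HOL-Algebra.Algebraic_Closure_Type" "HOL-Algebra.Generated_Fields"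
    "Jordan_Normal_Form.Matrix"
begin

definition GL :: "'a::division_ring itself \<Rightarrow> nat \<Rightarrow> 'a mat monoid" where
  "GL ty n = units_of (ring_mat ty n ())"

lemma group_GL: "group (GL TYPE('a::division_ring) n)"
  unfolding GL_def by (intro monoid.units_group semiring.axioms(2) semiring_mat)

lemma carrier_GL:
  "carrier (GL TYPE('a::division_ring) n) = {A \<in> carrier_mat n n. invertible_mat A}"
proof (intro equalityI subsetI)
  fix A assume "A \<in> carrier (GL TYPE('a) n)"
  then obtain B where "A \<in> carrier_mat n n" "B \<in> carrier_mat n n" "A * B = 1\<^sub>m n" "B * A = 1\<^sub>m n"
    by (auto simp: GL_def units_of_def Units_def ring_mat_simps)
  then show "A \<in> {A \<in> carrier_mat n n. invertible_mat A}"
    by (auto simp: invertible_mat_def inverts_mat_def square_mat.simps)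
next
  fix A :: "'a mat" assume "A \<in> {A \<in> carrier_mat n n. invertible_mat A}"
  then obtain B where A: "A \<in> carrier_mat n n"
    and AB: "A * B = 1\<^sub>m n" and BA: "B * A = 1\<^sub>m (dim_row B)"
    by (auto simp: invertible_mat_def inverts_mat_def)
  from arg_cong[OF AB, of dim_col] arg_cong[OF BA, of dim_col] A
  have "B \<in> carrier_mat n n" by auto
  with A AB BA show "A \<in> carrier (GL TYPE('a) n)"
    by (auto simp: GL_def units_of_def Units_def ring_mat_simps)
qed

text \<open>The index of \<open>K\<close> in \<open>L\<close> is finite iff \<open>L\<close> has finitely many right cosets of \<open>K\<close>; it is expressed
  through \<^const>\<open>finite\<close> since \<^const>\<open>card\<close> vanishes on infinite sets.\<close>

definition almost_subnormal :: "'a set \<Rightarrow> ('a, 'b) monoid_scheme \<Rightarrow> bool" where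
  "almost_subnormal H G \<longleftrightarrow>
     (\<exists>(r::nat) C. C 0 = H \<and> C r = carrier G \<and>
        (\<forall>i\<le>r. subgroup (C i) G) \<and>
        (\<forall>i<r. C i \<subseteq> C (Suc i) \<and>
           (C i \<lhd> G\<lparr>carrier := C (Suc i)\<rparr> \<or>
            finite (rcosets\<^bsub>G\<lparr>carrier := C (Suc i)\<rparr>\<^esub> (C i)))))"

definition periodic_group :: "('a, 'b) monoid_scheme \<Rightarrow> bool" where
  "periodic_group G \<longleftrightarrow>
     group G \<and> (\<forall>x\<in>carrier G. \<exists>k::nat. k > 0 \<and> x [^]\<^bsub>G\<^esub> k = \<one>\<^bsub>G\<^esub>)"

definition group_center :: "('a, 'b) monoid_scheme \<Rightarrow> 'a set" where
  "group_center G = {z \<in> carrier G. \<forall>x\<in>carrier G. z \<otimes>\<^bsub>G\<^esub> x = x \<otimes>\<^bsub>G\<^esub> z}"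

definition locally_finite_field :: "('a, 'b) ring_scheme \<Rightarrow> bool" where
  "locally_finite_field K \<longleftrightarrow>
     field K \<and> (\<forall>S\<subseteq>carrier K. finite S \<longrightarrow> finite (generate_field K S))"

end

(*
  Case n = 1. Let a in G be noncentral; its order m is prime to the characteristic, so splitting D into
  eigenspaces of right multiplication by a yields x with x a x^-1 = a^i different from a. The ring
  R = Z[a, x] contains a central element \<pi> (a power of x, or the square of a large prime) for which the
  \<pi>-adic filtration of a localisation of R is well behaved: units 1 + \<pi>^k (b + ...) with suitable b have
  infinite order, a commutator with a replaces b by (1 - z) b for a root of unity z, and a quotient of two
  units of different levels keeps the smaller level. Hence, descending the chain from D^* to G,
  every group contains such units of arbitrarily high level, which is absurd for the periodic group G.
  If neither choice of \<pi> works, then R is (up to changing x) a finite noncommutative domain, which a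
  count of norms excludes as in Wedderburn's theorem.

  Case n > 1. By the case n = 1 applied to D^*, some t in D has infinite order. If G is noncentral, then
  Iwasawa's simplicity argument shows that each group of the chain contains all transvections, hence
  G contains an element acting as diag(t, t^-1) on a plane.
*)
theory Submission
  imports Defs "HOL-Computational_Algebra.Group_Closure"
begin

section \<open>Additive closures\<close>

text \<open>The length of the chain shapes the case \<open>n = 1\<close>. Every normal step
  multiplies the leading coefficient by \<open>d = 1 - z\<close>, so \<open>d ^ r * x\<close> must
  stay outside \<open>\<pi> * R\<close> for all \<open>r\<close> at once, although \<open>d\<close>
  need not be a unit. The way out is that \<open>d\<close> divides the integer \<open>m\<close> with
  \<open>a ^ m = 1\<close>: a relation \<open>d ^ r * x = \<pi> * s\<close> yields one for
  \<open>m ^ r * x\<close>. A power of \<open>x\<close> is then a good \<open>\<pi>\<close> unless a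
  nonzero integer \<open>c\<close> lies in \<open>x * R\<close>. In that case
  \<open>c * inverse x\<close> is integral, so with \<open>a\<close> it generates a ring that is
  finitely generated as a group, where a large prime divides neither \<open>m\<close> nor the new
  \<open>x\<close>. A unit of prime order \<open>l\<close> that is 1 modulo \<open>\<pi>\<close>
  forces \<open>l\<close>, if nonzero, into \<open>\<pi> * R\<close>; hence the square of a prime.
  Arbitrarily high levels are kept for the finite index steps: pigeonhole on cosets gives a quotient
  of two units, whose leading term is known only if their levels differ. For \<open>n > 1\<close>
  the infinite order of \<open>t\<close> serves three times: \<open>t * t - 1\<close> is invertible,
  infinitely many transvections meet finitely many cosets in a finite index step, and the final
  element has infinite order.\<close>

lemma group_closure_mapI:
  assumes "r \<in> group_closure S" and "\<And>u v. f (u - v) = f u - f v"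
    and "\<And>s. s \<in> S \<Longrightarrow> f s \<in> group_closure T"
  shows "f r \<in> group_closure T"
  using assms(1)
proof induction
  case (base s)
  have "f 0 = 0" using assms(2)[of 0 0] by simp
  with base assms(3) show ?case by auto
next
  case (diff s t)
  then show ?case by (auto simp: assms(2) intro: group_closure.diff)
qed

lemma group_closure_mult_closed:
  fixes S :: "'a::ring set"
  assumes "\<And>s t. s \<in> S \<Longrightarrow> t \<in> S \<Longrightarrow> s * t \<in> group_closure S"
    and "u \<in> group_closure S" "v \<in> group_closure S"
  shows "u * v \<in> group_closure S"
proof (rule group_closure_mapI[OF assms(3), where f = "(*) u"])
  fix t assume "t \<in> S"
  show "u * t \<in> group_closure S"
    by (rule group_closure_mapI[OF assms(2), where f = "\<lambda>s. s * t"])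
      (auto simp: algebra_simps intro: assms(1) \<open>t \<in> S\<close>)
qed (simp add: algebra_simps)

lemma group_closure_commute:
  fixes S :: "'a::ring set"
  assumes "u \<in> group_closure S" and "\<And>s. s \<in> S \<Longrightarrow> g * s = s * g"
  shows "g * u = u * g"
  using assms(1) by induction (auto simp: algebra_simps assms(2))

lemma group_closure_of_int_mult:
  fixes S :: "'a::ring_1 set"
  assumes "u \<in> group_closure S"
  shows "of_int k * u \<in> group_closure S"
proof -
  have nat: "of_nat n * u \<in> group_closure S" for n
    by (induction n) (auto simp: algebra_simps intro: group_closure_add assms)
  show ?thesis
    using nat[of "nat k"] nat[of "nat (-k)"]
    by (cases "k \<ge> 0") auto
qed

lemma group_closure_insertE:
  fixes S :: "'a::ring_1 set"
  assumes "u \<in> group_closure (insert s S)"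
  obtains k r where "r \<in> group_closure S" "u = of_int k * s + r"
proof -
  have "\<exists>k. \<exists>r\<in>group_closure S. u = of_int k * s + r"
    using assms
  proof induction
    case (base t)
    show ?case
    proof (cases "t = s")
      case True
      then show ?thesis by (intro exI[of _ 1] bexI[of _ 0]) auto
    next
      case False
      with base show ?thesis
        by (intro exI[of _ 0] bexI[of _ t]) (auto intro: group_closure.base)
    qed
  next
    case (diff t u)
    then obtain k r l q where "r \<in> group_closure S" "q \<in> group_closure S"
      "t = of_int k * s + r" "u = of_int l * s + q" by blast
    then show ?case
      by (intro exI[of _ "k - l"] bexI[of _ "r - q"]) (auto simp: algebra_simps intro: group_closure.diff)
  qed
  then show thesis using that by blast
qed

lemma finite_group_closure:
  fixes S :: "'a::ring_1 set"
  assumes "finite S" and p: "p > 0" "of_nat p = (0::'a)"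
  shows "finite (group_closure S)"
  using assms(1)
proof induction
  case (insert s S)
  have "group_closure (insert s S) \<subseteq> (\<lambda>(k, r). of_int k * s + r) ` ({0..<int p} \<times> group_closure S)"
  proof
    fix u assume "u \<in> group_closure (insert s S)"
    then obtain k r where *: "r \<in> group_closure S" "u = of_int k * s + r"
      by (rule group_closure_insertE)
    have "of_int k = (of_int (int p * (k div int p) + k mod int p) :: 'a)"
      by simp
    also have "\<dots> = of_int (k mod int p)"
      using p(2) unfolding of_int_add of_int_mult by simp
    finally have "u = of_int (k mod int p) * s + r" using * by simp
    with p * show "u \<in> (\<lambda>(k, r). of_int k * s + r) ` ({0..<int p} \<times> group_closure S)"
      by (auto intro!: image_eqI[of _ _ "(k mod int p, r)"])
  qed
  with insert show ?case by (meson finite_SigmaI finite_atLeastLessThan_int finite_imageI finite_subset)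
qed simp

text \<open>Divisibility of \<open>b\<close> in a finitely generated torsion-free group is bounded. The induction
  on the generators distinguishes whether the new generator \<open>s\<close> is independent of the others.\<close>

lemma group_closure_divisibility_bounded:
  fixes S :: "'a::division_ring set"
  assumes "finite S" and char0: "\<And>k::int. k \<noteq> 0 \<Longrightarrow> of_int k \<noteq> (0::'a)" and "b \<noteq> 0"
  shows "\<exists>q0::int. \<forall>q r. r \<in> group_closure S \<longrightarrow> b = of_int q * r \<longrightarrow> q \<le> q0"
  using assms(1,3)
proof (induction arbitrary: b)
  case empty
  then show ?case by auto
next
  case (insert s S)
  show ?case
  proof (cases "\<exists>n::int. n \<noteq> 0 \<and> of_int n * s \<in> group_closure S")
    case True
    then obtain n :: int where n: "n \<noteq> 0" "of_int n * s \<in> group_closure S" by blast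
    \<comment> \<open>A multiple \<open>n * s\<close> already lies in the smaller group, so
      multiplication by \<open>n\<close> moves every \<open>r\<close> there; the bound for
      \<open>n * b\<close> then bounds \<open>q\<close>.\<close>
    have "of_int n * b \<noteq> 0" using n char0 insert by simp
    with insert.IH obtain q0 where
      q0: "\<And>q r. r \<in> group_closure S \<Longrightarrow> of_int n * b = of_int q * r \<Longrightarrow> q \<le> q0" by blast
    show ?thesis
    proof (intro exI allI impI)
      fix q r assume r: "r \<in> group_closure (insert s S)" and b: "b = of_int q * r"
      have "of_int n * r \<in> group_closure S"
      proof (rule group_closure_mapI[OF r, where f = "(*) (of_int n)"])
        fix t assume "t \<in> insert s S"
        then show "of_int n * t \<in> group_closure S"
          using n by (auto intro: group_closure_of_int_mult group_closure.base)
      qed (simp add: algebra_simps)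
      moreover have "of_int n * b = of_int q * (of_int n * r)"
        unfolding b by (simp add: mult.assoc[symmetric] of_int_mult[symmetric] mult.commute del: of_int_mult)
      ultimately show "q \<le> q0" by (rule q0)
    qed
  next
    case False
    then have indep: "k = 0" if "of_int k * s \<in> group_closure S" for k :: int using that by blast
    show ?thesis
    proof (cases "b \<in> group_closure (insert s S)")
      case False
      then show ?thesis using group_closure_of_int_mult[of _ "insert s S"] by blast
    next
      case True
      then obtain k0 r0 where b0: "r0 \<in> group_closure S" "b = of_int k0 * s + r0"
        by (rule group_closure_insertE)
      obtain q0 where q0: "\<And>q r. r \<in> group_closure S \<Longrightarrow> b = of_int q * r \<Longrightarrow> q \<le> q0"
        using insert.IH insert.prems by blast
      show ?thesis
      proof (intro exI allI impI)
        fix q r' assume r': "r' \<in> group_closure (insert s S)" and b: "b = of_int q * r'"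
        from r' obtain k r where r: "r \<in> group_closure S" "r' = of_int k * s + r"
          by (rule group_closure_insertE)
        \<comment> \<open>Comparing coefficients of the independent \<open>s\<close> gives
          \<open>k0 = q * k\<close>: either \<open>q\<close> divides a nonzero \<open>k0\<close>, or
          the term in \<open>s\<close> drops out of \<open>b\<close> and the bound for
          \<open>S\<close> applies.\<close>
        have "of_int (k0 - q * k) * s = of_int q * r - r0"
        proof -
          have "of_int (k0 - q * k) * s = of_int k0 * s - of_int q * (of_int k * s)"
            by (simp add: left_diff_distrib mult.assoc)
          also have "\<dots> = of_int q * r - r0"
            using b b0(2) r(2) by (simp add: distrib_left) (simp add: algebra_simps)
          finally show ?thesis .
        qed
        with indep have k: "k0 = q * k"
          using r(1) b0(1) by (metis eq_iff_diff_eq_0 group_closure.diff group_closure_of_int_mult)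
        show "q \<le> max q0 \<bar>k0\<bar>"
        proof (cases "k0 = 0")
          case True
          then have "k = 0 \<or> q = 0" using k by auto
          then have "b = of_int q * r" using b r by auto
          from q0[OF r(1) this] show ?thesis by simp
        next
          case False
          then have "\<bar>q\<bar> * 1 \<le> \<bar>q\<bar> * \<bar>k\<bar>" using k by (intro mult_left_mono) auto
          then show ?thesis using k by (simp add: abs_mult)
        qed
      qed
    qed
  qed
qed

section \<open>Units of a localisation at a central element\<close>

lemma inverse_commute:
  fixes x y :: "'a::division_ring"
  assumes "x * y = y * x"
  shows "inverse x * y = y * inverse x"
proof (cases "x = 0")
  case False
  have "inverse x * (x * y) * inverse x = inverse x * (y * x) * inverse x"
    using assms by simp
  with False show ?thesis
    by (simp add: mult.assoc) (metis False left_inverse mult.assoc mult_1_left)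
qed simp

lemma power_commutes':
  fixes x y :: "'a::monoid_mult"
  assumes "x * y = y * x"
  shows "x ^ k * y = y * x ^ k"
  by (induction k) (auto simp: mult.assoc assms, simp add: mult.assoc[symmetric] assms)

lemma one_diff_geometric:
  fixes w :: "'a::ring_1"
  shows "(1 - w) * (\<Sum>i<N. w ^ i) = 1 - w ^ N"
proof (induction N)
  case (Suc N)
  then show ?case by (simp add: distrib_left left_diff_distrib)
qed simp

text \<open>\<open>1\<close> commutes with \<open>u\<close>, so the binomial formula survives in a
  noncommutative ring, and its inner coefficients vanish. It serves to show that in characteristic
  \<open>l\<close> only 1 satisfies \<open>y ^ l = 1\<close>.\<close>

lemma freshman_prime:
  fixes u :: "'a::ring_1"
  assumes "prime l" "of_nat l = (0::'a)"
  shows "(1 + u) ^ l = 1 + u ^ l"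
proof -
  have binom: "(1 + u) ^ n = (\<Sum>k\<le>n. of_nat (n choose k) * u ^ k)" for n
  proof (induction n)
    case (Suc n)
    have "(1 + u) ^ Suc n = (\<Sum>k\<le>n. of_nat (n choose k) * u ^ k) + (\<Sum>k\<le>n. of_nat (n choose k) * u ^ Suc k)"
    proof -
      have "u * (of_nat (n choose k) * u ^ k) = of_nat (n choose k) * u ^ Suc k" for k
        unfolding mult.assoc[symmetric] mult_of_nat_commute[symmetric] by (simp add: mult.assoc)
      then show ?thesis unfolding power_Suc Suc by (simp add: distrib_right sum_distrib_left sum.distrib)
    qed
    also have "\<dots> = (\<Sum>k\<le>Suc n. of_nat (n choose k) * u ^ k) + (\<Sum>k\<le>n. of_nat (n choose k) * u ^ Suc k)"
      by (simp add: binomial_eq_0)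
    also have "\<dots> = (\<Sum>k\<le>Suc n. of_nat (Suc n choose k) * u ^ k)"
      unfolding sum.atMost_Suc_shift[of _ n] by (simp add: sum.distrib distrib_right)
    finally show ?case .
  qed simp
  have zero: "of_nat (l choose k) * u ^ k = 0" if "k \<in> {0<..<l}" for k
  proof -
    have "l dvd (l choose k)" using that assms(1) by (intro dvd_choose_prime) auto
    then obtain c where "l choose k = l * c" by (elim dvdE)
    then show ?thesis using assms(2) by simp
  qed
  have "l > 0" using assms(1) by (simp add: prime_gt_0_nat)
  then have "{..l} = insert 0 (insert l {0<..<l})" by auto
  then have "(1 + u) ^ l = 1 + (u ^ l + (\<Sum>k\<in>{0<..<l}. of_nat (l choose k) * u ^ k))"
    unfolding binom using \<open>l > 0\<close> by simp
  also have "(\<Sum>k\<in>{0<..<l}. of_nat (l choose k) * u ^ k) = 0"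
    by (intro sum.neutral ballI zero)
  finally show ?thesis by simp
qed

section \<open>A localisation with central denominators\<close>

locale subring_with_center_element =
  fixes R :: "'a::division_ring set" and \<pi> :: 'a
  assumes one_R: "1 \<in> R"
    and diff_R: "r \<in> R \<Longrightarrow> s \<in> R \<Longrightarrow> r - s \<in> R"
    and mult_R: "r \<in> R \<Longrightarrow> s \<in> R \<Longrightarrow> r * s \<in> R"
    and pi_R: "\<pi> \<in> R"
    and pi_commute: "r \<in> R \<Longrightarrow> r * \<pi> = \<pi> * r"
    and pi_proper: "\<And>r. r \<in> R \<Longrightarrow> \<pi> * r \<noteq> 1"
begin

lemma zero_R: "0 \<in> R" using diff_R[OF one_R one_R] by simp
lemma uminus_R: "r \<in> R \<Longrightarrow> - r \<in> R" using diff_R[OF zero_R, of r] by simp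
lemma add_R: "r \<in> R \<Longrightarrow> s \<in> R \<Longrightarrow> r + s \<in> R" using diff_R[of r "- s"] uminus_R by simp
lemma power_R: "r \<in> R \<Longrightarrow> r ^ k \<in> R" by (induction k) (auto intro: one_R mult_R)

definition center_R where "center_R = {c \<in> R. \<forall>r\<in>R. r * c = c * r}"

text \<open>Denominators are central in \<open>R\<close>, so fractions multiply without an Ore
  condition, and they are 1 modulo \<open>\<pi>\<close>, so inverting them changes nothing modulo
  \<open>\<pi>\<close>. They are nonzero because \<open>\<pi>\<close> is not invertible in
  \<open>R\<close>.\<close>

definition denoms where "denoms = {1 + \<pi> * g |g. g \<in> center_R}"

definition local_R where "local_R = {f * inverse h |f h. f \<in> R \<and> h \<in> denoms}"

lemma denoms_subset: "h \<in> denoms \<Longrightarrow> h \<in> center_R"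
proof -
  assume "h \<in> denoms"
  then obtain g where g: "g \<in> R" "\<And>r. r \<in> R \<Longrightarrow> r * g = g * r" "h = 1 + \<pi> * g"
    by (auto simp: denoms_def center_R_def)
  have "r * (\<pi> * g) = \<pi> * g * r" if "r \<in> R" for r
    using g(2)[OF that] pi_commute[OF that] by (metis mult.assoc)
  moreover have "h \<in> R" unfolding g(3) by (intro add_R mult_R one_R pi_R g(1))
  ultimately show ?thesis by (simp add: center_R_def g(3) distrib_left distrib_right)
qed

lemma denoms_nonzero: "h \<in> denoms \<Longrightarrow> h \<noteq> 0"
proof
  assume "h \<in> denoms" "h = 0"
  then obtain g where g: "g \<in> center_R" "1 + \<pi> * g = 0" by (auto simp: denoms_def)
  then have "\<pi> * (- g) = 1" by (simp add: add_eq_0_iff2)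
  moreover have "- g \<in> R" using g uminus_R by (simp add: center_R_def)
  ultimately show False using pi_proper by blast
qed

lemma denoms_mult:
  assumes "h \<in> denoms" "h' \<in> denoms" shows "h * h' \<in> denoms"
proof -
  obtain g where g: "g \<in> center_R" "h = 1 + \<pi> * g" using assms by (auto simp: denoms_def)
  obtain g' where g': "g' \<in> center_R" "h' = 1 + \<pi> * g'" using assms by (auto simp: denoms_def)
  have c: "r * g = g * r" "r * g' = g' * r" if "r \<in> R" for r
    using g g' that by (auto simp: center_R_def)
  have "g + g' + \<pi> * g * g' \<in> R"
    using g g' by (auto simp: center_R_def intro!: add_R mult_R pi_R)
  moreover have "r * (g + g' + \<pi> * g * g') = (g + g' + \<pi> * g * g') * r" if r: "r \<in> R" for r
  proof -
    have "r * (\<pi> * g * g') = (\<pi> * g * g') * r"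
      using c[OF r] pi_commute[OF r] by (metis mult.assoc)
    then show ?thesis using c[OF r] by (simp add: algebra_simps)
  qed
  moreover have "h * h' = 1 + \<pi> * (g + g' + \<pi> * g * g')"
  proof -
    have "g * \<pi> = \<pi> * g" using g by (intro pi_commute) (auto simp: center_R_def)
    then have "\<pi> * g * (\<pi> * g') = \<pi> * (\<pi> * g * g')" by (metis mult.assoc)
    then show ?thesis by (simp add: g g' algebra_simps)
  qed
  ultimately show ?thesis unfolding denoms_def center_R_def by blast
qed

lemma one_denoms: "1 \<in> denoms"
  using zero_R by (auto simp: denoms_def center_R_def intro!: exI[of _ 0])

lemma denom_commute:
  assumes "h \<in> denoms" "f \<in> R" shows "f * h = h * f" "f * inverse h = inverse h * f"
  using denoms_subset[OF assms(1)] assms(2) inverse_commute[of h f] by (auto simp: center_R_def)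

lemma R_local: "r \<in> R \<Longrightarrow> r \<in> local_R"
  using one_denoms unfolding local_R_def by (metis (mono_tags, lifting) inverse_1 mem_Collect_eq mult_1_right)

lemma local_mult:
  assumes "u \<in> local_R" "v \<in> local_R" shows "u * v \<in> local_R"
proof -
  obtain f h where f: "f \<in> R" "h \<in> denoms" "u = f * inverse h" using assms by (auto simp: local_R_def)
  obtain f' h' where f': "f' \<in> R" "h' \<in> denoms" "v = f' * inverse h'" using assms by (auto simp: local_R_def)
  have "u * v = f * (inverse h * f') * inverse h'" by (simp add: f f' mult.assoc)
  also have "\<dots> = (f * f') * (inverse h * inverse h')"
    by (simp add: mult.assoc denom_commute(2)[OF f(2) f'(1), symmetric])
  also have "\<dots> = (f * f') * inverse (h' * h)"
    using denoms_nonzero f f' by (simp add: nonzero_inverse_mult_distrib)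
  finally have "u * v = (f * f') * inverse (h' * h)" .
  moreover have "f * f' \<in> R" "h' * h \<in> denoms" using f f' denoms_mult mult_R by auto
  ultimately show ?thesis unfolding local_R_def by blast
qed

lemma local_diff:
  assumes "u \<in> local_R" "v \<in> local_R" shows "u - v \<in> local_R"
proof -
  obtain f h where f: "f \<in> R" "h \<in> denoms" "u = f * inverse h" using assms by (auto simp: local_R_def)
  obtain f' h' where f': "f' \<in> R" "h' \<in> denoms" "v = f' * inverse h'" using assms by (auto simp: local_R_def)
  have R: "h \<in> R" "h' \<in> R" using f f' denoms_subset by (auto simp: center_R_def)
  have nz: "h \<noteq> 0" "h' \<noteq> 0" using f f' denoms_nonzero by auto
  have "u = f * h' * inverse (h * h')"
    using nz f by (simp add: nonzero_inverse_mult_distrib mult.assoc) (simp add: mult.assoc[symmetric])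
  moreover have "v = f' * h * inverse (h * h')"
    unfolding denom_commute(1)[OF f'(2) R(1)]
    using nz f' by (simp add: nonzero_inverse_mult_distrib mult.assoc) (simp add: mult.assoc[symmetric])
  ultimately have "u - v = (f * h' - f' * h) * inverse (h * h')" by (simp add: left_diff_distrib)
  then show ?thesis using f f' R denoms_mult by (auto simp: local_R_def intro!: diff_R mult_R)
qed

lemma local_uminus: "u \<in> local_R \<Longrightarrow> - u \<in> local_R"
  using local_diff[OF R_local[OF zero_R], of u] by simp

lemma local_add: "u \<in> local_R \<Longrightarrow> v \<in> local_R \<Longrightarrow> u + v \<in> local_R"
  using local_diff[of u "- v"] local_uminus by simp

lemma local_power: "u \<in> local_R \<Longrightarrow> u ^ k \<in> local_R"
  by (induction k) (auto intro: R_local one_R local_mult)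

lemma local_sum: "(\<And>i. i \<in> I \<Longrightarrow> u i \<in> local_R) \<Longrightarrow> sum u I \<in> local_R"
  by (induction I rule: infinite_finite_induct) (auto intro: local_add R_local zero_R)

lemma pi_commute_local:
  assumes "u \<in> local_R" shows "u * \<pi> = \<pi> * u"
proof -
  obtain f h where f: "f \<in> R" "h \<in> denoms" "u = f * inverse h" using assms by (auto simp: local_R_def)
  have "inverse h * \<pi> = \<pi> * inverse h" using denom_commute(2)[OF f(2) pi_R] by simp
  then show ?thesis using f pi_commute[OF f(1)] by (metis mult.assoc)
qed

lemma pi_power_commute_local: "u \<in> local_R \<Longrightarrow> u * \<pi> ^ k = \<pi> ^ k * u"
  using power_commutes'[of \<pi> u k] pi_commute_local by simp

text \<open>With \<open>h = 1 + \<pi> * g\<close>, the equation \<open>r * h = \<pi> * f\<close>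
  rearranges to \<open>r = \<pi> * (f - r * g)\<close>. Nondivisibility assumed in \<open>R\<close>
  thus carries over to the localisation.\<close>

lemma R_multiple_of_local_multiple:
  assumes "r \<in> R" "v \<in> local_R" "r = \<pi> * v"
  shows "\<exists>s\<in>R. r = \<pi> * s"
proof -
  obtain f h where f: "f \<in> R" "h \<in> denoms" "v = f * inverse h" using assms by (auto simp: local_R_def)
  obtain g where g: "g \<in> center_R" "h = 1 + \<pi> * g" using f by (auto simp: denoms_def)
  have "r * h = \<pi> * f" using f denoms_nonzero assms(3) by (simp add: mult.assoc)
  then have "r = \<pi> * f - r * \<pi> * g" by (simp add: g algebra_simps)
  also have "\<dots> = \<pi> * (f - r * g)" using pi_commute[OF assms(1)] by (simp add: algebra_simps)
  finally show ?thesis using f g assms(1) by (auto simp: center_R_def intro: diff_R mult_R)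
qed

text \<open>A unit of the localisation with leading term \<open>b\<close> at level \<open>k\<close> of the \<open>\<pi>\<close>-adic filtration.\<close>

definition lead where
  "lead k b y \<longleftrightarrow> y \<noteq> 0 \<and> inverse y \<in> local_R \<and> (\<exists>u\<in>local_R. y = 1 + \<pi> ^ k * (b + \<pi> * u))"

lemma lead_local: "lead k b y \<Longrightarrow> b \<in> R \<Longrightarrow> y \<in> local_R"
  unfolding lead_def by (auto intro!: local_add local_mult local_power intro: R_local one_R pi_R)

text \<open>With \<open>w = - (\<pi> ^ k * x)\<close>, the geometric series shows that
  \<open>1 - w\<close> divides \<open>1 - w ^ N\<close>, which is an admissible denominator because
  \<open>x ^ N\<close> is central. The inverse therefore exists in the localisation, without
  completing \<open>R\<close>.\<close>

lemma lead_basic: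
  assumes "x \<in> R" "x ^ N \<in> center_R" "N > 0" "k > 0" 
  shows "lead k x (1 + \<pi> ^ k * x)"
proof -
  define w where "w = - (\<pi> ^ k * x)"
  have w: "w \<in> R" unfolding w_def using assms by (auto intro: uminus_R mult_R power_R pi_R)
  define g where "g = \<pi> ^ (k * N - 1) * x ^ N * (- ((- 1) ^ N))"
  have "(\<pi> ^ k * x) ^ N = \<pi> ^ (k * N) * x ^ N"
  proof -
    have c: "x * \<pi> ^ k = \<pi> ^ k * x" using pi_power_commute_local R_local assms by simp
    show ?thesis
    proof (induction N)
      case (Suc n)
      have "(\<pi> ^ k * x) ^ Suc n = \<pi> ^ k * x * (\<pi> ^ (k * n) * x ^ n)" using Suc by simp
      also have "\<dots> = \<pi> ^ k * (x * \<pi> ^ (k * n)) * x ^ n" by (simp add: mult.assoc)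
      also have "x * \<pi> ^ (k * n) = \<pi> ^ (k * n) * x"
        using pi_power_commute_local R_local assms by simp
      finally show ?case by (simp add: power_add mult.assoc)
    qed simp
  qed
  then have "w ^ N = (-1) ^ N * (\<pi> ^ (k * N) * x ^ N)"
    unfolding w_def by (subst power_minus) simp
  also have "\<pi> ^ (k * N) = \<pi> * \<pi> ^ (k * N - 1)"
    using assms by (metis power_eq_if mult_eq_0_iff neq0_conv)
  finally have "1 - w ^ N = 1 + \<pi> * g"
    unfolding g_def by (cases "even N") (auto simp: mult.assoc)
  moreover have "g \<in> center_R"
  proof -
    have "g \<in> R" unfolding g_def using assms
      by (auto intro!: mult_R power_R pi_R uminus_R one_R)
    moreover have "r * g = g * r" if r: "r \<in> R" for r
    proof -
      have "r * \<pi> ^ (k * N - 1) = \<pi> ^ (k * N - 1) * r" 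
        using pi_power_commute_local R_local r by simp
      moreover have "r * x ^ N = x ^ N * r" using assms(2) r by (auto simp: center_R_def)
      ultimately have "r * (\<pi> ^ (k * N - 1) * x ^ N) = \<pi> ^ (k * N - 1) * x ^ N * r"
        by (metis mult.assoc)
      then show ?thesis unfolding g_def by (cases "even N") (auto simp: mult.assoc)
    qed
    ultimately show ?thesis by (simp add: center_R_def)
  qed
  ultimately have h: "1 - w ^ N \<in> denoms" by (auto simp: denoms_def)
  define s where "s = (\<Sum>i<N. w ^ i)"
  have sR: "s \<in> R" unfolding s_def
    using w by (induction N) (auto intro: zero_R add_R power_R)
  have e: "(1 - w) * s = 1 - w ^ N" unfolding s_def by (rule one_diff_geometric)
  have nz: "1 - w \<noteq> 0" using e denoms_nonzero[OF h] by auto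
  have "inverse (1 - w) = s * inverse (1 - w ^ N)"
  proof (rule inverse_unique)
    show "(1 - w) * (s * inverse (1 - w ^ N)) = 1"
      using e denoms_nonzero[OF h] by (simp add: mult.assoc[symmetric])
  qed
  then have "inverse (1 - w) \<in> local_R" using sR h by (auto simp: local_R_def)
  with nz show ?thesis unfolding lead_def w_def
    by (auto intro!: bexI[of _ 0] R_local zero_R)
qed

text \<open>Write \<open>y = 1 + \<pi> ^ k * c\<close>. The commutator is
  \<open>1 + (y * a - a * y) * inverse y * inverse a\<close>, where the difference is
  \<open>\<pi> ^ k * (c * a - a * c)\<close> and \<open>inverse y\<close> is 1 modulo
  \<open>\<pi>\<close>; all that remains of lowest level is
  \<open>b - a * b * inverse a\<close>.\<close>

lemma lead_commutator:
  assumes y: "lead k b y" and "k > 0" and R: "b \<in> R" "a \<in> R" "inverse a \<in> R" and a: "a \<noteq> 0"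
  shows "lead k (b - a * b * inverse a) (y * a * inverse y * inverse a)"
proof -
  obtain u where u: "u \<in> local_R" "y = 1 + \<pi> ^ k * (b + \<pi> * u)" and y0: "y \<noteq> 0"
    and iy: "inverse y \<in> local_R" using y by (auto simp: lead_def)
  define c where "c = b + \<pi> * u"
  have yc: "y = 1 + \<pi> ^ k * c" using u c_def by simp
  have L: "a \<in> local_R" "inverse a \<in> local_R" "b \<in> local_R" "\<pi> \<in> local_R" "y \<in> local_R"
    using R R_local pi_R lead_local[OF y] by auto
  have cL: "c \<in> local_R" unfolding c_def using L u by (intro local_add local_mult)
  define e where "e = c * a - a * c"
  have eL: "e \<in> local_R" unfolding e_def using L cL by (intro local_diff local_mult)
  have "y * a - a * y = \<pi> ^ k * e"
    unfolding yc e_def using pi_power_commute_local[OF L(1), of k]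
    by (simp add: algebra_simps) (metis mult.assoc)
  then have "y * a * inverse y * inverse a = 1 + \<pi> ^ k * e * inverse y * inverse a"
  proof -
    have "y * a * inverse y * inverse a = (a * y + (y * a - a * y)) * inverse y * inverse a" by simp
    also have "\<dots> = a * y * inverse y * inverse a + (y * a - a * y) * inverse y * inverse a"
      by (simp only: distrib_right)
    also have "a * y * inverse y * inverse a = 1" using a y0 by (simp add: mult.assoc)
    finally show ?thesis using \<open>y * a - a * y = \<pi> ^ k * e\<close> by simp
  qed
  moreover have iy2: "inverse y = 1 - \<pi> ^ k * c * inverse y"
    using y0 yc by (metis add_diff_cancel_right' distrib_right mult_1_left right_inverse)
  obtain k' where k': "k = Suc k'" using \<open>k > 0\<close> by (cases k) auto
  define v where "v = (u - a * u * inverse a) - e * \<pi> ^ k' * c * inverse y * inverse a"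
  have "e * inverse y * inverse a = (b - a * b * inverse a) + \<pi> * v"
  proof -
    have "e * inverse y * inverse a = e * inverse a - e * (\<pi> ^ k * c * inverse y) * inverse a"
      by (subst iy2) (simp add: algebra_simps)
    also have "e * (\<pi> ^ k * c * inverse y) * inverse a = \<pi> * (e * \<pi> ^ k' * c * inverse y * inverse a)"
      using pi_commute_local[OF eL] unfolding k' by (simp add: mult.assoc) (metis mult.assoc)
    also have "e * inverse a = c - a * c * inverse a"
      unfolding e_def using a by (simp add: left_diff_distrib mult.assoc)
    also have "\<dots> = (b - a * b * inverse a) + \<pi> * (u - a * u * inverse a)"
      unfolding c_def using pi_commute_local[OF L(1)]
      by (simp add: algebra_simps) (metis mult.assoc)
    finally show ?thesis unfolding v_def by (simp add: algebra_simps)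
  qed
  moreover have "v \<in> local_R" unfolding v_def
    using L u cL eL iy by (intro local_diff local_mult local_power)
  moreover have "inverse (y * a * inverse y * inverse a) = a * y * inverse a * inverse y"
    using a y0 by (simp add: nonzero_inverse_mult_distrib mult.assoc)
  moreover have "a * y * inverse a * inverse y \<in> local_R"
    using L iy by (intro local_mult)
  ultimately show ?thesis unfolding lead_def using a y0 by (auto simp: mult.assoc)
qed

text \<open>The quotient is \<open>1 + (y - y') * inverse y'\<close>. As \<open>y'\<close> differs
  from 1 only from level \<open>k'\<close> on, and \<open>k < k'\<close>, the difference
  \<open>y - y'\<close> keeps the leading term of \<open>y\<close>. This is for two units in the
  same coset.\<close>

lemma lead_quotient:
  assumes y: "lead k b y" and y': "lead k' b y'" and "k < k'" "k > 0" and R: "b \<in> R"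
  shows "lead k b (y * inverse y')"
proof -
  obtain u where u: "u \<in> local_R" "y = 1 + \<pi> ^ k * (b + \<pi> * u)" and y0: "y \<noteq> 0"
    and iy: "inverse y \<in> local_R" using y by (auto simp: lead_def)
  obtain u' where u': "u' \<in> local_R" "y' = 1 + \<pi> ^ k' * (b + \<pi> * u')" and y'0: "y' \<noteq> 0"
    and iy': "inverse y' \<in> local_R" using y' by (auto simp: lead_def)
  have L: "b \<in> local_R" "\<pi> \<in> local_R" "y \<in> local_R" "y' \<in> local_R"
    using R R_local pi_R lead_local[OF y] lead_local[OF y'] by auto
  obtain j where j: "k' = k + Suc j" using \<open>k < k'\<close> less_iff_Suc_add by auto
  obtain l where l: "k = Suc l" using \<open>k > 0\<close> by (cases k) auto
  define c' where "c' = b + \<pi> * u'"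
  define v where "v = u - \<pi> ^ j * c'"
  define q where "q = \<pi> ^ (l + Suc j) * c' * inverse y'"
  have q: "q \<in> local_R" unfolding q_def c'_def using L u' iy' by (intro local_mult local_power local_add)
  have v: "v \<in> local_R" unfolding v_def c'_def using L u' u by (intro local_mult local_power local_add local_diff)
  have d: "y - y' = \<pi> ^ k * (b + \<pi> * v)"
    unfolding u u' j v_def c'_def power_add power_Suc by (simp only: mult.assoc distrib_left right_diff_distrib) simp
  have "inverse y' = 1 - \<pi> ^ k' * c' * inverse y'"
    using y'0 u' unfolding c'_def by (metis add_diff_cancel_right' distrib_right mult_1_left right_inverse)
  then have iy2: "inverse y' = 1 - \<pi> * q" unfolding q_def j l by (simp add: mult.assoc)
  have "y * inverse y' = 1 + (y - y') * inverse y'" using y'0 by (simp add: left_diff_distrib)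
  also have "\<dots> = 1 + \<pi> ^ k * ((b + \<pi> * v) * (1 - \<pi> * q))" by (simp add: d iy2 mult.assoc)
  also have "(b + \<pi> * v) * (1 - \<pi> * q) = b + \<pi> * (v - (b + \<pi> * v) * q)"
  proof -
    have "(b + \<pi> * v) * \<pi> = \<pi> * (b + \<pi> * v)"
      using L v by (intro pi_commute_local local_add local_mult)
    then have "(b + \<pi> * v) * (\<pi> * q) = \<pi> * ((b + \<pi> * v) * q)" by (metis mult.assoc)
    then show ?thesis by (simp add: algebra_simps)
  qed
  finally have "y * inverse y' = 1 + \<pi> ^ k * (b + \<pi> * (v - (b + \<pi> * v) * q))" .
  moreover have "v - (b + \<pi> * v) * q \<in> local_R"
    using L v q by (intro local_diff local_add local_mult)
  moreover have "inverse (y * inverse y') = y' * inverse y"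
    using y0 y'0 by (simp add: nonzero_inverse_mult_distrib)
  moreover have "y' * inverse y \<in> local_R" using L iy by (intro local_mult)
  ultimately show ?thesis unfolding lead_def using y0 y'0 by auto
qed

section \<open>Units with a leading term have infinite order\<close>

lemma one_plus_power:
  assumes "u \<in> local_R" shows "\<exists>v\<in>local_R. (1 + \<pi> * u) ^ n = 1 + \<pi> * u * v"
proof (induction n)
  case 0
  show ?case by (intro bexI[of _ 0] R_local zero_R) simp
next
  case (Suc n)
  then obtain v where v: "v \<in> local_R" "(1 + \<pi> * u) ^ n = 1 + \<pi> * u * v" by blast
  have "(1 + \<pi> * u) ^ Suc n = 1 + \<pi> * u * (1 + v + \<pi> * u * v)"
    unfolding power_Suc v(2) by (simp add: algebra_simps)
  with v assms show ?case
    by (intro bexI[of _ "1 + v + \<pi> * u * v"]) (auto intro!: local_add local_mult R_local[OF one_R] R_local[OF pi_R])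
qed

text \<open>A torsion unit \<open>y\<close> other than 1 has a power \<open>y'\<close> of prime
  order \<open>l\<close>, still congruent to 1 modulo \<open>\<pi>\<close>. If \<open>l\<close>
  vanishes in the division ring, then \<open>y' = 1\<close>; otherwise
  \<open>1 + y' + ... + y' ^ (l - 1) = 0\<close> reduces to \<open>l\<close> modulo
  \<open>\<pi>\<close>, against \<open>primes\<close>.\<close>

lemma lead_not_torsion:
  assumes y: "lead k b y" and "k > 0" and b: "b \<in> R" "\<And>r. r \<in> R \<Longrightarrow> b \<noteq> \<pi> * r"
    and primes: "\<And>l r. prime l \<Longrightarrow> of_nat l \<noteq> (0::'a) \<Longrightarrow> r \<in> R \<Longrightarrow> of_nat l \<noteq> \<pi> * r"
    and \<pi>: "\<pi> \<noteq> 0" and M: "M > 0"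
  shows "y ^ M \<noteq> 1"
proof
  assume "y ^ M = 1"
  with M have ex: "\<exists>M. M > 0 \<and> y ^ M = 1" by blast
  define n where "n = (LEAST M. M > 0 \<and> y ^ M = 1)"
  have n: "n > 0" "y ^ n = 1" unfolding n_def using LeastI_ex[OF ex] by auto
  have least: "n \<le> M" if "M > 0" "y ^ M = 1" for M
    unfolding n_def using that by (intro Least_le) auto
  obtain u where u: "u \<in> local_R" "y = 1 + \<pi> ^ k * (b + \<pi> * u)" using y by (auto simp: lead_def)
  have bL: "b \<in> local_R" "\<pi> \<in> local_R" using b pi_R R_local by auto
  have "y \<noteq> 1"
  proof
    assume "y = 1"
    then have "b = \<pi> * (- u)" using u \<pi> by (simp add: add_eq_0_iff2)
    then show False using R_multiple_of_local_multiple[OF b(1) local_uminus[OF u(1)]] b(2) by blast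
  qed
  with n have "n \<noteq> 1" by auto
  then obtain l where l: "prime l" "l dvd n" using prime_factor_nat by blast
  then obtain t where t: "n = l * t" by (elim dvdE)
  have "t > 0" "t < n" using t n(1) prime_gt_1_nat[OF l(1)] by auto
  define y' where "y' = y ^ t"
  have "y' \<noteq> 1" using least[OF \<open>t > 0\<close>] \<open>t < n\<close> by (auto simp: y'_def)
  have y'l: "y' ^ l = 1" unfolding y'_def using n(2) t by (simp add: power_mult[symmetric] mult.commute)
  obtain k' where k': "k = Suc k'" using \<open>k > 0\<close> by (cases k) auto
  define u1 where "u1 = \<pi> ^ k' * (b + \<pi> * u)"
  have u1: "u1 \<in> local_R" unfolding u1_def using bL u by (intro local_mult local_power local_add)
  have "y = 1 + \<pi> * u1" unfolding u u1_def k' by (simp add: mult.assoc)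
  with one_plus_power[OF u1, of t] obtain v where v: "v \<in> local_R" "y' = 1 + \<pi> * u1 * v"
    by (auto simp: y'_def)
  define w where "w = u1 * v"
  have w: "w \<in> local_R" "y' = 1 + \<pi> * w" unfolding w_def using u1 v by (auto intro: local_mult simp: mult.assoc)
  have "y' - 1 \<noteq> 0" using \<open>y' \<noteq> 1\<close> by simp
  show False
  proof (cases "of_nat l = (0::'a)")
    case True
    have "y' ^ l = 1 + (y' - 1) ^ l" using freshman_prime[OF l(1) True, of "y' - 1"] by simp
    then have "(y' - 1) ^ l = 0" using y'l by simp
    then show False using \<open>y' - 1 \<noteq> 0\<close> by simp
  next
    case False
    have "(1 - y') * (\<Sum>i<l. y' ^ i) = 1 - y' ^ l" by (rule one_diff_geometric)
    then have s0: "(\<Sum>i<l. y' ^ i) = 0" using y'l \<open>y' - 1 \<noteq> 0\<close> by simp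
    obtain f where f: "\<And>i. f i \<in> local_R" "\<And>i. y' ^ i = 1 + \<pi> * w * f i"
      using one_plus_power[OF w(1)] w(2) by metis
    have "0 = of_nat l + \<pi> * (w * (\<Sum>i<l. f i))"
      unfolding s0[symmetric] f(2) by (simp add: sum.distrib sum_distrib_left mult.assoc)
    then have "of_nat l = \<pi> * (- (w * (\<Sum>i<l. f i)))"
      by (simp add: add_eq_0_iff2)
    moreover have "- (w * (\<Sum>i<l. f i)) \<in> local_R"
      using w f by (intro local_uminus local_mult local_sum) auto
    moreover have "of_nat l \<in> R" by (induction l) (auto intro: zero_R add_R one_R)
    ultimately show False using R_multiple_of_local_multiple primes[OF l(1) False] by blast
  qed
qed

end

section \<open>A root of unity normalised by another element\<close>

lemma finite_closed_power_one:
  fixes f :: "'a::division_ring"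
  assumes "finite T" "\<And>k. f ^ k \<in> T" "f \<noteq> 0"
  shows "\<exists>t>0. f ^ t = 1"
proof -
  have "\<not> inj (\<lambda>k::nat. f ^ k)"
    using assms(1,2) by (metis finite_imageD finite_subset image_subsetI infinite_UNIV_nat)
  then obtain k l where "k < l" "f ^ k = f ^ l"
    by (metis injI linorder_neqE_nat)
  moreover from \<open>k < l\<close> have "f ^ l = f ^ k * f ^ (l - k)" by (simp flip: power_add)
  ultimately have "f ^ k * f ^ (l - k) = f ^ k * 1" by simp
  with assms(3) have "f ^ (l - k) = 1" by (metis mult_left_cancel power_not_zero)
  with \<open>k < l\<close> show ?thesis by (intro exI[of _ "l - k"]) auto
qed

lemma sum_root_of_unity:
  fixes \<zeta> :: "'a::division_ring"
  assumes "\<zeta> ^ m = 1" "\<zeta> \<noteq> 1"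
  shows "(\<Sum>k<m. \<zeta> ^ k) = 0"
  using one_diff_geometric[of \<zeta> m] assms by simp

text \<open>Multiplying the sum of \<open>k * \<zeta> ^ k\<close> by \<open>1 - \<zeta>\<close>
  telescopes to a geometric sum, which vanishes, and a boundary term. The cofactor is an integer
  combination of powers of \<open>\<zeta>\<close>, so the divisibility holds inside the generated
  ring.\<close>

lemma one_minus_root_of_unity_dvd:
  fixes \<zeta> :: "'a::division_ring"
  assumes "\<zeta> ^ m = 1" "\<zeta> \<noteq> 1"
  shows "(1 - \<zeta>) * (- (\<Sum>k<m. of_nat k * \<zeta> ^ k)) = of_nat m"
proof -
  have "(1 - \<zeta>) * (\<Sum>k<n. of_nat k * \<zeta> ^ k) = \<zeta> * (\<Sum>k<n. \<zeta> ^ k) - of_nat n * \<zeta> ^ n" for n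
  proof (induction n)
    case (Suc n)
    have "\<zeta> * (of_nat n * \<zeta> ^ n) = of_nat n * \<zeta> ^ Suc n"
      unfolding mult.assoc[symmetric] mult_of_nat_commute[symmetric] by (simp add: mult.assoc)
    moreover have "of_nat (Suc n) * \<zeta> ^ Suc n = \<zeta> ^ Suc n + of_nat n * \<zeta> ^ Suc n"
      by (simp add: distrib_right)
    ultimately show ?case
      using Suc by (simp add: distrib_left left_diff_distrib del: of_nat_Suc)
  qed simp
  from this[of m] show ?thesis using assms sum_root_of_unity[OF assms] by simp
qed

text \<open>The powers of \<open>a\<close> form a finite group that \<open>x\<close> normalises but
  does not centralise. That \<open>m\<close> is nonzero in the division ring keeps sums over
  \<open>m\<close> conjugates of a commuting element from vanishing.\<close>

locale skew_pair =
  fixes a x :: "'a::division_ring" and m :: nat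
  assumes am: "a ^ m = 1" and m: "of_nat m \<noteq> (0::'a)" and x: "x \<noteq> 0"
    and xa: "\<exists>i. x * a = a ^ i * x" and noncommuting: "a * x \<noteq> x * a"
begin

lemma m_pos: "m > 0" using m by (cases m) auto

lemma a_nonzero: "a \<noteq> 0" using am m_pos by (metis zero_neq_one zero_power)

lemma inverse_a: "inverse a = a ^ (m - 1)"
proof (rule inverse_unique)
  show "a * a ^ (m - 1) = 1" using am m_pos by (simp flip: power_Suc)
qed

lemma a_power_mod: "a ^ k = a ^ (k mod m)"
proof -
  have "a ^ k = (a ^ m) ^ (k div m) * a ^ (k mod m)"
    by (simp add: power_mult[symmetric] power_add[symmetric])
  then show ?thesis by (simp add: am)
qed

lemma finite_powers: "finite (range (\<lambda>k. a ^ k))"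
proof -
  have "range (\<lambda>k. a ^ k) \<subseteq> (\<lambda>k. a ^ k) ` {..<m}"
  proof clarify
    fix k show "a ^ k \<in> (\<lambda>k. a ^ k) ` {..<m}"
      using a_power_mod[of k] m_pos by (intro image_eqI[of _ _ "k mod m"]) auto
  qed
  then show ?thesis by (rule finite_subset) simp
qed

definition normalizes where "normalizes y \<longleftrightarrow> y \<noteq> 0 \<and> (\<exists>i. y * a = a ^ i * y)"

lemma normalizes_x: "normalizes x" using x xa by (simp add: normalizes_def)

lemma normalizes_power:
  assumes "normalizes y" obtains l where "y * a ^ k = a ^ l * y"
proof -
  obtain i where i: "y * a = a ^ i * y" using assms by (auto simp: normalizes_def)
  have "y * a ^ k = a ^ (i * k) * y"
  proof (induction k)
    case (Suc k)
    have "y * a ^ Suc k = y * a ^ k * a" by (simp add: power_commutes mult.assoc)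
    also have "\<dots> = a ^ (i * k) * (y * a)" by (simp add: Suc mult.assoc)
    finally show ?case by (simp add: i mult.assoc[symmetric] power_add[symmetric] add.commute)
  qed simp
  then show thesis by (rule that)
qed

lemma normalizes_mult:
  assumes "normalizes y" "normalizes y'" shows "normalizes (y * y')"
proof -
  obtain i where i: "y' * a = a ^ i * y'" using assms by (auto simp: normalizes_def)
  obtain l where l: "y * a ^ i = a ^ l * y" using normalizes_power[OF assms(1)] .
  have "y * y' * a = a ^ l * (y * y')" by (simp add: mult.assoc i) (simp add: mult.assoc[symmetric] l)
  with assms show ?thesis by (auto simp: normalizes_def)
qed

lemma normalizes_pow: "normalizes y \<Longrightarrow> normalizes (y ^ j)"
  by (induction j) (auto intro: normalizes_mult simp: normalizes_def[of 1] intro!: exI[of _ 1])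

text \<open>Conjugation by \<open>y\<close> maps the finite set of powers of \<open>a\<close>
  injectively into itself, hence onto, so \<open>a\<close> is itself the conjugate of a
  power.\<close>

lemma normalizes_inverse:
  assumes "normalizes y" shows "normalizes (inverse y)"
proof -
  let ?P = "range (\<lambda>k. a ^ k)"
  have y: "y \<noteq> 0" using assms by (simp add: normalizes_def)
  have "(\<lambda>p. y * p * inverse y) ` ?P \<subseteq> ?P"
  proof (intro subsetI, elim imageE)
    fix u p k assume u: "u = y * p * inverse y" "p = a ^ k"
    obtain l where "y * a ^ k = a ^ l * y" using normalizes_power[OF assms] .
    then have "u = a ^ l * (y * inverse y)" unfolding u by (simp only: mult.assoc)
    with y show "u \<in> ?P" by simp
  qed
  moreover have "inj_on (\<lambda>p. y * p * inverse y) ?P"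
    using y by (simp add: inj_on_def)
  ultimately have "(\<lambda>p. y * p * inverse y) ` ?P = ?P"
    using endo_inj_surj[OF finite_powers] by simp
  moreover have "a \<in> ?P" by (rule range_eqI[of _ _ 1]) simp
  ultimately obtain p where p: "p \<in> ?P" "a = y * p * inverse y" by blast
  have "inverse y * (y * p * inverse y) = p * inverse y"
    using y by (simp add: mult.assoc[symmetric])
  then have "inverse y * a = p * inverse y" unfolding p(2)[symmetric] .
  with y p(1) show ?thesis by (auto simp: normalizes_def)
qed

lemma normalizes_commutator:
  assumes "normalizes y"
  obtains l where "a * y * inverse a = a ^ l * y"
proof -
  obtain i where i: "y * a ^ (m - 1) = a ^ i * y" using normalizes_power[OF assms] .
  have "a * y * inverse a = a ^ Suc i * y" unfolding inverse_a by (simp add: mult.assoc i[unfolded One_nat_def])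
  then show thesis by (rule that)
qed

text \<open>Conjugation by \<open>a\<close> multiplies \<open>y\<close> by a root of unity
  \<open>a ^ l\<close> different from 1, so the sum is a vanishing geometric sum. Averaging over
  conjugates thus keeps only the terms commuting with \<open>a\<close>; it takes the place of
  Dedekind's independence of characters.\<close>

lemma sum_conjugates_zero:
  assumes "normalizes y" "a * y \<noteq> y * a"
  shows "(\<Sum>k<m. a ^ k * y * inverse a ^ k) = 0"
proof -
  obtain l where l: "a * y * inverse a = a ^ l * y" using normalizes_commutator[OF assms(1)] .
  have "a ^ k * y * inverse a ^ k = (a ^ l) ^ k * y" for k
  proof (induction k)
    case (Suc k)
    have "a ^ Suc k * y * inverse a ^ Suc k = a * (a ^ k * y * inverse a ^ k) * inverse a"
      unfolding power_Suc2[of "inverse a"] power_Suc[of a] by (simp only: mult.assoc)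
    also have "\<dots> = a * (a ^ l) ^ k * (y * inverse a)" unfolding Suc by (simp only: mult.assoc)
    also have "a * (a ^ l) ^ k = (a ^ l) ^ k * a" by (simp add: power_mult[symmetric] power_commutes)
    also have "(a ^ l) ^ k * a * (y * inverse a) = (a ^ l) ^ k * (a * y * inverse a)"
      by (simp only: mult.assoc)
    also have "\<dots> = (a ^ l) ^ Suc k * y" unfolding l power_Suc2 by (simp only: mult.assoc)
    finally show ?case .
  qed simp
  then have "(\<Sum>k<m. a ^ k * y * inverse a ^ k) = (\<Sum>k<m. (a ^ l) ^ k) * y"
    by (simp add: sum_distrib_right)
  moreover have "a ^ l \<noteq> 1"
    using assms(2) l a_nonzero by (metis left_inverse mult.assoc mult_1_left mult_1_right)
  moreover have "(a ^ l) ^ m = 1" by (metis am mult.commute power_mult power_one)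
  ultimately show ?thesis using sum_root_of_unity[of "a ^ l" m] by simp
qed

lemma commuting_power: "\<exists>N>0. x ^ N * a = a * x ^ N"
proof -
  have "\<forall>n. \<exists>l. x ^ n * a = a ^ l * x ^ n"
    using normalizes_pow[OF normalizes_x] by (auto simp: normalizes_def)
  then obtain l where l: "\<And>n. x ^ n * a = a ^ l n * x ^ n" by metis
  have "\<not> inj (\<lambda>n. a ^ l n)"
    using finite_powers by (metis (no_types, lifting) finite_imageD finite_subset image_subsetI infinite_UNIV_nat rangeI)
  then obtain n1 n2 where n: "n1 < n2" "a ^ l n1 = a ^ l n2"
    by (metis injI linorder_neqE_nat)
  have e: "x ^ n2 = x ^ n1 * x ^ (n2 - n1)" using n(1) by (simp add: power_add[symmetric])
  have "x ^ n1 * (x ^ (n2 - n1) * a) = x ^ n1 * (a * x ^ (n2 - n1))"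
  proof -
    have "x ^ n1 * (x ^ (n2 - n1) * a) = x ^ n2 * a" by (simp only: e mult.assoc)
    also have "\<dots> = a ^ l n1 * x ^ n2" by (simp only: l n(2))
    also have "\<dots> = a ^ l n1 * x ^ n1 * x ^ (n2 - n1)" by (simp only: e mult.assoc)
    also have "\<dots> = x ^ n1 * (a * x ^ (n2 - n1))" by (simp only: l[symmetric] mult.assoc)
    finally show ?thesis .
  qed
  then have "x ^ (n2 - n1) * a = a * x ^ (n2 - n1)" using x by simp
  with n(1) show ?thesis by (intro exI[of _ "n2 - n1"]) auto
qed

section \<open>The ring generated by a skew pair\<close>

definition monomials where "monomials = {a ^ k * x ^ j |k j. True}"

text \<open>Monomials multiply to monomials because \<open>x\<close> can be moved past powers of
  \<open>a\<close>, so their additive span is already the ring generated by \<open>a\<close> and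
  \<open>x\<close>.\<close>

definition gen_ring where "gen_ring = group_closure monomials"

lemma monomial_gen_ring: "a ^ k * x ^ j \<in> gen_ring"
  unfolding gen_ring_def monomials_def by (rule group_closure.base) auto

lemma gen_ring_one: "1 \<in> gen_ring" using monomial_gen_ring[of 0 0] by simp
lemma gen_ring_a: "a ^ k \<in> gen_ring" using monomial_gen_ring[of k 0] by simp
lemma gen_ring_x: "x ^ j \<in> gen_ring" using monomial_gen_ring[of 0 j] by simp
lemma gen_ring_diff: "r \<in> gen_ring \<Longrightarrow> s \<in> gen_ring \<Longrightarrow> r - s \<in> gen_ring"
  unfolding gen_ring_def by (rule group_closure.diff)
lemma gen_ring_zero: "0 \<in> gen_ring" by (simp add: gen_ring_def)
lemma gen_ring_of_int_mult: "r \<in> gen_ring \<Longrightarrow> of_int k * r \<in> gen_ring"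
  unfolding gen_ring_def by (rule group_closure_of_int_mult)

lemma gen_ring_mult:
  assumes "r \<in> gen_ring" "s \<in> gen_ring" shows "r * s \<in> gen_ring"
  using assms unfolding gen_ring_def
proof (rule group_closure_mult_closed[rotated 1])
  fix s t assume "s \<in> monomials" "t \<in> monomials"
  then obtain k j k' j' where s: "s = a ^ k * x ^ j" "t = a ^ k' * x ^ j'"
    by (auto simp: monomials_def)
  obtain l where l: "x ^ j * a ^ k' = a ^ l * x ^ j"
    using normalizes_power[OF normalizes_pow[OF normalizes_x]] .
  have "s * t = a ^ k * (x ^ j * a ^ k') * x ^ j'" by (simp add: s mult.assoc)
  also have "\<dots> = a ^ (k + l) * x ^ (j + j')" by (simp add: l mult.assoc power_add)
  finally show "s * t \<in> group_closure monomials"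
    using monomial_gen_ring by (simp add: gen_ring_def)
qed

lemma gen_ring_power: "r \<in> gen_ring \<Longrightarrow> r ^ k \<in> gen_ring"
  by (induction k) (auto intro: gen_ring_one gen_ring_mult)

lemma gen_ring_inverse_a: "inverse a \<in> gen_ring"
  unfolding inverse_a by (rule gen_ring_a)

lemma gen_ring_central:
  assumes "g * a = a * g" "g * x = x * g" "r \<in> gen_ring"
  shows "r * g = g * r"
proof -
  have "g * (a ^ k * x ^ j) = a ^ k * x ^ j * g" for k j
  proof -
    have "g * (a ^ k * x ^ j) = a ^ k * (g * x ^ j)"
      using power_commutes'[of a g k] assms by (simp add: mult.assoc[symmetric])
    then show ?thesis using power_commutes'[of x g j] assms by (simp add: mult.assoc)
  qed
  then have "g * s = s * g" if "s \<in> monomials" for s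
    using that unfolding monomials_def by blast
  then show ?thesis
    using group_closure_commute assms(3) unfolding gen_ring_def by metis
qed

text \<open>The commutator of \<open>a\<close> and \<open>x\<close> is a root of unity \<open>1 - d\<close>, so \<open>d\<close> divides the integer \<open>m\<close>.\<close>

lemma commutator_root_of_unity:
  obtains d e where "d \<in> gen_ring" "e \<in> gen_ring" "x - a * x * inverse a = d * x" "a * d = d * a"
    "\<And>r. e ^ r * d ^ r = of_nat (m ^ r)"
proof -
  obtain l where l: "a * x * inverse a = a ^ l * x" using normalizes_commutator[OF normalizes_x] .
  define d where "d = 1 - a ^ l"
  define e where "e = - (\<Sum>k<m. of_nat k * (a ^ l) ^ k)"
  have root: "(a ^ l) ^ m = 1" by (metis am mult.commute power_mult power_one)
  have neq: "a ^ l \<noteq> 1"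
    using noncommuting l a_nonzero by (metis left_inverse mult.assoc mult_1_left mult_1_right)
  have de: "d * e = of_nat m"
    unfolding d_def e_def using root neq by (rule one_minus_root_of_unity_dvd)
  have "d \<noteq> 0" using neq by (simp add: d_def)
  have "e = inverse d * (d * e)" using \<open>d \<noteq> 0\<close> by (simp add: mult.assoc[symmetric])
  also have "\<dots> = of_nat m * inverse d" by (simp add: de mult_of_nat_commute)
  finally have ed: "e * d = of_nat m" using \<open>d \<noteq> 0\<close> by (simp add: mult.assoc)
  have "e ^ r * d ^ r = of_nat (m ^ r)" for r
  proof (induction r)
    case (Suc r)
    have "e ^ Suc r * d ^ Suc r = e ^ r * (e * d) * d ^ r"
      unfolding power_Suc2[of e] power_Suc[of d] by (simp only: mult.assoc)
    also have "\<dots> = of_nat m * (e ^ r * d ^ r)" 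
      unfolding ed by (simp only: mult_of_nat_commute[symmetric] mult.assoc)
    finally show ?case by (simp add: Suc)
  qed simp
  moreover have "d \<in> gen_ring" unfolding d_def by (intro gen_ring_diff gen_ring_one gen_ring_a)
  moreover have "e \<in> gen_ring"
  proof -
    have "of_nat k * (a ^ l) ^ k \<in> gen_ring" for k
      using gen_ring_of_int_mult[OF gen_ring_a[of "l * k"], of "int k"] by (simp add: power_mult)
    then have "(\<Sum>k<n. of_nat k * (a ^ l) ^ k) \<in> gen_ring" for n
      unfolding gen_ring_def by (induction n) (auto intro: group_closure_add)
    from gen_ring_diff[OF gen_ring_zero this, of m] show ?thesis by (simp add: e_def)
  qed
  moreover have "x - a * x * inverse a = d * x" unfolding l d_def by (simp add: left_diff_distrib)
  moreover have "a * d = d * a" unfolding d_def by (simp add: algebra_simps power_commutes)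
  ultimately show thesis using that by blast
qed

end

text \<open>Up to the factor \<open>m\<close>, \<open>g j\<close> is the component of
  \<open>y\<close> on which right multiplication by \<open>a\<close> acts as left multiplication by
  \<open>a ^ j\<close>. The components add up to \<open>m * y\<close>, so one of them fails to
  commute with \<open>a\<close>.\<close>

lemma exists_skew_pair:
  fixes a :: "'a::division_ring"
  assumes "M > 0" "a ^ M = 1" and y: "a * y \<noteq> y * a"
  shows "\<exists>x m. skew_pair a x m"
proof -
  have ex: "\<exists>M. M > 0 \<and> a ^ M = 1" using assms by blast
  define m where "m = (LEAST M. M > 0 \<and> a ^ M = 1)"
  have m: "m > 0" "a ^ m = 1" unfolding m_def using LeastI_ex[OF ex] by auto
  have least: "m \<le> M" if "M > 0" "a ^ M = 1" for M
    unfolding m_def using that by (intro Least_le) auto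
  have a: "a \<noteq> 0" using m by (metis zero_neq_one zero_power)
  \<comment> \<open>The exact order is prime to the characteristic: a characteristic
    \<open>l\<close> dividing \<open>m\<close> would give \<open>(a ^ t) ^ l = 1\<close> for
    \<open>m = l * t\<close>, hence \<open>a ^ t = 1\<close>.\<close>
  have m0: "of_nat m \<noteq> (0::'a)"
  proof
    assume m00: "of_nat m = (0::'a)"
    have "\<exists>l. prime l \<and> l dvd m \<and> of_nat l = (0::'a)"
    proof -
      have "of_nat n = (0::'a) \<Longrightarrow> n > 0 \<Longrightarrow> \<exists>l. prime l \<and> l dvd n \<and> of_nat l = (0::'a)" for n
      proof (induction n rule: less_induct)
        case (less n)
        then have "n \<noteq> 1" by auto
        then obtain l where l: "prime l" "l dvd n" using prime_factor_nat by blast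
        then obtain t where t: "n = l * t" by (elim dvdE)
        have "t > 0" "t < n" using t less(3) prime_gt_1_nat[OF l(1)] by auto
        have "of_nat l = (0::'a) \<or> of_nat t = (0::'a)" using less(2) t by simp
        then show ?case using less.IH[OF \<open>t < n\<close> _ \<open>t > 0\<close>] l t by (metis dvd_mult)
      qed
      then show ?thesis using m00 m by blast
    qed
    then obtain l where l: "prime l" "l dvd m" "of_nat l = (0::'a)" by blast
    then obtain t where t: "m = l * t" by (elim dvdE)
    have t2: "t > 0" "t < m" using t m(1) prime_gt_1_nat[OF l(1)] by auto
    have "(a ^ t) ^ l = 1 + (a ^ t - 1) ^ l" using freshman_prime[OF l(1,3), of "a ^ t - 1"] by simp
    moreover have "(a ^ t) ^ l = 1" using m t by (simp add: power_mult[symmetric] mult.commute)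
    ultimately have "a ^ t = 1" by simp
    then show False using least[of t] t2 by simp
  qed
  define g where "g j = (\<Sum>k<m. inverse a ^ (j * k) * y * a ^ k)" for j
  have ga: "g j * a = a ^ j * g j" for j
  proof -
    let ?h = "\<lambda>k. inverse a ^ (j * k) * y * a ^ k"
    have shift: "a ^ j * ?h (Suc k) = ?h k * a" for k
    proof -
      have "a ^ j * inverse a ^ (j * Suc k) = inverse a ^ (j * k)"
        using a by (simp add: power_add mult.assoc[symmetric] power_inverse)
      then have "a ^ j * ?h (Suc k) = inverse a ^ (j * k) * y * a ^ Suc k"
        by (simp add: mult.assoc[symmetric])
      then show ?thesis by (simp add: power_commutes mult.assoc)
    qed
    have "?h m = ?h 0" using m a by (simp add: mult.commute[of j] power_mult power_inverse)
    then have "sum ?h {..<m} = (\<Sum>k<m. ?h (Suc k))"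
      using sum.lessThan_Suc_shift[of ?h m] by simp
    then have "a ^ j * g j = (\<Sum>k<m. a ^ j * ?h (Suc k))"
      by (simp add: g_def sum_distrib_left)
    also have "\<dots> = g j * a" unfolding shift by (simp add: g_def sum_distrib_right)
    finally show ?thesis by simp
  qed
  have "\<exists>j<m. a * g j \<noteq> g j * a"
  proof (rule ccontr)
    assume "\<not> ?thesis"
    then have c: "a * g j = g j * a" if "j < m" for j using that by blast
    have "(\<Sum>j<m. g j) = (\<Sum>k<m. (\<Sum>j<m. (inverse a ^ k) ^ j) * y * a ^ k)"
      unfolding g_def by (subst sum.swap) (simp add: sum_distrib_right power_mult[symmetric] mult.commute)
    also have "\<dots> = (\<Sum>k<m. if k = 0 then of_nat m * y else 0)"
    proof (rule sum.cong)
      fix k assume k: "k \<in> {..<m}"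
      show "(\<Sum>j<m. (inverse a ^ k) ^ j) * y * a ^ k = (if k = 0 then of_nat m * y else 0)"
      proof (cases "k = 0")
        case False
        have "inverse a ^ k \<noteq> 1"
          using least[of k] k False by (metis inverse_1 inverse_inverse_eq lessThan_iff not_le neq0_conv power_inverse)
        moreover have "(inverse a ^ k) ^ m = 1"
          using m(2) by (metis inverse_1 mult.commute power_inverse power_mult power_one)
        ultimately show ?thesis using False sum_root_of_unity[of "inverse a ^ k" m] by simp
      qed simp
    qed simp
    also have "\<dots> = of_nat m * y" using m(1) by simp
    finally have s: "of_nat m * y = (\<Sum>j<m. g j)" by simp
    have "a * (\<Sum>j<m. g j) = (\<Sum>j<m. g j) * a"
      using c by (simp add: sum_distrib_left sum_distrib_right)
    then have "of_nat m * (a * y) = of_nat m * (y * a)"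
      unfolding s[symmetric] by (metis mult.assoc mult_of_nat_commute)
    then show False using m0 y by simp
  qed
  then obtain j where j: "a * g j \<noteq> g j * a" by blast
  have "skew_pair a (g j) m"
    by standard (use m m0 j ga[of j] in auto)
  then show ?thesis by blast
qed

section \<open>No skew pair generates a finite ring\<close>

lemma card_eq_sum_fibers:
  assumes "finite A" shows "card A = (\<Sum>v\<in>f ` A. card {u \<in> A. f u = v})"
  using sum.image_gen[OF assms, of "\<lambda>_. 1::nat" f] assms by simp

context skew_pair
begin

text \<open>A finite ring generated by a skew pair would contain an element \<open>w = c x\<close> with \<open>w\<^sup>N = 1\<close>, by
  surjectivity of the norm of the cyclic extension on which \<open>x\<close> acts; such a \<open>w\<close> gives a zero divisor.\<close>

lemma infinite_gen_ring: "infinite gen_ring"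
proof
  assume fin: "finite gen_ring"
  define N where "N = (LEAST N. N > 0 \<and> x ^ N * a = a * x ^ N)"
  have N: "N > 0" "x ^ N * a = a * x ^ N"
    unfolding N_def using LeastI_ex[OF commuting_power] by auto
  have N_least: "x ^ j * a \<noteq> a * x ^ j" if "0 < j" "j < N" for j
    using that not_less_Least[of j "\<lambda>N. N > 0 \<and> x ^ N * a = a * x ^ N"] unfolding N_def by blast
  define z where "z = x ^ N"
  have za: "z * a = a * z" using N by (simp add: z_def)
  have zx: "z * x = x * z" by (simp add: z_def power_commutes)
  have z0: "z \<noteq> 0" using x by (simp add: z_def)
  \<comment> \<open>\<open>F\<close> is the commutative ring generated by \<open>a\<close> and
    \<open>z = x ^ N\<close>; being finite inside a division ring, it is a field. Conjugation by
    \<open>x\<close> is an automorphism of \<open>F\<close>, of order \<open>N\<close> by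
    minimality.\<close>
  define S where "S = {a ^ k * z ^ j |k j. True}"
  define F where "F = group_closure S"
  have S_F: "a ^ k * z ^ j \<in> F" for k j
    unfolding F_def S_def by (rule group_closure.base) auto
  have za_pow: "z ^ j * a ^ k = a ^ k * z ^ j" for j k
    by (metis power_commutes' za)
  have F_diff: "f - g \<in> F" if "f \<in> F" "g \<in> F" for f g
    using that unfolding F_def by (rule group_closure.diff)
  have F_zero: "0 \<in> F" by (simp add: F_def)
  have F_add: "f + g \<in> F" if "f \<in> F" "g \<in> F" for f g
    using that unfolding F_def by (rule group_closure_add)
  have S_mult: "(a ^ k * z ^ j) * (a ^ k' * z ^ j') = a ^ (k + k') * z ^ (j + j')" for k j k' j'
  proof -
    have "(a ^ k * z ^ j) * (a ^ k' * z ^ j') = a ^ k * (z ^ j * a ^ k') * z ^ j'" by (simp only: mult.assoc)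
    then show ?thesis by (simp add: za_pow power_add mult.assoc)
  qed
  have F_mult: "f * g \<in> F" if "f \<in> F" "g \<in> F" for f g
  proof -
    have "s * t \<in> group_closure S" if "s \<in> S" "t \<in> S" for s t
      using that S_F S_mult unfolding S_def F_def by auto
    then show ?thesis using group_closure_mult_closed that unfolding F_def by blast
  qed
  have F_comm: "f * g = g * f" if f: "f \<in> F" and g: "g \<in> F" for f g
  proof -
    have "s * t = t * s" if "s \<in> S" "t \<in> S" for s t
      using that unfolding S_def by (auto simp: S_mult add.commute)
    then have "f * s = s * f" if "s \<in> S" for s
      using group_closure_commute[of f S s] f that unfolding F_def by metis
    then show ?thesis using group_closure_commute[of g S f] g unfolding F_def by metis
  qed
  have F_a: "a ^ k \<in> F" for k using S_F[of k 0] by simp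
  have F_one: "1 \<in> F" using F_a[of 0] by simp
  have F_z: "z \<in> F" using S_F[of 0 1] by simp
  have "S \<subseteq> monomials" unfolding S_def monomials_def z_def by (auto simp: power_mult[symmetric])
  then have "F \<subseteq> gen_ring" unfolding F_def gen_ring_def
    using group_closure_mapI[of _ S "\<lambda>u. u" monomials] by (auto intro: group_closure.base)
  with fin have finF: "finite F" by (rule rev_finite_subset)
  have F_power: "f ^ k \<in> F" if "f \<in> F" for f k
    using that by (induction k) (auto intro: F_one F_mult)
  have F_inverse: "inverse f \<in> F" if f: "f \<in> F" "f \<noteq> 0" for f
  proof -
    obtain t where t: "t > 0" "f ^ t = 1"
      using finite_closed_power_one[OF finF F_power[OF f(1)] f(2)] by blast
    then have "inverse f = f ^ (t - 1)"
      by (intro inverse_unique) (simp flip: power_Suc)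
    then show ?thesis using F_power f by simp
  qed
  have F_conj: "x ^ j * f * inverse (x ^ j) \<in> F" if f: "f \<in> F" for f j
  proof -
    have xj: "x ^ j \<noteq> 0" using x by simp
    show ?thesis unfolding F_def
    proof (rule group_closure_mapI[where f = "\<lambda>f. x ^ j * f * inverse (x ^ j)"])
      show "f \<in> group_closure S" using f by (simp add: F_def)
      fix s assume "s \<in> S"
      then obtain k i where s: "s = a ^ k * z ^ i" by (auto simp: S_def)
      obtain l where l: "x ^ j * a ^ k = a ^ l * x ^ j"
        using normalizes_power[OF normalizes_pow[OF normalizes_x]] .
      have xz: "x ^ j * z ^ i = z ^ i * x ^ j" by (metis power_commutes' zx)
      have "x ^ j * s = a ^ l * (x ^ j * z ^ i)" by (simp add: s mult.assoc[symmetric] l)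
      also have "\<dots> = a ^ l * z ^ i * x ^ j" by (simp add: xz mult.assoc)
      finally have "x ^ j * s * inverse (x ^ j) = a ^ l * z ^ i" using xj by (simp add: mult.assoc)
      then show "x ^ j * s * inverse (x ^ j) \<in> group_closure S" using S_F by (simp add: F_def)
    qed (simp add: algebra_simps)
  qed
  \<comment> \<open>For \<open>w = c * x\<close> the power \<open>w ^ N\<close> is the norm of
    \<open>c\<close> times \<open>z\<close>; working with \<open>w\<close> itself avoids naming the
    automorphism.\<close>
  define W where "W = (\<lambda>c. c * x) ` (F - {0})"
  have W_power: "\<exists>f\<in>F - {0}. w ^ j = f * x ^ j" if w: "w \<in> W" for w j
  proof -
    obtain c where c: "c \<in> F" "c \<noteq> 0" "w = c * x" using w by (auto simp: W_def)
    show ?thesis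
    proof (induction j)
      case 0
      show ?case using F_one by auto
    next
      case (Suc j)
      then obtain f where f: "f \<in> F" "f \<noteq> 0" "w ^ j = f * x ^ j" by auto
      have xj: "x ^ j \<noteq> 0" using x by simp
      have "w ^ Suc j = f * x ^ j * (c * x)" unfolding power_Suc2 f c(3)[symmetric] ..
      also have "\<dots> = f * (x ^ j * c * inverse (x ^ j)) * (x ^ j * x)"
        using xj by (simp add: mult.assoc) (simp add: mult.assoc[symmetric])
      also have "x ^ j * x = x ^ Suc j" by (simp add: power_commutes)
      finally have "w ^ Suc j = f * (x ^ j * c * inverse (x ^ j)) * x ^ Suc j" .
      moreover have "f * (x ^ j * c * inverse (x ^ j)) \<in> F - {0}"
        using f c xj F_conj F_mult by auto
      ultimately show ?case by blast
    qed
  qed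
  have W_normalizes: "normalizes w" if w: "w \<in> W" for w
  proof -
    obtain c where c: "c \<in> F" "c \<noteq> 0" "w = c * x" using w by (auto simp: W_def)
    obtain i where i: "x * a = a ^ i * x" using xa by blast
    have "w * a = c * a ^ i * x" by (simp add: c i mult.assoc)
    also have "\<dots> = a ^ i * w" using F_comm[OF c(1) F_a] by (simp add: c mult.assoc)
    finally show ?thesis using c x by (auto simp: normalizes_def)
  qed
  have W_noncomm: "w ^ j * a \<noteq> a * w ^ j" if "w \<in> W" "0 < j" "j < N" for w j
  proof
    assume *: "w ^ j * a = a * w ^ j"
    obtain f where f: "f \<in> F" "f \<noteq> 0" "w ^ j = f * x ^ j" using W_power \<open>w \<in> W\<close> by blast
    have "f * (x ^ j * a) = a * f * x ^ j" using * f by (simp add: mult.assoc)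
    also have "a * f = f * a" using F_comm[OF f(1) F_a[of 1]] by simp
    finally have "x ^ j * a = a * x ^ j" using f(2) by (simp add: mult.assoc)
    then show False using N_least that by blast
  qed
  have W_nonzero: "w \<noteq> 0" if "w \<in> W" for w using that x by (auto simp: W_def)
  define Fx where "Fx = {f \<in> F - {0}. f * x = x * f}"
  have pow_Fx: "w ^ N \<in> Fx" if w: "w \<in> W" for w
  proof -
    obtain c where c: "c \<in> F" "c \<noteq> 0" "w = c * x" using w by (auto simp: W_def)
    obtain f where f: "f \<in> F" "f \<noteq> 0" "w ^ N = f * x ^ N" using W_power w by blast
    then have wN: "w ^ N \<in> F" using F_mult F_z by (simp add: z_def)
    have "w ^ N * w = w * w ^ N" by (simp add: power_commutes)
    then have "w ^ N * c * x = c * (x * w ^ N)" by (simp add: c(3) mult.assoc)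
    also have "w ^ N * c = c * w ^ N" using F_comm wN c by blast
    finally have "w ^ N * x = x * w ^ N" using c(2) by (simp add: mult.assoc)
    then show ?thesis using wN W_nonzero[OF w] by (simp add: Fx_def)
  qed
  \<comment> \<open>Hilbert 90 in the form that elements of \<open>W\<close> with equal norms are
    conjugate under the nonzero elements of \<open>F\<close>. The Lagrange resolvents
    \<open>b k\<close> satisfy \<open>w' * b k = b k * w\<close>.\<close>
  have conj: "\<exists>b\<in>F - {0}. w' = b * w * inverse b" if w: "w \<in> W" "w' \<in> W" "w ^ N = w' ^ N" for w w'
  proof -
    have w0: "w \<noteq> 0" "w' \<noteq> 0" using w W_nonzero by auto
    define b where "b k = (\<Sum>j<N. w' ^ j * a ^ k * inverse w ^ j)" for k
    have bF: "b k \<in> F" for k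
    proof -
      have "w' ^ j * a ^ k * inverse w ^ j \<in> F" for j
      proof -
        obtain f where f: "f \<in> F" "f \<noteq> 0" "w ^ j = f * x ^ j" using W_power w by blast
        obtain f' where f': "f' \<in> F" "f' \<noteq> 0" "w' ^ j = f' * x ^ j" using W_power w by blast
        have "inverse w ^ j = inverse (x ^ j) * inverse f"
          using f(3) f(2) x by (simp add: power_inverse nonzero_inverse_mult_distrib)
        then have "w' ^ j * a ^ k * inverse w ^ j = f' * (x ^ j * a ^ k * inverse (x ^ j)) * inverse f"
          by (simp add: f'(3) mult.assoc)
        then show ?thesis using F_mult F_conj F_inverse f f' F_a by simp
      qed
      then have "(\<Sum>j<n. w' ^ j * a ^ k * inverse w ^ j) \<in> F" for n
        by (induction n) (auto intro: F_zero F_add)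
      then show ?thesis by (simp add: b_def)
    qed
    \<comment> \<open>Averaging over \<open>k\<close> isolates the term \<open>j = 0\<close>, so the
      resolvents cannot all vanish.\<close>
    have "\<exists>k<m. b k \<noteq> 0"
    proof (rule ccontr)
      assume "\<not> ?thesis"
      then have "0 = (\<Sum>k<m. b k * inverse a ^ k)" by simp
      also have "\<dots> = (\<Sum>j<N. w' ^ j * (\<Sum>k<m. a ^ k * inverse w ^ j * inverse a ^ k))"
        unfolding b_def by (subst sum_distrib_right, subst sum.swap) (simp add: sum_distrib_left mult.assoc)
      also have "\<dots> = (\<Sum>j<N. if j = 0 then of_nat m else 0)"
      proof (rule sum.cong)
        fix j assume j: "j \<in> {..<N}"
        show "w' ^ j * (\<Sum>k<m. a ^ k * inverse w ^ j * inverse a ^ k) = (if j = 0 then of_nat m else 0)"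
        proof (cases "j = 0")
          case True
          then show ?thesis using a_nonzero by (simp add: power_inverse)
        next
          case False
          have wj: "w ^ j * a \<noteq> a * w ^ j" using W_noncomm w j False by simp
          have "a * inverse w ^ j \<noteq> inverse w ^ j * a"
            using inverse_commute[of "inverse w ^ j" a] wj by (auto simp: power_inverse)
          moreover have "normalizes (inverse w ^ j)"
            using w by (intro normalizes_pow normalizes_inverse W_normalizes)
          ultimately show ?thesis using False sum_conjugates_zero by simp
        qed
      qed simp
      also have "\<dots> = of_nat m" using N(1) by simp
      finally show False using m by simp
    qed
    then obtain k where k: "b k \<noteq> 0" by blast
    let ?h = "\<lambda>j. w' ^ j * a ^ k * inverse w ^ j"
    have "w' * b k * inverse w = (\<Sum>j<N. ?h (Suc j))"
      unfolding b_def sum_distrib_left sum_distrib_right power_Suc2[of "inverse w"] power_Suc[of w']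
      by (simp only: mult.assoc)
    also have "\<dots> = (\<Sum>j<N. ?h j)"
    proof -
      have "?h N = w ^ N * a ^ k * inverse w ^ N" using w(3) by simp
      also have "w ^ N * a ^ k = a ^ k * w ^ N"
        using pow_Fx[OF w(1)] F_comm F_a by (simp add: Fx_def)
      finally have "?h N = ?h 0" using w0 by (simp add: mult.assoc power_inverse)
      then show ?thesis using sum.lessThan_Suc_shift[of ?h N] by simp
    qed
    finally have "w' * b k * inverse w = b k" by (simp add: b_def)
    then have "w' * b k = b k * w" using w0 by (metis left_inverse mult.assoc mult_1_right)
    then have "w' = b k * w * inverse (b k)" using k by (metis mult.assoc mult_1_right right_inverse)
    then show ?thesis using bF k by blast
  qed
  have finFs: "finite (F - {0})" "finite Fx" using finF by (auto simp: Fx_def)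
  have Fx_pos: "card Fx > 0" using finFs F_one by (auto simp: card_gt_0_iff Fx_def)
  have cardX: "card W = card (F - {0})"
    unfolding W_def using x by (intro card_image) (simp add: inj_on_def)
  have finX: "finite W" unfolding W_def using finFs by simp
  \<comment> \<open>Elements of \<open>Fx\<close> commute with \<open>w\<close>, so each fibre of
    the conjugation map contains a translate of \<open>Fx\<close>.\<close>
  have orbit: "card ((\<lambda>b. b * w * inverse b) ` (F - {0})) * card Fx \<le> card (F - {0})" if w: "w \<in> W" for w
  proof -
    obtain c where c: "c \<in> F" "c \<noteq> 0" "w = c * x" using w by (auto simp: W_def)
    let ?f = "\<lambda>b. b * w * inverse b"
    have "card Fx \<le> card {u \<in> F - {0}. ?f u = v}" if v: "v \<in> ?f ` (F - {0})" for v
    proof -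
      obtain b where b: "b \<in> F" "b \<noteq> 0" "v = ?f b" using v by auto
      have "(\<lambda>u. b * u) ` Fx \<subseteq> {u \<in> F - {0}. ?f u = v}"
      proof clarify
        fix u assume u: "u \<in> Fx"
        then have u': "u \<in> F" "u \<noteq> 0" "u * x = x * u" by (auto simp: Fx_def)
        have "u * w = w * u" using F_comm[OF u'(1) c(1)] u'(3) by (metis c(3) mult.assoc)
        then have "u * w * inverse u = w" using u' by (simp add: mult.assoc)
        then have "?f (b * u) = v"
          using b u' by (simp add: nonzero_inverse_mult_distrib mult.assoc)
            (simp add: mult.assoc[symmetric])
        then show "b * u \<in> F - {0} \<and> ?f (b * u) = v" using b u' F_mult by auto
      qed
      moreover have "card ((\<lambda>u. b * u) ` Fx) = card Fx" using b by (intro card_image) (simp add: inj_on_def)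
      moreover have "finite {u \<in> F - {0}. ?f u = v}" using finFs(1) by (rule rev_finite_subset) blast
      ultimately show ?thesis using card_mono by metis
    qed
    then have "(\<Sum>v\<in>?f ` (F - {0}). card Fx) \<le> (\<Sum>v\<in>?f ` (F - {0}). card {u \<in> F - {0}. ?f u = v})"
      by (rule sum_mono)
    also have "\<dots> = card (F - {0})" using card_eq_sum_fibers[OF finFs(1), of ?f] by simp
    finally show ?thesis by simp
  qed
  let ?g = "\<lambda>w. w ^ N"
  have gX: "?g ` W \<subseteq> Fx" using pow_Fx by blast
  \<comment> \<open>Each fibre of \<open>w \<mapsto> w ^ N\<close> lies in one conjugation orbit, of
    size at most \<open>card (F - {0}) / card Fx\<close>. So the image has at least
    \<open>card Fx\<close> elements and is all of \<open>Fx\<close>; in particular it contains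
    1.\<close>
  have "card (F - {0}) * card Fx = (\<Sum>v\<in>?g ` W. card {u \<in> W. ?g u = v}) * card Fx"
    using card_eq_sum_fibers[OF finX, of ?g] cardX by simp
  also have "\<dots> = (\<Sum>v\<in>?g ` W. card {u \<in> W. ?g u = v} * card Fx)" by (simp add: sum_distrib_right)
  also have "\<dots> \<le> (\<Sum>v\<in>?g ` W. card (F - {0}))"
  proof (rule sum_mono)
    fix v assume "v \<in> ?g ` W"
    then obtain w where w: "w \<in> W" "v = w ^ N" by blast
    have "{u \<in> W. ?g u = v} \<subseteq> (\<lambda>b. b * w * inverse b) ` (F - {0})"
    proof
      fix u assume "u \<in> {u \<in> W. ?g u = v}"
      then obtain b where "b \<in> F - {0}" "u = b * w * inverse b"
        using conj[OF w(1), of u] w(2) by auto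
      then show "u \<in> (\<lambda>b. b * w * inverse b) ` (F - {0})" by blast
    qed
    then have "card {u \<in> W. ?g u = v} \<le> card ((\<lambda>b. b * w * inverse b) ` (F - {0}))"
      using finFs by (intro card_mono) auto
    then show "card {u \<in> W. ?g u = v} * card Fx \<le> card (F - {0})"
      using orbit[OF w(1)] by (meson mult_le_mono1 order_trans)
  qed
  finally have "card (F - {0}) * card Fx \<le> card (F - {0}) * card (?g ` W)" by (simp add: mult.commute)
  moreover have "card (F - {0}) > 0" using finFs F_one by (auto simp: card_gt_0_iff)
  ultimately have "card Fx \<le> card (?g ` W)" by simp
  with gX have "?g ` W = Fx" using finFs card_seteq by blast
  moreover have "1 \<in> Fx" using F_one by (simp add: Fx_def)
  ultimately obtain w where w: "w \<in> W" "w ^ N = 1" by (metis (no_types, lifting) imageE)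
  obtain c where c: "c \<in> F" "c \<noteq> 0" "w = c * x" using w by (auto simp: W_def)
  have "w \<noteq> 1"
  proof
    assume "w = 1"
    then have "x = inverse c" using c by (metis inverse_unique)
    then have "x \<in> F" using F_inverse c by simp
    then have "a * x = x * a" using F_comm F_a[of 1] by simp
    then show False using noncommuting by simp
  qed
  \<comment> \<open>The powers of \<open>w\<close> add up to zero, but averaging this sum over
    conjugates by powers of \<open>a\<close> leaves only the contribution \<open>m\<close> of
    \<open>j = 0\<close>.\<close>
  then have "(\<Sum>j<N. w ^ j) = 0" using one_diff_geometric[of w N] w by simp
  then have "0 = (\<Sum>k<m. a ^ k * (\<Sum>j<N. w ^ j) * inverse a ^ k)" by simp
  also have "\<dots> = (\<Sum>j<N. \<Sum>k<m. a ^ k * w ^ j * inverse a ^ k)"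
    by (subst sum.swap) (simp add: sum_distrib_left sum_distrib_right)
  also have "\<dots> = (\<Sum>j<N. if j = 0 then of_nat m else 0)"
  proof (rule sum.cong)
    fix j assume j: "j \<in> {..<N}"
    show "(\<Sum>k<m. a ^ k * w ^ j * inverse a ^ k) = (if j = 0 then of_nat m else 0)"
    proof (cases "j = 0")
      case True
      then show ?thesis using a_nonzero by (simp add: power_inverse)
    next
      case False
      then have "w ^ j * a \<noteq> a * w ^ j" using W_noncomm[OF w(1)] j by simp
      then have "a * w ^ j \<noteq> w ^ j * a" by (rule not_sym)
      then show ?thesis
        using False sum_conjugates_zero[OF normalizes_pow[OF W_normalizes[OF w(1)]]] by simp
    qed
  qed simp
  also have "\<dots> = of_nat m" using N(1) by simp
  finally show False using m by simp
qed

end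

text \<open>This collects what the descent along the chain uses. \<open>not_multiple\<close> ranges
  over all \<open>r\<close>, as each normal step puts one more factor \<open>d\<close> into the
  leading coefficient and the number of steps is arbitrary; \<open>primes\<close> excludes
  torsion.\<close>

locale adic_skew = subring_with_center_element R \<pi> for R :: "'a::division_ring set" and \<pi> +
  fixes a x d
  assumes a_R: "a \<in> R" "inverse a \<in> R" "a \<noteq> 0" and x_R: "x \<in> R" and d_R: "d \<in> R"
    and x_central_power: "\<exists>N>0. x ^ N \<in> center_R"
    and commutator_x: "x - a * x * inverse a = d * x" and d_commute: "a * d = d * a"
    and not_multiple: "\<And>r s. s \<in> R \<Longrightarrow> d ^ r * x \<noteq> \<pi> * s"
    and primes: "\<And>l s. prime l \<Longrightarrow> of_nat l \<noteq> (0::'a) \<Longrightarrow> s \<in> R \<Longrightarrow> of_nat l \<noteq> \<pi> * s"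
    and pi_nonzero: "\<pi> \<noteq> 0"
begin

lemma coefficient_R: "d ^ r * x \<in> R" by (intro mult_R power_R d_R x_R)

lemma lead_commutator_power:
  assumes "lead k (d ^ r * x) y" "k > 0"
  shows "lead k (d ^ Suc r * x) (y * a * inverse y * inverse a)"
proof -
  have c: "a * d ^ r = d ^ r * a" using power_commutes'[of d a r] d_commute by simp
  have "d ^ r * x - a * (d ^ r * x) * inverse a = d ^ r * (x - a * x * inverse a)"
    by (simp add: right_diff_distrib) (simp add: mult.assoc[symmetric] c)
  also have "\<dots> = d ^ Suc r * x" unfolding commutator_x power_Suc2 by (simp only: mult.assoc)
  finally show ?thesis using lead_commutator[OF assms coefficient_R a_R] by simp
qed

lemma lead_one_plus: "k > 0 \<Longrightarrow> lead k (d ^ 0 * x) (1 + \<pi> ^ k * x)"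
  using lead_basic x_central_power x_R by auto

lemma lead_infinite_order:
  "lead k (d ^ r * x) y \<Longrightarrow> k > 0 \<Longrightarrow> M > 0 \<Longrightarrow> y ^ M \<noteq> 1"
  using lead_not_torsion[OF _ _ coefficient_R] not_multiple primes pi_nonzero by blast

end

section \<open>Choice of the central element\<close>

context skew_pair
begin

lemma adic_skew_gen_ringI:
  assumes \<pi>: "\<pi> \<in> gen_ring" "\<pi> * a = a * \<pi>" "\<pi> * x = x * \<pi>" "\<pi> \<noteq> 0"
    and proper: "\<And>r. r \<in> gen_ring \<Longrightarrow> \<pi> * r \<noteq> 1"
    and d: "d \<in> gen_ring" "x - a * x * inverse a = d * x" "a * d = d * a"
    and nm: "\<And>r s. s \<in> gen_ring \<Longrightarrow> d ^ r * x \<noteq> \<pi> * s"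
    and primes: "\<And>l s. prime l \<Longrightarrow> of_nat l \<noteq> (0::'a) \<Longrightarrow> s \<in> gen_ring \<Longrightarrow> of_nat l \<noteq> \<pi> * s"
  shows "adic_skew gen_ring \<pi> a x d"
proof -
  interpret subring_with_center_element gen_ring \<pi>
    by standard (fact gen_ring_one gen_ring_diff gen_ring_mult \<pi>(1) gen_ring_central[OF \<pi>(2,3)] proper)+
  show ?thesis
  proof
    obtain N where N: "N > 0" "x ^ N * a = a * x ^ N" using commuting_power by blast
    have "x ^ N \<in> center_R"
      unfolding center_R_def using gen_ring_x gen_ring_central[OF N(2)] by (simp add: power_commutes)
    with N(1) show "\<exists>N>0. x ^ N \<in> center_R" by blast
  qed (use d \<pi> nm primes a_nonzero gen_ring_a[of 1] gen_ring_x[of 1] gen_ring_inverse_a in auto)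
qed

text \<open>The central element is \<open>x ^ N\<close>. Multiplying
  \<open>d ^ r * x = x ^ N * s\<close> by \<open>e ^ r\<close> turns the left side into
  \<open>m ^ r * x\<close>; cancelling one \<open>x\<close> exhibits the nonzero integer
  \<open>m ^ r\<close> as a multiple of \<open>x\<close>, which \<open>no_int\<close>
  forbids.\<close>

lemma adic_skew_x_adic:
  assumes no_int: "\<And>c f. of_int c \<noteq> (0::'a) \<Longrightarrow> f \<in> gen_ring \<Longrightarrow> of_int c \<noteq> x * f"
  shows "\<exists>\<pi> d. adic_skew gen_ring \<pi> a x d"
proof -
  obtain d e where d: "d \<in> gen_ring" "e \<in> gen_ring" "x - a * x * inverse a = d * x" "a * d = d * a"
    and ed: "\<And>r. e ^ r * d ^ r = of_nat (m ^ r)"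
    by (rule commutator_root_of_unity) blast
  obtain N where N: "N > 0" "x ^ N * a = a * x ^ N" using commuting_power by blast
  \<comment> \<open>\<open>N = 1\<close> is impossible because \<open>x\<close> does not commute
    with \<open>a\<close>; a second factor \<open>x\<close> must survive the cancellation
    below.\<close>
  have "N \<noteq> 1" using N noncommuting by auto
  with N have "N \<ge> 2" by simp
  then obtain n where n: "N = Suc (Suc n)" by (metis add_2_eq_Suc le_Suc_ex)
  have xN: "x ^ N * r = x * (x * (x ^ n * r))" for r by (simp add: n mult.assoc)
  have "adic_skew gen_ring (x ^ N) a x d"
  proof (rule adic_skew_gen_ringI)
    show "x ^ N * r \<noteq> 1" if "r \<in> gen_ring" for r
    proof
      assume "x ^ N * r = 1"
      then have "of_int 1 = x * (x * (x ^ n * r))" by (simp only: xN of_int_1)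
      moreover have "x * (x ^ n * r) \<in> gen_ring"
        using that gen_ring_x[of 1] gen_ring_x gen_ring_mult by simp
      ultimately show False using no_int[of 1] by simp
    qed
    show "of_nat l \<noteq> x ^ N * s" if "s \<in> gen_ring" "of_nat l \<noteq> (0::'a)" for l :: nat and s
    proof
      assume "of_nat l = x ^ N * s"
      then have "of_int (int l) = x * (x * (x ^ n * s))" by (simp only: xN of_int_of_nat_eq)
      moreover have "x * (x ^ n * s) \<in> gen_ring"
        using that gen_ring_x[of 1] gen_ring_x gen_ring_mult by simp
      ultimately show False using no_int[of "int l"] that(2) by (metis of_int_of_nat_eq)
    qed
    show "d ^ r * x \<noteq> x ^ N * s" if s: "s \<in> gen_ring" for r s
    proof
      assume *: "d ^ r * x = x ^ N * s"
      have eN: "e ^ r * x ^ N = x ^ N * e ^ r"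
        using gen_ring_central[OF N(2) _ gen_ring_power[OF d(2)]] by (simp add: power_commutes)
      have "x * of_nat (m ^ r) = of_nat (m ^ r) * x" by (simp only: mult_of_nat_commute)
      also have "\<dots> = e ^ r * (d ^ r * x)" by (simp only: ed[symmetric] mult.assoc)
      also have "\<dots> = x ^ N * (e ^ r * s)" unfolding * by (simp only: mult.assoc[symmetric] eN)
      finally have "of_nat (m ^ r) = x * (x ^ n * (e ^ r * s))"
        using x by (simp only: xN mult_left_cancel simp_thms)
      then have "of_int (int (m ^ r)) = x * (x ^ n * (e ^ r * s))" by (simp only: of_int_of_nat_eq)
      moreover have "x ^ n * (e ^ r * s) \<in> gen_ring"
        using s gen_ring_x d gen_ring_mult gen_ring_power by simp
      moreover have "of_int (int (m ^ r)) \<noteq> (0::'a)" using m by simp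
      ultimately show False by (metis no_int)
    qed
  qed (use N d x gen_ring_x in \<open>auto simp: power_commutes\<close>)
  then show ?thesis by blast
qed

text \<open>The central element is \<open>p ^ 2\<close> for a large prime \<open>p\<close>. The
  square matters for torsion: \<open>p\<close> is trivially a multiple of itself, whereas
  \<open>p = p ^ 2 * s\<close> would make \<open>p\<close> invertible in the ring and hence a
  divisor of \<open>x\<close>.\<close>

lemma adic_skew_p_adic:
  assumes char0: "\<And>k::int. k \<noteq> 0 \<Longrightarrow> of_int k \<noteq> (0::'a)"
    and fg: "finite S" "gen_ring = group_closure S"
  shows "\<exists>\<pi> d. adic_skew gen_ring \<pi> a x d"
proof -
  obtain q0 where q0: "\<And>q r. r \<in> gen_ring \<Longrightarrow> x = of_int q * r \<Longrightarrow> q \<le> q0"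
    using group_closure_divisibility_bounded[OF fg(1) char0 x] fg(2) by auto
  \<comment> \<open>Beyond \<open>q0\<close>, \<open>p\<close> does not divide \<open>x\<close>;
    beyond \<open>m\<close>, it is prime to every \<open>m ^ r\<close>.\<close>
  obtain p where p: "prime p" "p > max (nat q0) m"
    using bigger_prime by blast
  then have pq: "int p > q0" by auto
  have p1: "p > 1" using p(1) by (rule prime_gt_1_nat)
  obtain d e where d: "d \<in> gen_ring" "e \<in> gen_ring" "x - a * x * inverse a = d * x" "a * d = d * a"
    and ed: "\<And>r. e ^ r * d ^ r = of_nat (m ^ r)"
    by (rule commutator_root_of_unity) blast
  have not_dvd: "x \<noteq> of_nat p * r" if "r \<in> gen_ring" for r
    using q0[of r "int p"] that pq by auto
  have gx: "x \<in> gen_ring" using gen_ring_x[of 1] by simp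
  have nat_left: "y * (of_nat k * z) = of_nat k * (y * z)" for k and y z :: 'a
    by (metis mult.assoc mult_of_nat_commute)
  \<comment> \<open>By Bezout, an integer \<open>k\<close> prime to \<open>p\<close> can be removed
    from a divisibility by \<open>p\<close>, which would leave \<open>p\<close> dividing
    \<open>x\<close>.\<close>
  have coprime_multiple: False
    if "coprime k p" "s \<in> gen_ring" "of_nat k * x = of_nat p * s" for k s
  proof -
    have "gcd (int k) (int p) = 1" using that(1) by simp
    then obtain u v where "u * int k + v * int p = 1"
      using bezout_int[of "int k" "int p"] by metis
    then have "x = of_int (u * int k + v * int p) * x" by simp
    also have "\<dots> = of_int u * (of_nat k * x) + of_int v * (of_nat p * x)"
      by (simp add: distrib_right mult.assoc)
    also have "\<dots> = of_nat p * (of_int u * s + of_int v * x)"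
      by (simp only: that(3) nat_left[of "of_int _"] distrib_left)
    finally have "x = of_nat p * (of_int u * s + of_int v * x)" .
    moreover have "of_int u * s + of_int v * x \<in> gen_ring"
      using gen_ring_of_int_mult[OF that(2)] gen_ring_of_int_mult[OF gx]
      unfolding gen_ring_def by (rule group_closure_add)
    ultimately show False using not_dvd by blast
  qed
  have p2: "of_nat (p ^ 2) * s = of_nat p * (of_nat p * s)" for s :: 'a
    by (simp add: power2_eq_square mult.assoc)
  have gp: "of_nat k * s \<in> gen_ring" if "s \<in> gen_ring" for k s
    using gen_ring_of_int_mult[OF that, of "int k"] by simp
  have one: "of_nat p * r \<noteq> 1" if "r \<in> gen_ring" for r
  proof
    assume "of_nat p * r = 1"
    then have "x = of_nat p * (r * x)" by (simp add: mult.assoc[symmetric])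
    then show False using not_dvd gen_ring_mult[OF that gx] by blast
  qed
  have "adic_skew gen_ring (of_nat (p ^ 2)) a x d"
  proof (rule adic_skew_gen_ringI)
    show "of_nat (p ^ 2) \<in> gen_ring" using gp[OF gen_ring_one, of "p ^ 2"] by simp
    show "of_nat (p ^ 2) * r \<noteq> 1" if "r \<in> gen_ring" for r
      unfolding p2 using one gp that by blast
    show "of_nat (p ^ 2) \<noteq> (0::'a)" using char0[of "int (p ^ 2)"] p1 by simp
    show "d ^ r * x \<noteq> of_nat (p ^ 2) * s" if s: "s \<in> gen_ring" for r s
    proof
      assume *: "d ^ r * x = of_nat (p ^ 2) * s"
      have "of_nat (m ^ r) * x = e ^ r * (d ^ r * x)" by (simp only: ed[symmetric] mult.assoc)
      also have "\<dots> = of_nat p * (e ^ r * (of_nat p * s))"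
        unfolding * p2 by (rule nat_left)
      finally have "of_nat (m ^ r) * x = of_nat p * (e ^ r * (of_nat p * s))" .
      moreover have "coprime (m ^ r) p"
      proof -
        have "\<not> p dvd m" using p(2) m_pos by (auto dest: dvd_imp_le)
        then show ?thesis using p(1) prime_imp_coprime[of p m] by (simp add: coprime_commute)
      qed
      moreover have "e ^ r * (of_nat p * s) \<in> gen_ring"
        using s d(2) by (intro gen_ring_mult gen_ring_power gp)
      ultimately show False using coprime_multiple by blast
    qed
    show "of_nat l \<noteq> of_nat (p ^ 2) * s" if l: "prime l" and s: "s \<in> gen_ring" for l s
    proof
      assume *: "of_nat l = of_nat (p ^ 2) * s"
      show False
      proof (cases "l = p")
        case True
        then have "of_nat p * 1 = of_nat p * (of_nat p * s)" using * p2 by simp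
        moreover have "of_nat p \<noteq> (0::'a)" using char0[of "int p"] p1 by simp
        ultimately have "of_nat p * s = 1" by simp
        then show False using one s by blast
      next
        case False
        then have "coprime l p" using l p(1) by (simp add: primes_coprime)
        moreover have "of_nat l * x = of_nat p * (of_nat p * s * x)" by (simp only: * p2 mult.assoc)
        moreover have "of_nat p * s * x \<in> gen_ring" using s gx by (intro gen_ring_mult gp)
        ultimately show False using coprime_multiple by blast
      qed
    qed
  qed (fact mult_of_nat_commute d)+
  then show ?thesis by blast
qed

text \<open>If \<open>c = x f\<close> for a nonzero integer \<open>c\<close>, then \<open>c x\<^sup>-\<^sup>1\<close> is integral over \<open>\<int>[a]\<close>:
  multiplying by a high power of \<open>x\<^sup>-\<^sup>1\<close> makes \<open>c\<close> the leading coefficient.\<close>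

lemma finitely_generated_pair:
  assumes c: "of_int c \<noteq> (0::'a)" and f: "f \<in> gen_ring" "of_int c = x * f"
  shows "\<exists>x' S. skew_pair a x' m \<and> finite S \<and> skew_pair.gen_ring a x' = group_closure S"
proof -
  define w where "w = inverse x"
  have w0: "w \<noteq> 0" using x by (simp add: w_def)
  define x' where "x' = of_int c * w"
  have normw: "normalizes w" unfolding w_def by (intro normalizes_inverse normalizes_x)
  obtain i where i: "w * a = a ^ i * w" using normw by (auto simp: normalizes_def)
  have cc: "of_int c * y = y * of_int c" for y :: 'a by (rule mult_of_int_commute)
  have "x' * a = of_int c * a ^ i * w" unfolding x'_def by (simp only: mult.assoc i)
  also have "of_int c * a ^ i = a ^ i * of_int c" by (rule cc)
  finally have x'a: "x' * a = a ^ i * x'" unfolding x'_def by (simp only: mult.assoc)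
  interpret Y: skew_pair a x' m
  proof
    show "x' \<noteq> 0" using c w0 by (simp add: x'_def)
    show "\<exists>i. x' * a = a ^ i * x'" using x'a by blast
    show "a * x' \<noteq> x' * a"
    proof
      assume "a * x' = x' * a"
      then have "of_int c * (a * w) = of_int c * (w * a)"
        unfolding x'_def mult.assoc[symmetric] cc[of a] .
      then have "w * a = a * w" using c by simp
      then have "inverse w * a = a * inverse w" by (rule inverse_commute)
      then show False using noncommuting by (simp add: w_def)
    qed
  qed (use am m in auto)
  \<comment> \<open>\<open>W L\<close> collects the combinations with exponents of \<open>w\<close>
    below \<open>L\<close>. Every term of \<open>x * f\<close> contains a factor \<open>x\<close>,
    so multiplication by \<open>w ^ L\<close> for large \<open>L\<close> lands there, while it turns
    the integer \<open>c\<close> into \<open>c * w ^ L\<close>.\<close>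
  define W where "W L = group_closure {a ^ k * w ^ t |k t. t < L}" for L
  have "\<exists>L0. \<forall>L\<ge>L0. x * f * w ^ L \<in> W L"
    using f(1) unfolding gen_ring_def
  proof induction
    case (base s)
    show ?case
    proof (cases "s = 0")
      case True
      then show ?thesis by (simp add: W_def)
    next
      case False
      with base obtain k j where s: "s = a ^ k * x ^ j" by (auto simp: monomials_def)
      obtain l where l: "x * a ^ k = a ^ l * x" using normalizes_power[OF normalizes_x] .
      have "x * s * w ^ L \<in> W L" if L: "L \<ge> Suc j" for L
      proof -
        have "w ^ L = w ^ Suc j * w ^ (L - Suc j)" using L by (simp flip: power_add power_Suc)
        moreover have "x * s = a ^ l * x ^ Suc j" by (simp add: s mult.assoc[symmetric] l)
        moreover have "x ^ Suc j * w ^ Suc j = 1"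
          unfolding w_def power_inverse using x by (intro right_inverse) simp
        ultimately have "x * s * w ^ L = a ^ l * w ^ (L - Suc j)"
          by (metis mult.assoc mult_1_left)
        moreover have "L - Suc j < L" using L by simp
        ultimately show ?thesis unfolding W_def by (intro group_closure.base) blast
      qed
      then show ?thesis by blast
    qed
  next
    case (diff s t)
    then obtain L1 L2 where L: "\<forall>L\<ge>L1. x * s * w ^ L \<in> W L" "\<forall>L\<ge>L2. x * t * w ^ L \<in> W L" by blast
    have "x * (s - t) * w ^ L \<in> W L" if "L \<ge> max L1 L2" for L
    proof -
      have "x * (s - t) * w ^ L = x * s * w ^ L - x * t * w ^ L" by (simp add: algebra_simps)
      then show ?thesis using L that unfolding W_def by (auto intro: group_closure.diff)
    qed
    then show ?case by blast
  qed
  then obtain L0 where L0: "\<And>L. L \<ge> L0 \<Longrightarrow> x * f * w ^ L \<in> W L" by blast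
  define L where "L = Suc L0"
  have cw: "of_int c * w ^ L \<in> W L" using L0[of L] f(2) by (simp add: L_def)
  define S where "S = (\<lambda>(k, t). a ^ k * x' ^ t) ` ({..<m} \<times> {..<L})"
  have finS: "finite S" unfolding S_def by simp
  have S_mem: "a ^ k * x' ^ t \<in> group_closure S" if "t < L" for k t
  proof -
    have "a ^ k * x' ^ t = a ^ (k mod m) * x' ^ t" using a_power_mod by simp
    also have "\<dots> \<in> S" unfolding S_def using that m_pos by (intro image_eqI[of _ _ "(k mod m, t)"]) auto
    finally show ?thesis by (intro group_closure.base) simp
  qed
  have x'_pow: "x' ^ t = of_int (c ^ t) * w ^ t" for t
  proof (induction t)
    case (Suc t)
    have "x' ^ Suc t = of_int c * (w * of_int (c ^ t)) * w ^ t"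
      unfolding power_Suc Suc by (simp only: x'_def mult.assoc)
    also have "w * of_int (c ^ t) = of_int (c ^ t) * w" by (rule mult_of_int_commute[symmetric])
    finally show ?case by (simp add: mult.assoc)
  qed simp
  \<comment> \<open>As \<open>L = Suc L0\<close>, the factor \<open>c ^ L0\<close> turns every
    \<open>w ^ t\<close> with \<open>t < L\<close> into an integer multiple of
    \<open>x' ^ t\<close>, and \<open>c * w ^ L\<close> into \<open>x' ^ L\<close> exactly: a monic
    equation for \<open>x'\<close>.\<close>
  have "of_int (c ^ L0) * r \<in> group_closure S" if r: "r \<in> W L" for r
  proof (rule group_closure_mapI[where f = "(*) (of_int (c ^ L0))"])
    show "r \<in> group_closure {a ^ k * w ^ t |k t. t < L}" using r by (simp add: W_def)
    fix s assume "s \<in> {a ^ k * w ^ t |k t. t < L}"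
    then obtain k t where s: "s = a ^ k * w ^ t" "t < L" by blast
    have "of_int (c ^ L0) = of_int (c ^ (L0 - t)) * (of_int (c ^ t) :: 'a)"
      using s(2) unfolding L_def by (simp flip: of_int_mult power_add)
    then have "of_int (c ^ L0) * s = of_int (c ^ (L0 - t)) * (of_int (c ^ t) * a ^ k * w ^ t)"
      by (simp only: s mult.assoc)
    also have "of_int (c ^ t) * a ^ k = a ^ k * of_int (c ^ t)" by (rule mult_of_int_commute)
    also have "a ^ k * of_int (c ^ t) * w ^ t = a ^ k * x' ^ t" by (simp only: x'_pow mult.assoc)
    finally show "of_int (c ^ L0) * s \<in> group_closure S"
      using group_closure_of_int_mult[OF S_mem[OF s(2)], of "c ^ (L0 - t)" k] by simp
  qed (simp add: right_diff_distrib)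
  from this[OF cw] have "of_int (c ^ L0) * (of_int c * w ^ L) \<in> group_closure S" .
  moreover have "of_int (c ^ L0) * (of_int c * w ^ L) = x' ^ L"
    unfolding x'_pow L_def by (simp add: mult.assoc[symmetric] power_commutes)
  ultimately have x'L: "x' ^ L \<in> group_closure S" by simp
  have a_closed: "a ^ k * r \<in> group_closure S" if r: "r \<in> group_closure S" for k r
  proof (rule group_closure_mapI[OF r, where f = "(*) (a ^ k)"])
    fix s assume "s \<in> S"
    then obtain l t where "s = a ^ l * x' ^ t" "t < L" by (auto simp: S_def)
    then show "a ^ k * s \<in> group_closure S"
      using S_mem[of t "k + l"] by (simp add: power_add mult.assoc)
  qed (simp add: right_diff_distrib)
  have x'_closed: "x' * r \<in> group_closure S" if r: "r \<in> group_closure S" for r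
  proof (rule group_closure_mapI[OF r, where f = "(*) x'"])
    fix s assume "s \<in> S"
    then obtain l t where s: "s = a ^ l * x' ^ t" "t < L" by (auto simp: S_def)
    obtain k where k: "x' * a ^ l = a ^ k * x'" using Y.normalizes_power[OF Y.normalizes_x] .
    have "x' * s = a ^ k * x' ^ Suc t" by (simp add: s mult.assoc[symmetric] k)
    moreover have "x' ^ Suc t \<in> group_closure S"
      using S_mem[of "Suc t" 0] x'L s(2) by (cases "Suc t = L") auto
    ultimately show "x' * s \<in> group_closure S" using a_closed by simp
  qed (simp add: right_diff_distrib)
  have x'_pows: "x' ^ j \<in> group_closure S" for j
  proof (induction j)
    case 0
    show ?case using S_mem[of 0 0] by (simp add: L_def)
  next
    case (Suc j)
    then show ?case using x'_closed by simp
  qed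
  have "Y.gen_ring = group_closure S"
  proof
    show "Y.gen_ring \<subseteq> group_closure S"
    proof
      fix r assume "r \<in> Y.gen_ring"
      then show "r \<in> group_closure S" unfolding Y.gen_ring_def
        by (rule group_closure_mapI[where f = "\<lambda>u. u"])
          (auto simp: Y.monomials_def intro: a_closed x'_pows)
    qed
    show "group_closure S \<subseteq> Y.gen_ring"
    proof
      fix r assume "r \<in> group_closure S"
      then show "r \<in> Y.gen_ring" unfolding Y.gen_ring_def
        by (rule group_closure_mapI[where f = "\<lambda>u. u"])
          (auto simp: S_def Y.monomials_def intro: group_closure.base)
    qed
  qed
  then show ?thesis using Y.skew_pair_axioms finS by blast
qed

lemma exists_adic_skew: "\<exists>R \<pi> x d. adic_skew R \<pi> a x d"
proof (cases "\<exists>c f. of_int c \<noteq> (0::'a) \<and> f \<in> gen_ring \<and> of_int c = x * f")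
  case False
  have "\<exists>\<pi> d. adic_skew gen_ring \<pi> a x d"
  proof (rule adic_skew_x_adic)
    fix c f assume "of_int c \<noteq> (0::'a)" "f \<in> gen_ring"
    with False show "of_int c \<noteq> x * f" by metis
  qed
  then show ?thesis by (elim exE) (intro exI)
next
  case True
  then obtain x' S where "skew_pair a x' m" and S: "finite S" "skew_pair.gen_ring a x' = group_closure S"
    using finitely_generated_pair by metis
  then interpret Y: skew_pair a x' m by simp
  \<comment> \<open>In positive characteristic a finitely generated additive group is finite, which
    \<open>infinite_gen_ring\<close> excludes.\<close>
  have "of_int k \<noteq> (0::'a)" if k: "k \<noteq> 0" for k
  proof
    assume "of_int k = (0::'a)"
    then have "of_nat (nat \<bar>k\<bar>) = (0::'a)" by (cases "k \<ge> 0") auto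
    then have "finite Y.gen_ring"
      unfolding S(2) using S(1) k by (intro finite_group_closure[of _ "nat \<bar>k\<bar>"]) auto
    then show False using Y.infinite_gen_ring by contradiction
  qed
  then have "\<exists>\<pi> d. adic_skew Y.gen_ring \<pi> a x' d" using S by (rule Y.adic_skew_p_adic)
  then show ?thesis by (elim exE) (intro exI)
qed

end

lemma torsion_noncentral_adic_skew:
  fixes a :: "'a::division_ring"
  assumes "M > 0" "a ^ M = 1" "a * y \<noteq> y * a"
  shows "\<exists>R \<pi> x d. adic_skew R \<pi> a x d"
  using exists_skew_pair[OF assms] skew_pair.exists_adic_skew by blast

section \<open>The multiplicative group of a division ring\<close>

lemma GL_simps:
  "monoid.mult (GL TYPE('a::division_ring) n) = (*)" "monoid.one (GL TYPE('a) n) = 1\<^sub>m n"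
  by (simp_all add: GL_def units_of_def ring_mat_simps)

section \<open>Descent along an almost subnormal chain\<close>

lemma (in group) rcosets_sub:
  "rcosets\<^bsub>G\<lparr>carrier := L\<rparr>\<^esub> K = (\<lambda>l. K #> l) ` L"
  unfolding RCOSETS_def r_coset_def by auto

lemma (in group) coset_eq_imp_quotient:
  assumes "subgroup K G" "x \<in> carrier G" "y \<in> carrier G" "K #> x = K #> y"
  shows "x \<otimes> inv y \<in> K"
proof (rule coset_join1)
  show "K #> (x \<otimes> inv y) = K"
    using assms subgroup.subset[OF assms(1)] by (intro coset_mult_inv2)
qed (use assms in auto)

text \<open>The induction runs from the whole group down to \<open>H\<close>. Both steps record
  \<open>H \<subseteq> K\<close>, so that a fixed element of \<open>H\<close> is available in every
  member of the chain.\<close>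

lemma (in group) almost_subnormal_induct:
  assumes "almost_subnormal H G" and top: "P (carrier G)"
    and normal: "\<And>K L. subgroup K G \<Longrightarrow> subgroup L G \<Longrightarrow> K \<subseteq> L \<Longrightarrow> H \<subseteq> K \<Longrightarrow> P L \<Longrightarrow>
      (\<And>l k. l \<in> L \<Longrightarrow> k \<in> K \<Longrightarrow> l \<otimes> k \<otimes> inv l \<in> K) \<Longrightarrow> P K"
    and finite_index: "\<And>K L. subgroup K G \<Longrightarrow> subgroup L G \<Longrightarrow> K \<subseteq> L \<Longrightarrow> H \<subseteq> K \<Longrightarrow> P L \<Longrightarrow>
      finite ((\<lambda>l. K #> l) ` L) \<Longrightarrow> P K"
  shows "P H"
proof -
  obtain r C where C: "C 0 = H" "C r = carrier G" "\<And>i. i \<le> r \<Longrightarrow> subgroup (C i) G"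
    "\<And>i. i < r \<Longrightarrow> C i \<subseteq> C (Suc i)"
    and step: "\<And>i. i < r \<Longrightarrow> C i \<lhd> G\<lparr>carrier := C (Suc i)\<rparr> \<or>
      finite (rcosets\<^bsub>G\<lparr>carrier := C (Suc i)\<rparr>\<^esub> (C i))"
    using assms(1) unfolding almost_subnormal_def by blast
  have sub: "H \<subseteq> C i" if "i \<le> r" for i
    using that
  proof (induction i)
    case (Suc i)
    then show ?case using C(4)[of i] by simp
  qed (simp add: C)
  have "P (C (r - i))" if "i \<le> r" for i
    using that
  proof (induction i)
    case 0
    then show ?case using C top by simp
  next
    case (Suc i)
    define j where "j = r - Suc i"
    have j: "j < r" "Suc j = r - i" using Suc by (auto simp: j_def)
    have sg: "subgroup (C j) G" "subgroup (C (Suc j)) G" "C j \<subseteq> C (Suc j)" "H \<subseteq> C j"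
      using C(3)[of j] C(3)[of "Suc j"] C(4)[OF j(1)] sub[of j] j(1) by auto
    have IH: "P (C (Suc j))" unfolding j(2) using Suc by simp
    from step[OF j(1)] have "P (C j)"
    proof
      assume "C j \<lhd> G\<lparr>carrier := C (Suc j)\<rparr>"
      then have "l \<otimes> k \<otimes> inv l \<in> C j" if "l \<in> C (Suc j)" "k \<in> C j" for l k
        using normal.inv_op_closed2[of "C j" "G\<lparr>carrier := C (Suc j)\<rparr>" l k] that sg by simp
      then show ?thesis using normal sg IH by blast
    next
      assume "finite (rcosets\<^bsub>G\<lparr>carrier := C (Suc j)\<rparr>\<^esub> (C j))"
      then show ?thesis using finite_index[OF sg IH] by (simp add: rcosets_sub)
    qed
    then show ?case by (simp add: j_def)
  qed
  from this[of r] show ?thesis using C by simp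
qed

section \<open>The case of one by one matrices\<close>

lemma periodic_subgroupD:
  assumes "periodic_group (G\<lparr>carrier := H\<rparr>)" "x \<in> H"
  obtains k :: nat where "k > 0" "x [^]\<^bsub>G\<^esub> k = \<one>\<^bsub>G\<^esub>"
proof -
  obtain k :: nat where "k > 0" "x [^]\<^bsub>G\<lparr>carrier := H\<rparr>\<^esub> k = \<one>\<^bsub>G\<^esub>"
    using assms by (auto simp: periodic_group_def)
  moreover have "x [^]\<^bsub>G\<lparr>carrier := H\<rparr>\<^esub> k = x [^]\<^bsub>G\<^esub> k" for k :: nat
    by (simp add: nat_pow_def)
  ultimately show thesis using that by simp
qed

text \<open>Scalars become 1 by 1 matrices: the nonzero ones make up \<open>GL\<close> of degree
  one, and for transvections they multiply columns from the right and rows from the left.\<close>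

definition mat1 :: "'a \<Rightarrow> 'a mat" where "mat1 c = mat (Suc 0) (Suc 0) (\<lambda>_. c)"

lemma mat1_carrier [simp]: "mat1 c \<in> carrier_mat (Suc 0) (Suc 0)" by (simp add: mat1_def)

lemma mat1_dim [simp]: "dim_row (mat1 c) = Suc 0" "dim_col (mat1 c) = Suc 0"
  by (simp_all add: mat1_def)

lemma mat1_index [simp]: "mat1 c $$ (0, 0) = c" by (simp add: mat1_def)

lemma mat1_inject [simp]: "mat1 c = mat1 d \<longleftrightarrow> c = d"
  by (metis mat1_index)

lemma mat1_cases:
  assumes "A \<in> carrier_mat (Suc 0) (Suc 0)" obtains c where "A = mat1 c"
proof
  show "A = mat1 (A $$ (0, 0))" using assms by (intro eq_matI) (auto simp: mat1_def)
qed

lemma mat1_mult: "mat1 c * mat1 d = mat1 (c * d :: 'a::semiring_0)"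
  by (intro eq_matI) (auto simp: mat1_def scalar_prod_def)

lemma mat1_add: "mat1 c + mat1 d = mat1 (c + d)"
  by (intro eq_matI) (auto simp: mat1_def)

lemma mat1_one: "1\<^sub>m (Suc 0) = mat1 1" and mat1_zero: "0\<^sub>m (Suc 0) (Suc 0) = mat1 0"
  by (rule eq_matI; simp add: mat1_def)+

lemma mat1_GL: "mat1 (c :: 'a::division_ring) \<in> carrier (GL TYPE('a) (Suc 0)) \<longleftrightarrow> c \<noteq> 0"
proof -
  interpret group "GL TYPE('a) (Suc 0)" by (rule group_GL)
  show ?thesis
  proof
    assume "c \<noteq> 0"
    then have "mat1 c * mat1 (inverse c) = 1\<^sub>m (Suc 0)" "mat1 (inverse c) * mat1 c = 1\<^sub>m (Suc 0)"
      by (simp_all add: mat1_mult mat1_one)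
    then show "mat1 c \<in> carrier (GL TYPE('a) (Suc 0))"
      by (auto simp: GL_def units_of_def Units_def ring_mat_simps intro!: bexI[of _ "mat1 (inverse c)"])
  next
    assume c: "mat1 c \<in> carrier (GL TYPE('a) (Suc 0))"
    show "c \<noteq> 0"
    proof
      assume "c = 0"
      obtain B where B: "B \<in> carrier_mat (Suc 0) (Suc 0)" "mat1 c * B = 1\<^sub>m (Suc 0)"
        using c by (auto simp: GL_def units_of_def Units_def ring_mat_simps)
      obtain b where "B = mat1 b" using mat1_cases[OF B(1)] .
      with B(2) \<open>c = 0\<close> show False by (simp add: mat1_mult mat1_one)
    qed
  qed
qed

lemma mat1_inv:
  assumes "(c :: 'a::division_ring) \<noteq> 0"
  shows "inv\<^bsub>GL TYPE('a) (Suc 0)\<^esub> (mat1 c) = mat1 (inverse c)"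
proof -
  interpret group "GL TYPE('a) (Suc 0)" by (rule group_GL)
  show ?thesis
    by (rule inv_equality) (use assms in \<open>simp_all add: GL_simps mat1_mult mat1_one mat1_GL\<close>)
qed

lemma mat1_pow: "mat1 (c :: 'a::division_ring) [^]\<^bsub>GL TYPE('a) (Suc 0)\<^esub> (k::nat) = mat1 (c ^ k)"
proof -
  interpret group "GL TYPE('a) (Suc 0)" by (rule group_GL)
  show ?thesis
    by (induction k) (simp_all add: GL_simps mat1_one mat1_mult power_commutes)
qed

lemma GL1_periodic_almost_subnormal_central:
  fixes H :: "'a::division_ring mat set"
  assumes sn: "almost_subnormal H (GL TYPE('a) (Suc 0))"
    and per: "periodic_group ((GL TYPE('a) (Suc 0))\<lparr>carrier := H\<rparr>)"
  shows "H \<subseteq> group_center (GL TYPE('a) (Suc 0))"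
proof
  let ?G = "GL TYPE('a) (Suc 0)"
  interpret group ?G by (rule group_GL)
  fix g assume g: "g \<in> H"
  have HG: "H \<subseteq> carrier ?G"
    using sn by (rule almost_subnormal_induct) (auto dest: subgroup.subset)
  have carr: "carrier ?G \<subseteq> carrier_mat (Suc 0) (Suc 0)" by (auto simp: carrier_GL)
  obtain a where a: "g = mat1 a" using g HG carr mat1_cases by blast
  obtain M :: nat where M: "M > 0" "a ^ M = 1"
    using periodic_subgroupD[OF per g] unfolding a by (auto simp: mat1_pow GL_simps mat1_one)
  have ac: "a * y = y * a" for y
  proof (rule ccontr)
    assume "a * y \<noteq> y * a"
    then obtain R \<pi> x d where "adic_skew R \<pi> a x d"
      using torsion_noncentral_adic_skew M by blast
    then interpret adic_skew R \<pi> a x d .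
    \<comment> \<open>\<open>r\<close> is chosen before the level: the coset argument below compares
      units of different levels with one and the same leading coefficient.\<close>
    define P where "P L \<longleftrightarrow> (\<exists>r. \<forall>k0. \<exists>k>k0. \<exists>y. mat1 y \<in> L \<and> lead k (d ^ r * x) y)" for L
    have "P H"
      using sn
    proof (rule almost_subnormal_induct)
      have "\<exists>k>k0. \<exists>y. mat1 y \<in> carrier ?G \<and> lead k (d ^ 0 * x) y" for k0
      proof (intro exI conjI)
        show "lead (Suc k0) (d ^ 0 * x) (1 + \<pi> ^ Suc k0 * x)" by (rule lead_one_plus) simp
        then show "mat1 (1 + \<pi> ^ Suc k0 * x) \<in> carrier ?G" by (simp add: mat1_GL lead_def)
      qed simp
      then show "P (carrier ?G)" unfolding P_def by blast
    next
      fix K L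
      assume K: "subgroup K ?G" "subgroup L ?G" "K \<subseteq> L" "H \<subseteq> K" and "P L"
        and conj: "\<And>l k. l \<in> L \<Longrightarrow> k \<in> K \<Longrightarrow> l \<otimes>\<^bsub>?G\<^esub> k \<otimes>\<^bsub>?G\<^esub> inv\<^bsub>?G\<^esub> l \<in> K"
      from \<open>P L\<close> obtain r where r: "\<And>k0. \<exists>k>k0. \<exists>y. mat1 y \<in> L \<and> lead k (d ^ r * x) y"
        unfolding P_def by blast
      have "\<exists>k>k0. \<exists>y. mat1 y \<in> K \<and> lead k (d ^ Suc r * x) y" for k0
      proof -
        obtain k y where ky: "k > k0" "mat1 y \<in> L" "lead k (d ^ r * x) y" using r by blast
        have y0: "y \<noteq> 0" using ky by (simp add: lead_def)
        have "g \<in> K" using g K by blast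
        then have "g \<in> K" "inv\<^bsub>?G\<^esub> g \<in> K" using subgroup.m_inv_closed[OF K(1)] by auto
        \<comment> \<open>The conjugate of \<open>g\<close> by an element of \<open>L\<close> stays
          in the normal subgroup \<open>K\<close>, so the commutator lies in \<open>K\<close>
          although \<open>y\<close> itself may not.\<close>
        then have "mat1 y \<otimes>\<^bsub>?G\<^esub> g \<otimes>\<^bsub>?G\<^esub> inv\<^bsub>?G\<^esub> (mat1 y) \<otimes>\<^bsub>?G\<^esub> inv\<^bsub>?G\<^esub> g \<in> K"
          using conj[OF ky(2)] subgroup.m_closed[OF K(1)] by blast
        then have "mat1 (y * a * inverse y * inverse a) \<in> K"
          using y0 a_R(3) by (simp add: a GL_simps mat1_inv mat1_mult)
        moreover have "lead k (d ^ Suc r * x) (y * a * inverse y * inverse a)"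
          using lead_commutator_power ky by simp
        ultimately show ?thesis using ky(1) by blast
      qed
      then show "P K" unfolding P_def by blast
    next
      fix K L
      assume K: "subgroup K ?G" "subgroup L ?G" "K \<subseteq> L" and "P L"
        and fin: "finite ((\<lambda>l. K #>\<^bsub>?G\<^esub> l) ` L)"
      from \<open>P L\<close> obtain r where r: "\<And>k0. \<exists>k>k0. \<exists>y. mat1 y \<in> L \<and> lead k (d ^ r * x) y"
        unfolding P_def by blast
      have "\<exists>k>k0. \<exists>y. mat1 y \<in> K \<and> lead k (d ^ r * x) y" for k0
      proof -
        define I where "I = {k. k > k0 \<and> (\<exists>y. mat1 y \<in> L \<and> lead k (d ^ r * x) y)}"
        have "infinite I"
          unfolding infinite_nat_iff_unbounded
        proof
          fix k1
          obtain k where "k > max k0 k1" "\<exists>y. mat1 y \<in> L \<and> lead k (d ^ r * x) y" using r by blast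
          then show "\<exists>k>k1. k \<in> I" by (auto simp: I_def)
        qed
        have "\<forall>k\<in>I. \<exists>y. mat1 y \<in> L \<and> lead k (d ^ r * x) y" by (auto simp: I_def)
        then obtain y where y: "\<And>k. k \<in> I \<Longrightarrow> mat1 (y k) \<in> L" "\<And>k. k \<in> I \<Longrightarrow> lead k (d ^ r * x) (y k)"
          by metis
        \<comment> \<open>Infinitely many levels meet finitely many cosets, so two units of
          different levels share a coset; their quotient lies in \<open>K\<close> and keeps the
          lower level, which still exceeds \<open>k0\<close>.\<close>
        have "\<not> inj_on (\<lambda>k. K #>\<^bsub>?G\<^esub> mat1 (y k)) I"
        proof
          assume "inj_on (\<lambda>k. K #>\<^bsub>?G\<^esub> mat1 (y k)) I"
          moreover have "(\<lambda>k. K #>\<^bsub>?G\<^esub> mat1 (y k)) ` I \<subseteq> (\<lambda>l. K #>\<^bsub>?G\<^esub> l) ` L" using y by auto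
          ultimately show False using fin \<open>infinite I\<close> by (meson finite_imageD finite_subset)
        qed
        then obtain k k' where k: "k \<in> I" "k' \<in> I" "k < k'" 
          "K #>\<^bsub>?G\<^esub> mat1 (y k) = K #>\<^bsub>?G\<^esub> mat1 (y k')"
          unfolding inj_on_def by (metis linorder_neqE_nat)
        have y0: "y k \<noteq> 0" "y k' \<noteq> 0" using y k by (auto simp: lead_def)
        have "mat1 (y k) \<otimes>\<^bsub>?G\<^esub> inv\<^bsub>?G\<^esub> (mat1 (y k')) \<in> K"
          using coset_eq_imp_quotient[OF K(1) _ _ k(4)] y0 by (simp add: mat1_GL)
        then have "mat1 (y k * inverse (y k')) \<in> K"
          using y0 by (simp add: GL_simps mat1_inv mat1_mult)
        moreover have "lead k (d ^ r * x) (y k * inverse (y k'))"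
          using lead_quotient[OF y(2)[OF k(1)] y(2)[OF k(2)] k(3)] k coefficient_R by (simp add: I_def)
        ultimately show ?thesis using k(1) by (auto simp: I_def)
      qed
      then show "P K" unfolding P_def by blast
    qed
    then obtain r k y where y: "k > 0" "mat1 y \<in> H" "lead k (d ^ r * x) y" unfolding P_def by blast
    obtain M' :: nat where "M' > 0" "y ^ M' = 1"
      using periodic_subgroupD[OF per y(2)] by (auto simp: mat1_pow GL_simps mat1_one)
    then show False using lead_infinite_order[OF y(3,1)] by blast
  qed
  have comm: "mat1 a * z = z * mat1 a" if z: "z \<in> carrier ?G" for z
  proof -
    obtain y where "z = mat1 y" using z carr mat1_cases by blast
    with ac show ?thesis by (simp add: mat1_mult)
  qed
  then show "g \<in> group_center ?G"
    using g HG unfolding group_center_def a by (auto simp: GL_simps)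
qed

section \<open>Periodic division rings\<close>

lemma field_ring_of_type_algebra:
  assumes "\<And>x y :: 'a::division_ring. x * y = y * x"
  shows "field (ring_of_type_algebra :: 'a ring)"
proof -
  have "\<exists>y. x + y = 0" for x :: 'a
    using add.right_inverse by blast
  moreover have "x \<noteq> 0 \<Longrightarrow> \<exists>y. x * y = 1 \<and> y * x = 1" for x :: 'a
    by (rule exI[of _ "inverse x"]) auto
  moreover have "x * (y * z) = y * (x * z)" for x y z :: 'a
    by (metis assms mult.assoc)
  ultimately show ?thesis
    unfolding ring_of_type_algebra_def
    by unfold_locales (auto simp: algebra_simps Units_def assms)
qed

text \<open>This contains Jacobson's theorem for division rings with periodic multiplicative group.\<close>

lemma periodic_division_ring_locally_finite:
  assumes per: "\<And>t :: 'a::division_ring. t \<noteq> 0 \<Longrightarrow> \<exists>k>0. t ^ k = 1"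
  shows "locally_finite_field (ring_of_type_algebra :: 'a ring)"
proof -
  let ?K = "ring_of_type_algebra :: 'a ring"
  have comm: "a * y = y * a" for a y :: 'a
  proof (rule ccontr)
    assume *: "a * y \<noteq> y * a"
    then have "a \<noteq> 0" by auto
    then obtain M where "M > 0" "a ^ M = 1" using per by blast
    then obtain R \<pi> x d where "adic_skew R \<pi> a x d"
      using torsion_noncentral_adic_skew * by blast
    then interpret adic_skew R \<pi> a x d .
    have l: "lead 1 (d ^ 0 * x) (1 + \<pi> ^ 1 * x)" by (rule lead_one_plus) simp
    then obtain M where "M > 0" "(1 + \<pi> ^ 1 * x) ^ M = 1" using per unfolding lead_def by blast
    then show False using lead_infinite_order[OF l] by simp
  qed
  \<comment> \<open>Positive characteristic: either 2 vanishes, or 2 has a finite order dividing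
    some \<open>k\<close> and \<open>2 ^ k - 1\<close> vanishes.\<close>
  obtain p where p: "p > 0" "of_nat p = (0::'a)"
  proof (cases "(2::'a) = 0")
    case True
    then show thesis using that[of 2] by simp
  next
    case False
    then obtain k where k: "k > 0" "(2::'a) ^ k = 1" using per by blast
    have "of_nat (2 ^ k - 1) = (0::'a)" using k by simp
    moreover have "(2::nat) ^ k - 1 > 0" using one_less_power[of "2::nat" k] k by simp
    ultimately show thesis using that by blast
  qed
  \<comment> \<open>Generators are adjoined one at a time: by commutativity, the products of old
    elements with the finitely many powers of \<open>s\<close> span a subring, which is finite in
    positive characteristic.\<close>
  have fin: "\<exists>F. finite F \<and> S \<subseteq> F \<and> 1 \<in> F \<and> (\<forall>u\<in>F. \<forall>v\<in>F. u - v \<in> F \<and> u * v \<in> F)"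
    if S: "finite S" for S :: "'a set"
    using S
  proof induction
    case empty
    have "u * v \<in> group_closure {1}" if "u \<in> group_closure {1}" "v \<in> group_closure {1}" for u v :: 'a
      using that by (rule group_closure_mult_closed[rotated 1]) (auto intro: group_closure.base)
    then show ?case using finite_group_closure[of "{1::'a}" p] p
      by (intro exI[of _ "group_closure {1}"]) (auto intro: group_closure.intros)
  next
    case (insert s S)
    then obtain F where F: "finite F" "S \<subseteq> F" "1 \<in> F" "\<And>u v. u \<in> F \<Longrightarrow> v \<in> F \<Longrightarrow> u * v \<in> F"
      by blast
    define B where "B = {r * s ^ k |r k. r \<in> F}"
    have fr: "finite (range (\<lambda>k. s ^ k))"
    proof (cases "s = 0")
      case True
      have "range (\<lambda>k. s ^ k) \<subseteq> {0, 1}" using True by (auto simp: power_0_left)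
      then show ?thesis by (rule finite_subset) simp
    next
      case False
      then obtain M where M: "M > 0" "s ^ M = 1" using per by blast
      have "range (\<lambda>k. s ^ k) \<subseteq> (\<lambda>k. s ^ k) ` {..<M}"
      proof (intro subsetI, elim imageE)
        fix u k assume u: "u = s ^ k"
        have "s ^ k = (s ^ M) ^ (k div M) * s ^ (k mod M)"
          by (simp add: power_mult[symmetric] power_add[symmetric])
        then show "u \<in> (\<lambda>k. s ^ k) ` {..<M}" using M u
          by (intro image_eqI[of _ _ "k mod M"]) auto
      qed
      then show ?thesis by (rule finite_subset) simp
    qed
    have "B = (\<lambda>(r, q). r * q) ` (F \<times> range (\<lambda>k. s ^ k))" by (auto simp: B_def)
    then have finB: "finite B" using F fr by simp
    have B: "r * s ^ k \<in> group_closure B" if "r \<in> F" for r k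
      using that by (intro group_closure.base) (auto simp: B_def)
    have "u * v \<in> group_closure B" if "u \<in> group_closure B" "v \<in> group_closure B" for u v
      using that
    proof (rule group_closure_mult_closed[rotated 1])
      fix b c assume "b \<in> B" "c \<in> B"
      then obtain r k q l where b: "b = r * s ^ k" "c = q * s ^ l" "r \<in> F" "q \<in> F" by (auto simp: B_def)
      have "b * c = r * (s ^ k * q) * s ^ l" by (simp only: b mult.assoc)
      also have "\<dots> = (r * q) * s ^ (k + l)" by (simp only: comm[of "s ^ k" q] power_add mult.assoc)
      finally show "b * c \<in> group_closure B" using B F b by simp
    qed
    moreover have "insert s S \<subseteq> group_closure B"
      using B[of _ 0] B[OF F(3), of 1] F(2) by auto
    moreover have "1 \<in> group_closure B" using B[OF F(3), of 0] by simp
    ultimately show ?case using finite_group_closure[OF finB p]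
      by (intro exI[of _ "group_closure B"]) (auto intro: group_closure.diff)
  qed
  interpret K: field ?K by (rule field_ring_of_type_algebra[OF comm])
  have Ks: "carrier ?K = UNIV" "monoid.mult ?K = (*)" "monoid.one ?K = 1" "ring.zero ?K = 0" "ring.add ?K = (+)"
    by (simp_all add: ring_of_type_algebra_def)
  have "finite (generate_field ?K S)" if S: "finite S" for S
  proof -
    obtain F where F: "finite F" "S \<subseteq> F" "1 \<in> F" "\<And>u v. u \<in> F \<Longrightarrow> v \<in> F \<Longrightarrow> u - v \<in> F"
      "\<And>u v. u \<in> F \<Longrightarrow> v \<in> F \<Longrightarrow> u * v \<in> F" using fin[OF S] by blast
    have F0: "0 \<in> F" using F(4)[OF F(3,3)] by simp
    have Fm: "- u \<in> F" if "u \<in> F" for u using F(4)[OF F0 that] by simp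
    have Fa: "u + v \<in> F" if "u \<in> F" "v \<in> F" for u v using F(4)[OF that(1) Fm[OF that(2)]] by simp
    have Fp: "u ^ k \<in> F" if "u \<in> F" for u k using that by (induction k) (auto intro: F)
    have Fi: "inverse u \<in> F" if u: "u \<in> F" "u \<noteq> 0" for u
    proof -
      obtain t where t: "t > 0" "u ^ t = 1" using per u by blast
      then have "inverse u = u ^ (t - 1)" by (intro inverse_unique) (simp flip: power_Suc)
      then show ?thesis using Fp u by simp
    qed
    have "h \<in> F" if "h \<in> generate_field ?K S" for h
      using that
    proof induction
      case (a_inv h)
      have "\<ominus>\<^bsub>?K\<^esub> h = - h" by (rule K.minus_equality) (simp_all add: Ks)
      then show ?case using Fm a_inv by simp
    next
      case (m_inv h)
      then have "inv\<^bsub>?K\<^esub> h = inverse h" by (intro K.comm_inv_char) (simp_all add: Ks)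
      then show ?case using Fi m_inv by (simp add: Ks)
    qed (use F Fa in \<open>auto simp: Ks\<close>)
    then show ?thesis using F(1) by (meson finite_subset subsetI)
  qed
  then show ?thesis unfolding locally_finite_field_def using K.field_axioms by blast
qed

section \<open>Transvections\<close>

text \<open>Columns form a right and rows a left vector space over the division ring; as matrices,
  both share one associative product with the scalars \<open>mat1 c\<close>.\<close>

abbreviation "cvec n \<equiv> carrier_mat n (Suc 0)"
abbreviation "rvec n \<equiv> carrier_mat (Suc 0) n"

text \<open>Premises on dimensions, unlike membership in \<open>carrier_mat\<close>, leave no index
  to be guessed, so these laws work as conditional rewrite rules.\<close>

lemma mult_assoc_dim:
  "dim_col A = dim_row B \<Longrightarrow> dim_col B = dim_row C \<Longrightarrow> A * B * C = A * (B * (C :: 'a::semiring_0 mat))"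
  by (rule assoc_mult_mat[of A "dim_row A" "dim_col A" B "dim_col B" C "dim_col C"]) auto

lemma mult_add_distrib_dim:
  "dim_col A = dim_row B \<Longrightarrow> dim_row B = dim_row C \<Longrightarrow> dim_col B = dim_col C \<Longrightarrow>
    A * (B + C) = A * B + A * (C :: 'a::semiring_0 mat)"
  by (rule mult_add_distrib_mat[of A "dim_row A" "dim_col A" B "dim_col B" C]) auto

lemma add_mult_distrib_dim:
  "dim_row A = dim_row B \<Longrightarrow> dim_col A = dim_col B \<Longrightarrow> dim_col A = dim_row C \<Longrightarrow>
    (A + B) * C = A * C + B * (C :: 'a::semiring_0 mat)"
  by (rule add_mult_distrib_mat[of A "dim_row A" "dim_col A" B C "dim_col C"]) auto

lemma mult_minus_distrib_dim:
  "dim_col A = dim_row B \<Longrightarrow> dim_row B = dim_row C \<Longrightarrow> dim_col B = dim_col C \<Longrightarrow>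
    A * (B - C) = A * B - A * (C :: 'a::ring mat)"
  by (rule mult_minus_distrib_mat[of A "dim_row A" "dim_col A" B "dim_col B" C]) auto

lemma minus_mult_distrib_dim:
  "dim_row A = dim_row B \<Longrightarrow> dim_col A = dim_col B \<Longrightarrow> dim_col A = dim_row C \<Longrightarrow>
    (A - B) * C = A * C - B * (C :: 'a::ring mat)"
  by (rule minus_mult_distrib_mat[of A "dim_row A" "dim_col A" B C "dim_col C"]) auto

lemma one_mult_dim: "dim_row A = k \<Longrightarrow> 1\<^sub>m k * A = (A :: 'a::semiring_1 mat)"
  by (rule left_mult_one_mat[of A k "dim_col A"]) auto

lemma mult_one_dim: "dim_col A = k \<Longrightarrow> A * 1\<^sub>m k = (A :: 'a::semiring_1 mat)"
  by (rule right_mult_one_mat[of A "dim_row A"]) auto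

lemma zero_mult_dim: "dim_row A = l \<Longrightarrow> 0\<^sub>m k l * A = 0\<^sub>m k (dim_col (A :: 'a::semiring_0 mat))"
  by (rule left_mult_zero_mat[of A l]) auto

lemma mult_zero_dim: "dim_col A = k \<Longrightarrow> A * 0\<^sub>m k l = 0\<^sub>m (dim_row (A :: 'a::semiring_0 mat)) l"
  by (rule right_mult_zero_mat[of A "dim_row A"]) auto

lemmas mat_dim_simps = mult_assoc_dim mult_add_distrib_dim add_mult_distrib_dim
  mult_minus_distrib_dim minus_mult_distrib_dim one_mult_dim mult_one_dim zero_mult_dim mult_zero_dim

lemma mat1_mult_index:
  fixes A :: "'a::semiring_0 mat"
  assumes "A \<in> carrier_mat (Suc 0) k" "i < Suc 0" "j < k"
  shows "(mat1 c * A) $$ (i, j) = c * A $$ (i, j)"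
  using assms by (simp add: scalar_prod_def mat1_def)

lemma mult_mat1_index:
  fixes A :: "'a::semiring_0 mat"
  assumes "A \<in> carrier_mat k (Suc 0)" "i < k" "j < Suc 0"
  shows "(A * mat1 c) $$ (i, j) = A $$ (i, j) * c"
  using assms by (simp add: scalar_prod_def mat1_def)

lemma minus_eq_zero_matD:
  fixes A B :: "'a::group_add mat"
  assumes "A \<in> carrier_mat k l" "B \<in> carrier_mat k l" "A - B = 0\<^sub>m k l"
  shows "A = B"
proof (rule eq_matI)
  fix i j assume ij: "i < dim_row B" "j < dim_col B"
  have "A $$ (i, j) - B $$ (i, j) = (A - B) $$ (i, j)" using ij by simp
  also have "\<dots> = 0" unfolding assms(3) using ij assms(2) by simp
  finally show "A $$ (i, j) = B $$ (i, j)" by simp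
qed (use assms in auto)

lemma add_minus_cancel_mat:
  fixes A B :: "'a::ab_group_add mat"
  assumes "A \<in> carrier_mat k l" "B \<in> carrier_mat k l"
  shows "B + (A - B) = A"
  using assms by (intro eq_matI) auto

section \<open>Linear forms over a division ring\<close>

lemma exists_form_one:
  fixes w :: "'a::division_ring mat"
  assumes w: "w \<in> cvec n" "w \<noteq> 0\<^sub>m n (Suc 0)"
  shows "\<exists>\<phi>\<in>rvec n. \<phi> * w = 1\<^sub>m (Suc 0)"
proof -
  have "\<exists>i<n. w $$ (i, 0) \<noteq> 0"
  proof (rule ccontr)
    assume "\<not> ?thesis"
    then have "w = 0\<^sub>m n (Suc 0)" using w(1) by (intro eq_matI) auto
    then show False using w(2) by contradiction
  qed
  then obtain i where i: "i < n" "w $$ (i, 0) \<noteq> 0" by blast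
  define \<phi> where "\<phi> = mat (Suc 0) n (\<lambda>(_, j). if j = i then inverse (w $$ (i, 0)) else 0)"
  have "(\<phi> * w) $$ (0, 0) = (\<Sum>j<n. (if j = i then inverse (w $$ (i, 0)) else 0) * w $$ (j, 0))"
    using w(1) by (simp add: \<phi>_def scalar_prod_def atLeast0LessThan)
  also have "\<dots> = (\<Sum>j<n. if j = i then inverse (w $$ (i, 0)) * w $$ (j, 0) else 0)"
    by (rule sum.cong) auto
  also have "\<dots> = 1" using i by simp
  finally have "\<phi> * w = 1\<^sub>m (Suc 0)"
    using w(1) by (intro eq_matI) (auto simp: \<phi>_def)
  moreover have "\<phi> \<in> rvec n" by (simp add: \<phi>_def)
  ultimately show ?thesis by blast
qed

text \<open>An elimination step: \<open>\<phi>\<^sub>2 - \<phi>\<^sub>2 * u * \<phi>\<^sub>1\<close>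
  kills \<open>u\<close> because \<open>\<phi>\<^sub>1 * u\<close> is 1, and its value at
  \<open>w\<close> is that of \<open>\<phi>\<^sub>2\<close> at \<open>w\<close> projected along
  \<open>u\<close>. Common zeros of both forms persist, which preserves conditions met
  earlier.\<close>

lemma combine_forms:
  fixes u w :: "'a::division_ring mat"
  assumes c: "u \<in> cvec n" "w \<in> cvec n" "\<phi>\<^sub>1 \<in> rvec n" "\<phi>\<^sub>2 \<in> rvec n"
    and 1: "\<phi>\<^sub>1 * u = 1\<^sub>m (Suc 0)" and 2: "\<phi>\<^sub>2 * (w - u * (\<phi>\<^sub>1 * w)) = 1\<^sub>m (Suc 0)"
  shows "\<exists>\<phi>\<in>rvec n. \<phi> * u = 0\<^sub>m (Suc 0) (Suc 0) \<and> \<phi> * w = 1\<^sub>m (Suc 0) \<and>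
    (\<forall>v\<in>cvec n. \<phi>\<^sub>1 * v = 0\<^sub>m (Suc 0) (Suc 0) \<longrightarrow> \<phi>\<^sub>2 * v = 0\<^sub>m (Suc 0) (Suc 0) \<longrightarrow> \<phi> * v = 0\<^sub>m (Suc 0) (Suc 0))"
proof (intro bexI conjI ballI impI)
  have [simp]: "dim_row u = n" "dim_col u = Suc 0" "dim_row w = n" "dim_col w = Suc 0"
    "dim_row \<phi>\<^sub>1 = Suc 0" "dim_col \<phi>\<^sub>1 = n" "dim_row \<phi>\<^sub>2 = Suc 0" "dim_col \<phi>\<^sub>2 = n"
    using c by auto
  let ?\<phi> = "\<phi>\<^sub>2 - \<phi>\<^sub>2 * u * \<phi>\<^sub>1"
  show "?\<phi> \<in> rvec n" by (intro carrier_matI) simp_all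
  show "?\<phi> * u = 0\<^sub>m (Suc 0) (Suc 0)"
    by (simp add: mat_dim_simps 1) (intro eq_matI; simp)
  show "?\<phi> * w = 1\<^sub>m (Suc 0)"
    using 2 by (simp add: mat_dim_simps)
  fix v :: "'a mat" assume v: "v \<in> cvec n" "\<phi>\<^sub>1 * v = 0\<^sub>m (Suc 0) (Suc 0)" "\<phi>\<^sub>2 * v = 0\<^sub>m (Suc 0) (Suc 0)"
  then have [simp]: "dim_row v = n" "dim_col v = Suc 0" by auto
  show "?\<phi> * v = 0\<^sub>m (Suc 0) (Suc 0)"
    by (simp add: mat_dim_simps v(2,3))
qed

lemma exists_form_separating:
  fixes v w :: "'a::division_ring mat"
  assumes v: "v \<in> cvec n" and w: "w \<in> cvec n" and indep: "\<And>s. s \<in> carrier_mat (Suc 0) (Suc 0) \<Longrightarrow> w \<noteq> v * s"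
  shows "\<exists>\<phi>\<in>rvec n. \<phi> * v = 0\<^sub>m (Suc 0) (Suc 0) \<and> \<phi> * w = 1\<^sub>m (Suc 0)"
proof (cases "v = 0\<^sub>m n (Suc 0)")
  case True
  then have "w \<noteq> 0\<^sub>m n (Suc 0)"
    using indep[of "0\<^sub>m (Suc 0) (Suc 0)"] by (auto simp: mat_dim_simps)
  then obtain \<phi> where "\<phi> \<in> rvec n" "\<phi> * w = 1\<^sub>m (Suc 0)" using exists_form_one w by blast
  then show ?thesis using True by (intro bexI[of _ \<phi>]) (auto simp: mat_dim_simps)
next
  case False
  then obtain \<phi>\<^sub>1 where 1: "\<phi>\<^sub>1 \<in> rvec n" "\<phi>\<^sub>1 * v = 1\<^sub>m (Suc 0)" using exists_form_one v by blast
  have s: "\<phi>\<^sub>1 * w \<in> carrier_mat (Suc 0) (Suc 0)" using 1 w by simp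
  have "w - v * (\<phi>\<^sub>1 * w) \<noteq> 0\<^sub>m n (Suc 0)"
    using minus_eq_zero_matD[of w n "Suc 0" "v * (\<phi>\<^sub>1 * w)"] w v s indep[OF s] by auto
  moreover have "w - v * (\<phi>\<^sub>1 * w) \<in> cvec n" by (rule minus_carrier_mat[OF mult_carrier_mat[OF v s]])
  ultimately obtain \<phi>\<^sub>2 where "\<phi>\<^sub>2 \<in> rvec n" "\<phi>\<^sub>2 * (w - v * (\<phi>\<^sub>1 * w)) = 1\<^sub>m (Suc 0)"
    using exists_form_one by blast
  then show ?thesis using combine_forms[OF v w 1(1) _ 1(2)] by blast
qed

lemma exists_form_two_ones:
  fixes u v w :: "'a::division_ring mat"
  assumes v: "v \<in> cvec n" and w: "w \<in> cvec n" and u: "u \<in> cvec n"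
    and indep: "\<And>s. s \<in> carrier_mat (Suc 0) (Suc 0) \<Longrightarrow> w \<noteq> v * s"
    and span: "\<And>s t. s \<in> carrier_mat (Suc 0) (Suc 0) \<Longrightarrow> t \<in> carrier_mat (Suc 0) (Suc 0) \<Longrightarrow> u \<noteq> v * s + w * t"
  shows "\<exists>\<phi>\<in>rvec n. \<phi> * v = 0\<^sub>m (Suc 0) (Suc 0) \<and> \<phi> * w = 1\<^sub>m (Suc 0) \<and> \<phi> * u = 1\<^sub>m (Suc 0)"
proof -
  obtain \<phi>\<^sub>1 where 1: "\<phi>\<^sub>1 \<in> rvec n" "\<phi>\<^sub>1 * v = 0\<^sub>m (Suc 0) (Suc 0)" "\<phi>\<^sub>1 * w = 1\<^sub>m (Suc 0)"
    using exists_form_separating[OF v w indep] by blast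
  have t: "\<phi>\<^sub>1 * u \<in> carrier_mat (Suc 0) (Suc 0)" using 1 u by simp
  define u' where "u' = u - w * (\<phi>\<^sub>1 * u)"
  have u': "u' \<in> cvec n" unfolding u'_def by (rule minus_carrier_mat[OF mult_carrier_mat[OF w t]])
  have "u' \<noteq> v * s" if s: "s \<in> carrier_mat (Suc 0) (Suc 0)" for s
  proof
    assume "u' = v * s"
    then have "u = v * s + w * (\<phi>\<^sub>1 * u)"
      using add_minus_cancel_mat[of u n "Suc 0" "w * (\<phi>\<^sub>1 * u)"] u v w s t
      by (metis comm_add_mat mult_carrier_mat u'_def)
    then show False using span[OF s t] by contradiction
  qed
  then obtain \<phi>\<^sub>2 where 2: "\<phi>\<^sub>2 \<in> rvec n" "\<phi>\<^sub>2 * v = 0\<^sub>m (Suc 0) (Suc 0)" "\<phi>\<^sub>2 * u' = 1\<^sub>m (Suc 0)"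
    using exists_form_separating[OF v u'] by blast
  obtain \<phi>\<^sub>3 where 3: "\<phi>\<^sub>3 \<in> rvec n" "\<phi>\<^sub>3 * v = 0\<^sub>m (Suc 0) (Suc 0)" "\<phi>\<^sub>3 * w = 0\<^sub>m (Suc 0) (Suc 0)"
    "\<phi>\<^sub>3 * u = 1\<^sub>m (Suc 0)"
    using combine_forms[OF w u 1(1) 2(1) 1(3)] 2 1 v unfolding u'_def by blast
  have d [simp]: "dim_row u = n" "dim_col u = Suc 0" "dim_row v = n" "dim_col v = Suc 0"
    "dim_row w = n" "dim_col w = Suc 0"
    "dim_row \<phi>\<^sub>1 = Suc 0" "dim_col \<phi>\<^sub>1 = n" "dim_row \<phi>\<^sub>3 = Suc 0" "dim_col \<phi>\<^sub>3 = n"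
    using u v w 1(1) 3(1) by auto
  \<comment> \<open>\<open>\<phi>\<^sub>3\<close> vanishes at \<open>v\<close> and \<open>w\<close>
    and is 1 at \<open>u\<close>, so adding a multiple of it corrects the value at \<open>u\<close>
    alone.\<close>
  let ?\<phi> = "\<phi>\<^sub>1 + (1\<^sub>m (Suc 0) - \<phi>\<^sub>1 * u) * \<phi>\<^sub>3"
  have "?\<phi> * v = 0\<^sub>m (Suc 0) (Suc 0)" by (simp add: mat_dim_simps 1 3) (intro eq_matI; simp)
  moreover have "?\<phi> * w = 1\<^sub>m (Suc 0)" by (simp add: mat_dim_simps 1 3) (intro eq_matI; simp)
  moreover have "?\<phi> * u = 1\<^sub>m (Suc 0)"
    by (simp add: mat_dim_simps 3) (rule add_minus_cancel_mat, use t in auto)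
  moreover have "?\<phi> \<in> rvec n" by (intro carrier_matI) simp_all
  ultimately show ?thesis by blast
qed

section \<open>Calculus of transvections\<close>

definition transvection :: "nat \<Rightarrow> 'a::division_ring mat \<Rightarrow> 'a mat \<Rightarrow> 'a mat" where
  "transvection n v \<phi> = 1\<^sub>m n + v * \<phi>"

lemma transvection_dim [simp]:
  "v \<in> cvec n \<Longrightarrow> \<phi> \<in> rvec n \<Longrightarrow> transvection n v \<phi> \<in> carrier_mat n n"
  by (simp add: transvection_def)

lemma transvection_apply:
  assumes "v \<in> cvec n" "\<phi> \<in> rvec n" "u \<in> cvec n"
  shows "transvection n v \<phi> * u = u + v * (\<phi> * u)"
proof -
  have [simp]: "dim_row v = n" "dim_col v = Suc 0" "dim_row u = n" "dim_row \<phi> = Suc 0" "dim_col \<phi> = n"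
    using assms by auto
  show ?thesis by (simp add: transvection_def mat_dim_simps)
qed

lemma transvection_apply_right:
  assumes "v \<in> cvec n" "\<phi> \<in> rvec n" "\<psi> \<in> rvec n"
  shows "\<psi> * transvection n v \<phi> = \<psi> + \<psi> * v * \<phi>"
proof -
  have [simp]: "dim_row v = n" "dim_col v = Suc 0" "dim_col \<psi> = n" "dim_row \<phi> = Suc 0" "dim_col \<phi> = n"
    using assms by auto
  show ?thesis by (simp add: transvection_def mat_dim_simps)
qed

lemma transvection_fixes:
  assumes "v \<in> cvec n" "\<phi> \<in> rvec n" "u \<in> cvec n" "\<phi> * u = 0\<^sub>m (Suc 0) (Suc 0)"
  shows "transvection n v \<phi> * u = u"
  using assms by (simp add: transvection_apply mat_dim_simps)

lemma transvection_mult: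
  assumes "v \<in> cvec n" "\<phi> \<in> rvec n" "\<psi> \<in> rvec n" "\<phi> * v = 0\<^sub>m (Suc 0) (Suc 0)"
  shows "transvection n v \<phi> * transvection n v \<psi> = transvection n v (\<phi> + \<psi>)"
proof -
  have [simp]: "dim_row v = n" "dim_col v = Suc 0" "dim_row \<phi> = Suc 0" "dim_col \<phi> = n"
    "dim_row \<psi> = Suc 0" "dim_col \<psi> = n"
    using assms by auto
  have "transvection n v \<phi> * transvection n v \<psi> = transvection n v \<phi> + transvection n v \<phi> * v * \<psi>"
    by (simp add: transvection_def mat_dim_simps)
  also have "transvection n v \<phi> * v = v" using assms by (intro transvection_fixes)
  also have "transvection n v \<phi> + v * \<psi> = 1\<^sub>m n + (v * \<phi> + v * \<psi>)"
    unfolding transvection_def using assms by (intro assoc_add_mat[of _ n n]) auto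
  also have "\<dots> = transvection n v (\<phi> + \<psi>)"
    by (simp add: transvection_def mat_dim_simps)
  finally show ?thesis .
qed

lemma transvection_zero:
  "v \<in> cvec n \<Longrightarrow> transvection n v (0\<^sub>m (Suc 0) n) = 1\<^sub>m n"
  by (simp add: transvection_def mat_dim_simps)

lemma transvection_GL:
  fixes v :: "'a::division_ring mat"
  assumes "v \<in> cvec n" "\<phi> \<in> rvec n" "\<phi> * v = 0\<^sub>m (Suc 0) (Suc 0)"
  shows "transvection n v \<phi> \<in> carrier (GL TYPE('a) n)" (is ?GL)
    and "inv\<^bsub>GL TYPE('a) n\<^esub> (transvection n v \<phi>) = transvection n v (- \<phi>)" (is ?inv)
proof -
  interpret group "GL TYPE('a) n" by (rule group_GL)
  have m: "- \<phi> \<in> rvec n" "- \<phi> * v = 0\<^sub>m (Suc 0) (Suc 0)"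
    using assms by auto
  have z: "\<phi> + - \<phi> = 0\<^sub>m (Suc 0) n" "- \<phi> + \<phi> = 0\<^sub>m (Suc 0) n"
    by (rule eq_matI; use assms(2) in simp)+
  have 1: "transvection n v \<phi> * transvection n v (- \<phi>) = 1\<^sub>m n"
    using transvection_mult[OF assms(1,2) m(1) assms(3)] z transvection_zero[OF assms(1)] by simp
  have 2: "transvection n v (- \<phi>) * transvection n v \<phi> = 1\<^sub>m n"
    using transvection_mult[OF assms(1) m(1) assms(2) m(2)] z transvection_zero[OF assms(1)] by simp
  show a: ?GL
    using 1 2 assms m by (auto simp: GL_def units_of_def Units_def ring_mat_simps
        intro!: bexI[of _ "transvection n v (- \<phi>)"])
  have "transvection n v (- \<phi>) \<in> carrier (GL TYPE('a) n)"
    using 1 2 assms m by (auto simp: GL_def units_of_def Units_def ring_mat_simps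
        intro!: bexI[of _ "transvection n v \<phi>"])
  then show ?inv using 2 a by (intro inv_equality) (simp_all add: GL_simps)
qed

lemma transvection_conj:
  assumes "v \<in> cvec n" "\<phi> \<in> rvec n" "x \<in> carrier_mat n n" "y \<in> carrier_mat n n" "x * y = 1\<^sub>m n"
  shows "x * transvection n v \<phi> * y = transvection n (x * v) (\<phi> * y)"
proof -
  have [simp]: "dim_row v = n" "dim_col v = Suc 0" "dim_row \<phi> = Suc 0" "dim_col \<phi> = n"
    "dim_row x = n" "dim_col x = n" "dim_row y = n" "dim_col y = n"
    using assms by auto
  show ?thesis by (simp add: transvection_def mat_dim_simps assms(5))
qed

lemma transvection_scale:
  assumes "v \<in> cvec n" "\<phi> \<in> rvec n" "s \<in> carrier_mat (Suc 0) (Suc 0)"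
  shows "transvection n (v * s) \<phi> = transvection n v (s * \<phi>)"
proof -
  have [simp]: "dim_col v = Suc 0" "dim_row \<phi> = Suc 0" "dim_row s = Suc 0" "dim_col s = Suc 0"
    using assms by auto
  show ?thesis by (simp add: transvection_def mat_dim_simps)
qed

text \<open>Transvections fixing \<open>v\<close> act transitively on the other lines. If
  \<open>u\<close> lies in the span of \<open>v\<close> and \<open>w\<close>, a shift of
  \<open>w\<close> along \<open>v\<close> suffices; otherwise some form vanishes at \<open>v\<close>
  and is 1 at both \<open>w\<close> and \<open>u\<close>, so it vanishes at \<open>u - w\<close> and
  the shift by \<open>u - w\<close> is a transvection.\<close>

lemma exists_moving_transvection:
  fixes u v w :: "'a::division_ring mat"
  assumes v: "v \<in> cvec n" and w: "w \<in> cvec n" and u: "u \<in> cvec n"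
    and wv: "\<And>s. s \<in> carrier_mat (Suc 0) (Suc 0) \<Longrightarrow> w \<noteq> v * s"
    and uv: "\<And>s. s \<in> carrier_mat (Suc 0) (Suc 0) \<Longrightarrow> u \<noteq> v * s"
  shows "\<exists>y\<in>cvec n. \<exists>\<phi>\<in>rvec n. \<exists>s. \<phi> * y = 0\<^sub>m (Suc 0) (Suc 0) \<and>
    \<phi> * v = 0\<^sub>m (Suc 0) (Suc 0) \<and> transvection n y \<phi> * w * mat1 s = u"
proof (cases "\<exists>s t. s \<in> carrier_mat (Suc 0) (Suc 0) \<and> t \<in> carrier_mat (Suc 0) (Suc 0) \<and> u = v * s + w * t")
  case True
  then obtain s t where st: "s \<in> carrier_mat (Suc 0) (Suc 0)" "t \<in> carrier_mat (Suc 0) (Suc 0)" "u = v * s + w * t"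
    by blast
  obtain \<alpha> where \<alpha>: "s = mat1 \<alpha>" using mat1_cases[OF st(1)] .
  obtain \<beta> where \<beta>: "t = mat1 \<beta>" using mat1_cases[OF st(2)] .
  have [simp]: "dim_row v = n" "dim_col v = Suc 0" "dim_row w = n" "dim_col w = Suc 0" using v w by auto
  have "\<beta> \<noteq> 0"
  proof
    assume "\<beta> = 0"
    then have "u = v * s" using st \<beta> v by (simp add: mat1_zero[symmetric] mat_dim_simps)
    then show False using uv[OF st(1)] by contradiction
  qed
  obtain \<phi> where \<phi>: "\<phi> \<in> rvec n" "\<phi> * v = 0\<^sub>m (Suc 0) (Suc 0)" "\<phi> * w = 1\<^sub>m (Suc 0)"
    using exists_form_separating[OF v w wv] by blast
  define y where "y = v * mat1 (\<alpha> * inverse \<beta>)"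
  have y: "y \<in> cvec n" unfolding y_def using v by (rule mult_carrier_mat) simp
  have "\<phi> * y = \<phi> * v * mat1 (\<alpha> * inverse \<beta>)"
    unfolding y_def using \<phi>(1) by (simp add: mult_assoc_dim)
  then have "\<phi> * y = 0\<^sub>m (Suc 0) (Suc 0)" by (simp add: \<phi> mat_dim_simps)
  moreover have "transvection n y \<phi> * w * mat1 \<beta> = u"
  proof -
    have "transvection n y \<phi> * w = w + y" using y \<phi> w by (simp add: transvection_apply mat_dim_simps)
    then have "transvection n y \<phi> * w * mat1 \<beta> = w * mat1 \<beta> + v * mat1 \<alpha>"
      using \<open>\<beta> \<noteq> 0\<close> y by (simp add: y_def mat_dim_simps mat1_mult mult.assoc)
    also have "\<dots> = u" unfolding st \<alpha> \<beta> by (rule comm_add_mat[of _ n "Suc 0"]) (rule carrier_matI, simp_all)+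
    finally show ?thesis .
  qed
  ultimately show ?thesis using y \<phi>(1,2) by (intro bexI exI conjI)
next
  case False
  then have span: "u \<noteq> v * s + w * t"
    if "s \<in> carrier_mat (Suc 0) (Suc 0)" "t \<in> carrier_mat (Suc 0) (Suc 0)" for s t
    using that by metis
  obtain \<phi> where \<phi>: "\<phi> \<in> rvec n" "\<phi> * v = 0\<^sub>m (Suc 0) (Suc 0)" "\<phi> * w = 1\<^sub>m (Suc 0)" "\<phi> * u = 1\<^sub>m (Suc 0)"
    using exists_form_two_ones[OF v w u wv span] by blast
  have [simp]: "dim_row u = n" "dim_col u = Suc 0" "dim_row w = n" "dim_col w = Suc 0"
    "dim_row \<phi> = Suc 0" "dim_col \<phi> = n" using u w \<phi>(1) by auto
  have y: "u - w \<in> cvec n" using w by (rule minus_carrier_mat)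
  have "\<phi> * (u - w) = 0\<^sub>m (Suc 0) (Suc 0)"
    by (simp add: mat_dim_simps \<phi>)
  moreover have "transvection n (u - w) \<phi> * w * mat1 1 = u"
  proof -
    have "transvection n (u - w) \<phi> * w = w + (u - w)"
      using y \<phi> w by (simp add: transvection_apply mat_dim_simps)
    also have "\<dots> = u" using u w by (rule add_minus_cancel_mat)
    finally show ?thesis by (simp add: mat1_one[symmetric] mat_dim_simps)
  qed
  ultimately show ?thesis using y \<phi>(1,2) by (intro bexI exI conjI)
qed

section \<open>Commuting modulo a normal subgroup\<close>

lemma (in group) inv_mult_cancel_left:
  "x \<in> carrier G \<Longrightarrow> y \<in> carrier G \<Longrightarrow> inv x \<otimes> (x \<otimes> y) = y"
  "x \<in> carrier G \<Longrightarrow> y \<in> carrier G \<Longrightarrow> x \<otimes> (inv x \<otimes> y) = y"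
  by (simp_all flip: m_assoc)

locale normalized_subgroup = group G for G (structure) +
  fixes K L
  assumes K: "subgroup K G" and L: "subgroup L G" and KL: "K \<subseteq> L"
    and conj: "\<And>l k. l \<in> L \<Longrightarrow> k \<in> K \<Longrightarrow> l \<otimes> k \<otimes> inv l \<in> K"
begin

text \<open>Commutation of the images in \<open>L / K\<close>, expressed by a commutator so that no
  quotient group has to be formed.\<close>

definition commute_mod where "commute_mod x z \<longleftrightarrow> x \<otimes> z \<otimes> inv x \<otimes> inv z \<in> K"

lemma L_carrier: "x \<in> L \<Longrightarrow> x \<in> carrier G" using subgroup.mem_carrier[OF L] .
lemma K_carrier: "x \<in> K \<Longrightarrow> x \<in> carrier G" using subgroup.mem_carrier[OF K] .

lemma commute_mod_sym:
  assumes "x \<in> L" "z \<in> L" "commute_mod x z" shows "commute_mod z x"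
proof -
  have "inv (x \<otimes> z \<otimes> inv x \<otimes> inv z) \<in> K"
    using assms(3) subgroup.m_inv_closed[OF K] by (simp add: commute_mod_def)
  then show ?thesis using assms(1,2) L_carrier by (simp add: commute_mod_def inv_mult_group m_assoc)
qed

lemma commute_mod_mult:
  assumes L: "x \<in> L" "y \<in> L" "z \<in> L" and "commute_mod x z" "commute_mod y z"
  shows "commute_mod (x \<otimes> y) z"
proof -
  \<comment> \<open>The commutator identity \<open>[x y, z] = x [y, z] x^-1 [x, z]\<close>.\<close>
  have "(x \<otimes> (y \<otimes> z \<otimes> inv y \<otimes> inv z) \<otimes> inv x) \<otimes> (x \<otimes> z \<otimes> inv x \<otimes> inv z) \<in> K"
    using assms conj[OF L(1)] subgroup.m_closed[OF K] by (simp add: commute_mod_def)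
  then show ?thesis
    using L L_carrier by (simp add: commute_mod_def inv_mult_group m_assoc inv_mult_cancel_left)
qed

lemma commute_mod_K:
  assumes "k \<in> K" "z \<in> L" shows "commute_mod k z"
proof -
  have "k \<otimes> (z \<otimes> inv k \<otimes> inv z) \<in> K"
    using assms conj subgroup.m_inv_closed[OF K] subgroup.m_closed[OF K] by blast
  then show ?thesis using assms K_carrier L_carrier by (simp add: commute_mod_def m_assoc)
qed

lemma commute_mod_conj:
  assumes L': "x \<in> L" "z \<in> L" and "k \<in> K" and "commute_mod x z"
  shows "commute_mod (k \<otimes> x \<otimes> inv k) z"
proof -
  have kL: "k \<in> L" "inv k \<in> L" "inv k \<in> K"
    using assms KL subgroup.m_inv_closed[OF K] by auto
  have "k \<otimes> x \<in> L" using kL L' subgroup.m_closed[OF L] by blast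
  moreover have "commute_mod (k \<otimes> x) z"
    using commute_mod_mult[OF kL(1) L' commute_mod_K] assms by blast
  ultimately show ?thesis
    using commute_mod_mult[OF _ kL(2) L'(2) _ commute_mod_K] kL L' by blast
qed

text \<open>Conjugation by an element of \<open>K\<close> is conjugation by 1 in
  \<open>L / K\<close>, so commutation survives even when \<open>x\<close> and \<open>z\<close> are
  conjugated by different elements.\<close>

lemma commute_mod_conjugates:
  assumes xz: "x \<in> L" "z \<in> L" "x \<otimes> z = z \<otimes> x" and k: "k \<in> K" "k' \<in> K"
  shows "commute_mod (k \<otimes> x \<otimes> inv k) (k' \<otimes> z \<otimes> inv k')"
proof -
  have L': "k' \<otimes> z \<otimes> inv k' \<in> L"
    using xz k KL by (intro subgroup.m_closed[OF L] subgroup.m_inv_closed[OF L]) auto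
  have "z \<otimes> x \<otimes> inv z \<otimes> inv x = \<one>"
    using xz L_carrier by (simp add: m_assoc inv_mult_cancel_left flip: xz(3))
  then have "commute_mod z x" unfolding commute_mod_def using subgroup.one_closed[OF K] by simp
  then have "commute_mod (k' \<otimes> z \<otimes> inv k') x" using commute_mod_conj xz k by blast
  then have "commute_mod x (k' \<otimes> z \<otimes> inv k')" using commute_mod_sym L' xz by blast
  then show ?thesis using commute_mod_conj xz k L' by blast
qed

end

text \<open>The relations of \<open>SL\<^sub>2\<close> on the plane spanned by \<open>v\<close> and \<open>w\<close>, with dual forms \<open>\<chi>\<close> and \<open>\<phi>\<close>.\<close>

locale dual_pair =
  fixes n :: nat and v w \<phi> \<chi> :: "'a::division_ring mat"
  assumes v: "v \<in> cvec n" and w: "w \<in> cvec n" and \<phi>: "\<phi> \<in> rvec n" and \<chi>: "\<chi> \<in> rvec n"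
    and pair: "\<phi> * v = 0\<^sub>m (Suc 0) (Suc 0)" "\<phi> * w = 1\<^sub>m (Suc 0)"
      "\<chi> * v = 1\<^sub>m (Suc 0)" "\<chi> * w = 0\<^sub>m (Suc 0) (Suc 0)"
begin

lemma dims [simp]: "dim_row v = n" "dim_col v = Suc 0" "dim_row w = n" "dim_col w = Suc 0"
  "dim_row \<phi> = Suc 0" "dim_col \<phi> = n" "dim_row \<chi> = Suc 0" "dim_col \<chi> = n"
  using v w \<phi> \<chi> by auto

text \<open>In the basis \<open>v\<close>, \<open>w\<close> of the plane, \<open>upper a\<close> and
  \<open>lower b\<close> are the unipotent matrices with rows (1, a), (0, 1) and (1, 0), (b, 1).
  Their products are evaluated on \<open>comb_c p q\<close>, the column with coordinates
  \<open>p\<close> and \<open>q\<close>, and on \<open>comb_r p q\<close>, the row with value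
  \<open>q\<close> at \<open>v\<close> and \<open>p\<close> at \<open>w\<close>.\<close>

definition upper where "upper a = transvection n v (mat1 a * \<phi>)"
definition lower where "lower b = transvection n w (mat1 b * \<chi>)"
definition comb_c where "comb_c p q = v * mat1 p + w * mat1 q"
definition comb_r where "comb_r p q = mat1 p * \<phi> + mat1 q * \<chi>"

lemma forms_vec: "mat1 a * \<phi> \<in> rvec n" "mat1 b * \<chi> \<in> rvec n"
  by (intro carrier_matI; simp)+

lemma forms_isotropic: "mat1 a * \<phi> * v = 0\<^sub>m (Suc 0) (Suc 0)" "mat1 b * \<chi> * w = 0\<^sub>m (Suc 0) (Suc 0)"
  by (simp_all add: mat_dim_simps pair)

lemma comb_c_vec: "comb_c p q \<in> cvec n" and comb_r_vec: "comb_r p q \<in> rvec n"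
  unfolding comb_c_def comb_r_def by (intro carrier_matI; simp)+

lemma form_comb_c: "\<phi> * comb_c p q = mat1 q" "\<chi> * comb_c p q = mat1 p"
  unfolding comb_c_def
  by (simp_all add: mat_dim_simps)
    (simp_all add: mult_assoc_dim[symmetric] pair mat1_one mat1_zero mat1_add mat1_mult)

lemma comb_r_vec_mult: "comb_r p q * v = mat1 q" "comb_r p q * w = mat1 p"
  unfolding comb_r_def
  by (simp_all add: mat_dim_simps pair mat1_one mat1_zero mat1_add mat1_mult)

lemma upper_comb_c: "upper a * comb_c p q = comb_c (p + a * q) q"
proof -
  have "upper a * comb_c p q = comb_c p q + v * (mat1 a * \<phi> * comb_c p q)"
    unfolding upper_def by (intro transvection_apply v forms_vec comb_c_vec)
  also have "mat1 a * \<phi> * comb_c p q = mat1 (a * q)"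
    using comb_c_vec[of p q] by (simp add: mult_assoc_dim form_comb_c mat1_mult)
  also have "comb_c p q + v * mat1 (a * q) = comb_c (p + a * q) q"
    unfolding comb_c_def by (intro eq_matI; simp add: mult_mat1_index[OF v] mult_mat1_index[OF w] algebra_simps del: index_mult_mat(1))
  finally show ?thesis .
qed

lemma lower_comb_c: "lower b * comb_c p q = comb_c p (q + b * p)"
proof -
  have "lower b * comb_c p q = comb_c p q + w * (mat1 b * \<chi> * comb_c p q)"
    unfolding lower_def by (intro transvection_apply w forms_vec comb_c_vec)
  also have "mat1 b * \<chi> * comb_c p q = mat1 (b * p)"
    using comb_c_vec[of p q] by (simp add: mult_assoc_dim form_comb_c mat1_mult)
  also have "comb_c p q + w * mat1 (b * p) = comb_c p (q + b * p)"
    unfolding comb_c_def by (intro eq_matI; simp add: mult_mat1_index[OF v] mult_mat1_index[OF w] algebra_simps del: index_mult_mat(1))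
  finally show ?thesis .
qed

lemma comb_r_upper: "comb_r p q * upper a = comb_r (p + q * a) q"
proof -
  have "comb_r p q * upper a = comb_r p q + comb_r p q * v * (mat1 a * \<phi>)"
    unfolding upper_def by (intro transvection_apply_right v forms_vec comb_r_vec)
  also have "comb_r p q * v * (mat1 a * \<phi>) = mat1 (q * a) * \<phi>"
    by (simp add: comb_r_vec_mult mult_assoc_dim[symmetric] mat1_mult)
  also have "comb_r p q + mat1 (q * a) * \<phi> = comb_r (p + q * a) q"
    unfolding comb_r_def by (intro eq_matI; simp add: mat1_mult_index[OF \<phi>] mat1_mult_index[OF \<chi>] algebra_simps del: index_mult_mat(1))
  finally show ?thesis .
qed

lemma comb_r_lower: "comb_r p q * lower b = comb_r p (q + p * b)"
proof -
  have "comb_r p q * lower b = comb_r p q + comb_r p q * w * (mat1 b * \<chi>)"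
    unfolding lower_def by (intro transvection_apply_right w forms_vec comb_r_vec)
  also have "comb_r p q * w * (mat1 b * \<chi>) = mat1 (p * b) * \<chi>"
    by (simp add: comb_r_vec_mult mult_assoc_dim[symmetric] mat1_mult)
  also have "comb_r p q + mat1 (p * b) * \<chi> = comb_r p (q + p * b)"
    unfolding comb_r_def by (intro eq_matI; simp add: mat1_mult_index[OF \<phi>] mat1_mult_index[OF \<chi>] algebra_simps del: index_mult_mat(1))
  finally show ?thesis .
qed

lemma upper_lower_GL:
  "upper a \<in> carrier (GL TYPE('a) n)" "lower b \<in> carrier (GL TYPE('a) n)"
  unfolding upper_def lower_def using v w forms_vec forms_isotropic by (intro transvection_GL; simp)+

lemma upper_carrier: "upper a \<in> carrier_mat n n" "lower b \<in> carrier_mat n n"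
  using upper_lower_GL by (auto simp: carrier_GL)

text \<open>The element acting as \<open>diag(s, s\<^sup>-\<^sup>1)\<close>.\<close>

definition torus where
  "torus s = upper s * (lower (- inverse s) * (upper s * (upper (- 1) * (lower 1 * upper (- 1)))))"

lemma comb_units: "comb_c 1 0 = v" "comb_r 1 0 = \<phi>" "comb_c s 0 = v * mat1 s" "comb_r s 0 = mat1 s * \<phi>"
proof -
  have *: "comb_c s 0 = v * mat1 s" "comb_r s 0 = mat1 s * \<phi>" for s
    by (rule eq_matI; simp add: comb_c_def comb_r_def mult_mat1_index[OF v] mult_mat1_index[OF w]
        mat1_mult_index[OF \<phi>] mat1_mult_index[OF \<chi>] del: index_mult_mat(1))+
  show "comb_c s 0 = v * mat1 s" "comb_r s 0 = mat1 s * \<phi>" by (fact *)+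
  show "comb_c 1 0 = v" "comb_r 1 0 = \<phi>" unfolding * by (simp_all add: mat1_one[symmetric] mat_dim_simps)
qed

text \<open>On the plane, the first three factors of \<open>torus s\<close> form the matrix with
  rows (0, s), (- inverse s, 0), and the last three the inverse of its value at
  \<open>s = 1\<close>, so the product is diagonal. Tracing the column (1, 0) through all six
  factors verifies this on \<open>v\<close>.\<close>

lemma torus_v:
  assumes "s \<noteq> 0" shows "torus s * v = v * mat1 s"
proof -
  have [simp]: "dim_row (upper a) = n" "dim_col (upper a) = n" "dim_row (lower a) = n" "dim_col (lower a) = n" for a
    using upper_carrier by auto
  have [simp]: "dim_row (comb_c p q) = n" for p q using comb_c_vec by auto
  have "torus s * comb_c 1 0 = comb_c s 0"
    unfolding torus_def using assms
    by (simp add: mult_assoc_dim upper_comb_c lower_comb_c)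
  then show ?thesis unfolding comb_units(1) by (simp only: comb_units(3))
qed

lemma phi_torus:
  assumes "s \<noteq> 0" shows "\<phi> * torus s = mat1 (inverse s) * \<phi>"
proof -
  have [simp]: "dim_row (upper a) = n" "dim_col (upper a) = n" "dim_row (lower a) = n" "dim_col (lower a) = n" for a
    using upper_carrier by auto
  have [simp]: "dim_col (comb_r p q) = n" for p q using comb_r_vec by auto
  have "comb_r 1 0 * torus s = comb_r (inverse s) 0"
    unfolding torus_def using assms
    by (simp add: mult_assoc_dim[symmetric] comb_r_upper comb_r_lower)
  then show ?thesis unfolding comb_units(2) by (simp only: comb_units(4))
qed

end

section \<open>Coordinates and the center\<close>

lemma GL_carrierD: "x \<in> carrier (GL TYPE('a::division_ring) n) \<Longrightarrow> x \<in> carrier_mat n n"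
  by (simp add: carrier_GL)

lemma GL_inv:
  assumes "x \<in> carrier (GL TYPE('a::division_ring) n)"
  shows "x * inv\<^bsub>GL TYPE('a) n\<^esub> x = 1\<^sub>m n" "inv\<^bsub>GL TYPE('a) n\<^esub> x * x = 1\<^sub>m n"
    "inv\<^bsub>GL TYPE('a) n\<^esub> x \<in> carrier_mat n n"
proof -
  interpret group "GL TYPE('a) n" by (rule group_GL)
  show "x * inv\<^bsub>GL TYPE('a) n\<^esub> x = 1\<^sub>m n" "inv\<^bsub>GL TYPE('a) n\<^esub> x * x = 1\<^sub>m n"
    using r_inv[OF assms] l_inv[OF assms] by (simp_all add: GL_simps)
  show "inv\<^bsub>GL TYPE('a) n\<^esub> x \<in> carrier_mat n n"
    using inv_closed[OF assms] by (rule GL_carrierD)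
qed

definition unit_vec_mat :: "nat \<Rightarrow> nat \<Rightarrow> 'a::division_ring mat" where
  "unit_vec_mat n i = mat n (Suc 0) (\<lambda>(r, _). if r = i then 1 else 0)"

definition unit_form :: "nat \<Rightarrow> nat \<Rightarrow> 'a::division_ring mat" where
  "unit_form n i = mat (Suc 0) n (\<lambda>(_, c). if c = i then 1 else 0)"

lemma unit_mats: "unit_vec_mat n i \<in> cvec n" "unit_form n i \<in> rvec n"
  by (simp_all add: unit_vec_mat_def unit_form_def)

lemma mult_unit_vec_index:
  fixes A :: "'a::division_ring mat"
  assumes "A \<in> carrier_mat k n" "i < n" "r < k"
  shows "(A * unit_vec_mat n i) $$ (r, 0) = A $$ (r, i)"
proof -
  have "(A * unit_vec_mat n i) $$ (r, 0) = (\<Sum>j<n. A $$ (r, j) * (if j = i then 1 else 0))"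
    using assms by (simp add: unit_vec_mat_def scalar_prod_def atLeast0LessThan)
  also have "\<dots> = (\<Sum>j<n. if j = i then A $$ (r, j) else 0)" by (rule sum.cong) auto
  finally show ?thesis using assms by simp
qed

lemma unit_form_unit_vec:
  assumes "i < n" "j < n"
  shows "unit_form n i * unit_vec_mat n j = (if i = j then 1\<^sub>m (Suc 0) else 0\<^sub>m (Suc 0) (Suc 0))"
proof (rule eq_matI)
  fix r c assume "r < dim_row (if i = j then 1\<^sub>m (Suc 0) else 0\<^sub>m (Suc 0) (Suc 0) :: 'a mat)"
    "c < dim_col (if i = j then 1\<^sub>m (Suc 0) else 0\<^sub>m (Suc 0) (Suc 0) :: 'a mat)"
  then have "r = 0" "c = 0" by (auto split: if_splits)
  then show "(unit_form n i * unit_vec_mat n j) $$ (r, c) =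
      (if i = j then 1\<^sub>m (Suc 0) else 0\<^sub>m (Suc 0) (Suc 0)) $$ (r, c)"
    using assms mult_unit_vec_index[OF unit_mats(2)[of n i] assms(2), of 0]
    by (auto simp: unit_form_def)
qed (simp_all add: unit_form_def unit_vec_mat_def)

text \<open>Unit vectors being eigenvectors, \<open>g\<close> is diagonal with entries
  \<open>l i\<close>. The vector with entries \<open>c\<close> at \<open>i\<close> and 1 at
  \<open>j\<close> gives \<open>l i * c = c * l j\<close>; \<open>c = 1\<close> shows that all
  entries agree, and arbitrary \<open>c\<close> that the common entry is central.\<close>

lemma GL_central_if_eigenvectors:
  fixes g :: "'a::division_ring mat"
  assumes g: "g \<in> carrier (GL TYPE('a) n)" and "n \<ge> 2"
    and eigen: "\<And>v. v \<in> cvec n \<Longrightarrow> \<exists>s\<in>carrier_mat (Suc 0) (Suc 0). g * v = v * s"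
  shows "g \<in> group_center (GL TYPE('a) n)"
proof -
  have gc: "g \<in> carrier_mat n n" using g by (rule GL_carrierD)
  have ev: "\<exists>\<mu>. \<forall>r<n. (g * v) $$ (r, 0) = v $$ (r, 0) * \<mu>" if v: "v \<in> cvec n" for v
  proof -
    obtain s where s: "s \<in> carrier_mat (Suc 0) (Suc 0)" "g * v = v * s" using eigen[OF v] by blast
    obtain \<mu> where "s = mat1 \<mu>" using mat1_cases[OF s(1)] .
    then show ?thesis unfolding s(2) using mult_mat1_index[OF v] by auto
  qed
  have "\<exists>\<mu>. \<forall>r<n. g $$ (r, i) = (if r = i then \<mu> else 0)" if i: "i < n" for i
  proof -
    obtain \<mu> where \<mu>: "\<And>r. r < n \<Longrightarrow> (g * unit_vec_mat n i) $$ (r, 0) = unit_vec_mat n i $$ (r, 0) * \<mu>"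
      using ev[OF unit_mats(1)] by blast
    have "g $$ (r, i) = (if r = i then \<mu> else 0)" if r: "r < n" for r
    proof -
      have "g $$ (r, i) = unit_vec_mat n i $$ (r, 0) * \<mu>"
        using mult_unit_vec_index[OF gc i r] \<mu>[OF r] by simp
      also have "\<dots> = (if r = i then \<mu> else 0)" using r by (simp add: unit_vec_mat_def)
      finally show ?thesis .
    qed
    then show ?thesis by blast
  qed
  then obtain l where l: "\<And>i r. i < n \<Longrightarrow> r < n \<Longrightarrow> g $$ (r, i) = (if r = i then l i else 0)" by metis
  have lc: "l i * c = c * l j" if ij: "i < n" "j < n" "i \<noteq> j" for i j c
  proof -
    define v where "v = mat n (Suc 0) (\<lambda>(r, _). if r = i then c else if r = j then 1 else 0)"
    have v: "v \<in> cvec n" by (simp add: v_def)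
    obtain \<mu> where \<mu>: "\<And>r. r < n \<Longrightarrow> (g * v) $$ (r, 0) = v $$ (r, 0) * \<mu>" using ev[OF v] by blast
    have gv: "(g * v) $$ (r, 0) = l r * v $$ (r, 0)" if r: "r < n" for r
    proof -
      have "(g * v) $$ (r, 0) = (\<Sum>k<n. g $$ (r, k) * v $$ (k, 0))"
        using gc v r by (simp add: scalar_prod_def atLeast0LessThan)
      also have "\<dots> = (\<Sum>k<n. if k = r then l r * v $$ (r, 0) else 0)"
        using l r by (intro sum.cong) auto
      finally show ?thesis using r by simp
    qed
    have "l i * c = c * \<mu>" using \<mu>[OF ij(1)] gv[OF ij(1)] ij by (simp add: v_def)
    moreover have "l j = \<mu>" using \<mu>[OF ij(2)] gv[OF ij(2)] ij by (auto simp: v_def)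
    ultimately show ?thesis by simp
  qed
  have l0: "l i = l 0" if "i < n" for i
    using lc[of i 0 1] that \<open>n \<ge> 2\<close> by (cases "i = 0") auto
  have l0c: "l 0 * c = c * l 0" for c
    using lc[of 0 1 c] l0[of 1] \<open>n \<ge> 2\<close> by simp
  have "g * x = x * g" if x: "x \<in> carrier (GL TYPE('a) n)" for x
  proof (rule eq_matI)
    have xc: "x \<in> carrier_mat n n" using x by (rule GL_carrierD)
    fix i j assume "i < dim_row (x * g)" "j < dim_col (x * g)"
    then have ij: "i < n" "j < n" using gc xc by auto
    have "(g * x) $$ (i, j) = (\<Sum>k<n. g $$ (i, k) * x $$ (k, j))"
      using gc xc ij by (simp add: scalar_prod_def atLeast0LessThan)
    also have "\<dots> = (\<Sum>k<n. if k = i then l 0 * x $$ (i, j) else 0)"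
      using ij by (intro sum.cong) (auto simp: l l0[OF ij(1)])
    also have "\<dots> = x $$ (i, j) * l 0" using ij l0c by simp
    also have "\<dots> = (\<Sum>k<n. if k = j then x $$ (i, j) * l 0 else 0)" using ij by simp
    also have "\<dots> = (\<Sum>k<n. x $$ (i, k) * g $$ (k, j))"
      using ij by (intro sum.cong) (auto simp: l l0[OF ij(2)])
    also have "\<dots> = (x * g) $$ (i, j)"
      using gc xc ij by (simp add: scalar_prod_def atLeast0LessThan)
    finally show "(g * x) $$ (i, j) = (x * g) $$ (i, j)" .
  qed (use gc GL_carrierD[OF x] in auto)
  then show ?thesis using g by (auto simp: group_center_def GL_simps)
qed

section \<open>Members of the chain contain all transvections\<close>

definition contains_transvections :: "nat \<Rightarrow> 'a::division_ring mat set \<Rightarrow> bool" where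
  "contains_transvections n L \<longleftrightarrow>
    (\<forall>v\<in>cvec n. \<forall>\<phi>\<in>rvec n. \<phi> * v = 0\<^sub>m (Suc 0) (Suc 0) \<longrightarrow> transvection n v \<phi> \<in> L)"

lemma contains_transvectionsD:
  "contains_transvections n L \<Longrightarrow> v \<in> cvec n \<Longrightarrow> \<phi> \<in> rvec n \<Longrightarrow> \<phi> * v = 0\<^sub>m (Suc 0) (Suc 0) \<Longrightarrow>
    transvection n v \<phi> \<in> L"
  by (simp add: contains_transvections_def)

lemma exists_dual_pair:
  fixes v \<phi> :: "'a::division_ring mat"
  assumes v: "v \<in> cvec n" "v \<noteq> 0\<^sub>m n (Suc 0)" and \<phi>: "\<phi> \<in> rvec n" "\<phi> \<noteq> 0\<^sub>m (Suc 0) n"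
    and "\<phi> * v = 0\<^sub>m (Suc 0) (Suc 0)"
  shows "\<exists>w \<chi>. dual_pair n v w \<phi> \<chi>"
proof -
  have "\<exists>i<n. \<phi> $$ (0, i) \<noteq> 0"
  proof (rule ccontr)
    assume "\<not> ?thesis"
    then have "\<phi> = 0\<^sub>m (Suc 0) n" using \<phi>(1) by (intro eq_matI) auto
    then show False using \<phi>(2) by contradiction
  qed
  then obtain i where i: "i < n" "\<phi> $$ (0, i) \<noteq> 0" by blast
  have d [simp]: "dim_row \<phi> = Suc 0" "dim_col \<phi> = n" "dim_row v = n" "dim_col v = Suc 0"
    using \<phi>(1) v(1) by auto
  have e [simp]: "dim_row (unit_vec_mat n i) = n" "dim_col (unit_vec_mat n i) = Suc 0"
    by (simp_all add: unit_vec_mat_def)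
  define w where "w = unit_vec_mat n i * mat1 (inverse (\<phi> $$ (0, i)))"
  have w: "w \<in> cvec n" unfolding w_def by (rule mult_carrier_mat[OF unit_mats(1)]) simp
  have "\<phi> * unit_vec_mat n i = mat1 (\<phi> $$ (0, i))"
  proof (rule eq_matI)
    fix r c assume "r < dim_row (mat1 (\<phi> $$ (0, i)))" "c < dim_col (mat1 (\<phi> $$ (0, i)))"
    then have "r = 0" "c = 0" by auto
    then show "(\<phi> * unit_vec_mat n i) $$ (r, c) = mat1 (\<phi> $$ (0, i)) $$ (r, c)"
      using mult_unit_vec_index[OF \<phi>(1) i(1), of 0] by simp
  qed simp_all
  then have \<phi>w: "\<phi> * w = 1\<^sub>m (Suc 0)"
    unfolding w_def using i by (simp add: mult_assoc_dim[symmetric] mat1_mult mat1_one)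
  have "v \<noteq> w * s" if s: "s \<in> carrier_mat (Suc 0) (Suc 0)" for s
  proof
    assume vs: "v = w * s"
    have "\<phi> * v = (\<phi> * w) * s" unfolding vs using w s by (simp add: mult_assoc_dim)
    then have "s = 0\<^sub>m (Suc 0) (Suc 0)" using s assms(5) \<phi>w by (simp add: one_mult_dim)
    then have "v = 0\<^sub>m n (Suc 0)" using vs w by (simp add: mult_zero_dim)
    then show False using v(2) by contradiction
  qed
  then obtain \<chi> where "\<chi> \<in> rvec n" "\<chi> * w = 0\<^sub>m (Suc 0) (Suc 0)" "\<chi> * v = 1\<^sub>m (Suc 0)"
    using exists_form_separating[OF w v(1)] by blast
  then show ?thesis using v w \<phi> assms(5) \<phi>w by (intro exI) (unfold_locales; simp)
qed

text \<open>Iwasawa's argument: the conjugates under \<open>K\<close> of one abelian group of transvections are all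
  groups of transvections, so transvections commute modulo \<open>K\<close>; but they are commutators.\<close>

lemma normalized_contains_transvections:
  fixes g :: "'a::division_ring mat" and t :: 'a
  assumes "normalized_subgroup (GL TYPE('a) n) K L" and TL: "contains_transvections n L"
    and g: "g \<in> K" and v0: "v0 \<in> cvec n" and gv0: "\<And>s. s \<in> carrier_mat (Suc 0) (Suc 0) \<Longrightarrow> g * v0 \<noteq> v0 * s"
    and t: "t \<noteq> 0" "t * t \<noteq> 1"
  shows "contains_transvections n K"
proof -
  let ?G = "GL TYPE('a) n"
  interpret normalized_subgroup ?G K L by fact
  have Kc: "k \<in> carrier_mat n n" if "k \<in> K" for k using K_carrier[OF that] by (rule GL_carrierD)
  have gv0c: "g * v0 \<in> cvec n" using Kc[OF g] v0 by (rule mult_carrier_mat)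
  have one_K: "1\<^sub>m n \<in> K" using subgroup.one_closed[OF K] by (simp add: GL_simps)
  \<comment> \<open>Up to scaling, \<open>K\<close> moves \<open>v0\<close> to every vector: a
    transvection \<open>h\<close> in \<open>L\<close> that fixes \<open>v0\<close> and carries
    \<open>g * v0\<close> to the line of \<open>u\<close> gives the element
    \<open>h * g * inv h\<close> of \<open>K\<close>.\<close>
  have move: "\<exists>k\<in>K. \<exists>c. k * v0 * mat1 c = u" if u: "u \<in> cvec n" for u
  proof (cases "\<exists>s\<in>carrier_mat (Suc 0) (Suc 0). u = v0 * s")
    case True
    then obtain s where s: "s \<in> carrier_mat (Suc 0) (Suc 0)" "u = v0 * s" by blast
    obtain c where "s = mat1 c" using mat1_cases[OF s(1)] .
    then have "1\<^sub>m n * v0 * mat1 c = u" using s v0 by simp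
    then show ?thesis using one_K by blast
  next
    case False
    then have uv0: "u \<noteq> v0 * s" if "s \<in> carrier_mat (Suc 0) (Suc 0)" for s using that by blast
    obtain y \<phi> c where y: "y \<in> cvec n" "\<phi> \<in> rvec n" "\<phi> * y = 0\<^sub>m (Suc 0) (Suc 0)"
      "\<phi> * v0 = 0\<^sub>m (Suc 0) (Suc 0)" "transvection n y \<phi> * (g * v0) * mat1 c = u"
      using exists_moving_transvection[OF v0 gv0c u gv0 uv0] by metis
    define h where "h = transvection n y \<phi>"
    have hL: "h \<in> L" unfolding h_def using TL y(1-3) by (rule contains_transvectionsD)
    have hc: "h \<in> carrier_mat n n" "inv\<^bsub>?G\<^esub> h \<in> carrier_mat n n"
      using GL_inv(3)[OF L_carrier[OF hL]] GL_carrierD[OF L_carrier[OF hL]] by auto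
    have hv0: "inv\<^bsub>?G\<^esub> h * v0 = v0"
    proof -
      have "h * v0 = v0" unfolding h_def using y v0 by (intro transvection_fixes)
      then have "inv\<^bsub>?G\<^esub> h * v0 = inv\<^bsub>?G\<^esub> h * h * v0"
        using hc v0 by (simp add: assoc_mult_mat[of _ n n _ n _ "Suc 0"])
      then show ?thesis using GL_inv(2)[OF L_carrier[OF hL]] v0 by simp
    qed
    have "h * g * inv\<^bsub>?G\<^esub> h \<in> K" using conj[OF hL g] by (simp add: GL_simps)
    moreover have "h * g * inv\<^bsub>?G\<^esub> h * v0 = h * (g * v0)"
    proof -
      have "h * g * inv\<^bsub>?G\<^esub> h * v0 = h * g * (inv\<^bsub>?G\<^esub> h * v0)"
        using hc v0 Kc[OF g] by (intro assoc_mult_mat[of _ n n _ n _ "Suc 0"]) auto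
      also have "\<dots> = h * (g * v0)"
        unfolding hv0 using hc v0 Kc[OF g] by (intro assoc_mult_mat[of _ n n _ n _ "Suc 0"]) auto
      finally show ?thesis .
    qed
    ultimately show ?thesis using y(5) unfolding h_def by metis
  qed
  have conjugate: "\<exists>k\<in>K. \<exists>\<psi>\<in>rvec n. \<psi> * v0 = 0\<^sub>m (Suc 0) (Suc 0) \<and>
      transvection n u \<phi> = k * transvection n v0 \<psi> * inv\<^bsub>?G\<^esub> k"
    if u: "u \<in> cvec n" and \<phi>: "\<phi> \<in> rvec n" "\<phi> * u = 0\<^sub>m (Suc 0) (Suc 0)" for u \<phi>
  proof -
    obtain k c where k: "k \<in> K" "k * v0 * mat1 c = u" using move[OF u] by blast
    have kc: "k \<in> carrier_mat n n" "inv\<^bsub>?G\<^esub> k \<in> carrier_mat n n"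
      "k * inv\<^bsub>?G\<^esub> k = 1\<^sub>m n" using Kc k GL_inv[OF K_carrier[OF k(1)]] by auto
    have kv: "k * v0 \<in> cvec n" using kc v0 by (intro mult_carrier_mat)
    have [simp]: "dim_row k = n" "dim_col k = n" "dim_row (inv\<^bsub>?G\<^esub> k) = n" "dim_row v0 = n" "dim_col v0 = Suc 0"
      "dim_row \<phi> = Suc 0" "dim_col \<phi> = n" using kc v0 \<phi> by auto
    define \<psi> where "\<psi> = mat1 c * \<phi> * k"
    have \<psi>: "\<psi> \<in> rvec n" unfolding \<psi>_def by (intro carrier_matI; simp)
    have "\<psi> * inv\<^bsub>?G\<^esub> k = mat1 c * \<phi>"
      unfolding \<psi>_def by (simp add: mult_assoc_dim kc mult_one_dim)
    then have "k * transvection n v0 \<psi> * inv\<^bsub>?G\<^esub> k = transvection n (k * v0) (mat1 c * \<phi>)"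
      using transvection_conj[OF v0 \<psi> kc] by simp
    also have "\<dots> = transvection n u \<phi>"
      unfolding k(2)[symmetric] by (rule transvection_scale[symmetric]) (use kv \<phi> in auto)
    finally have eq: "transvection n u \<phi> = k * transvection n v0 \<psi> * inv\<^bsub>?G\<^esub> k" by simp
    have "\<phi> * (k * v0) \<in> carrier_mat (Suc 0) (Suc 0)" by (rule mult_carrier_mat[OF \<phi>(1) kv])
    then obtain e where e: "\<phi> * (k * v0) = mat1 e" by (rule mat1_cases)
    \<comment> \<open>Only \<open>e * c = 0\<close> is known; the product in the other order
      vanishes because a division ring has no zero divisors.\<close>
    have "\<phi> * u = mat1 (e * c)"
      unfolding k(2)[symmetric] by (simp add: mult_assoc_dim[symmetric] e[unfolded mult_assoc_dim[symmetric]] mat1_mult)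
    then have "e = 0 \<or> c = 0" using \<phi>(2) by (simp add: mat1_zero)
    then have "mat1 c * mat1 e = 0\<^sub>m (Suc 0) (Suc 0)" by (auto simp: mat1_mult mat1_zero)
    then have "\<psi> * v0 = 0\<^sub>m (Suc 0) (Suc 0)"
      unfolding \<psi>_def by (simp add: mult_assoc_dim e)
    with eq \<psi> k(1) show ?thesis by blast
  qed
  have comm: "commute_mod (transvection n u \<phi>) (transvection n u' \<phi>')"
    if u: "u \<in> cvec n" "\<phi> \<in> rvec n" "\<phi> * u = 0\<^sub>m (Suc 0) (Suc 0)"
      and u': "u' \<in> cvec n" "\<phi>' \<in> rvec n" "\<phi>' * u' = 0\<^sub>m (Suc 0) (Suc 0)" for u \<phi> u' \<phi>'
  proof -
    obtain k \<psi> where k: "k \<in> K" "\<psi> \<in> rvec n" "\<psi> * v0 = 0\<^sub>m (Suc 0) (Suc 0)"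
      "transvection n u \<phi> = k * transvection n v0 \<psi> * inv\<^bsub>?G\<^esub> k" using conjugate[OF u] by blast
    obtain k' \<psi>' where k': "k' \<in> K" "\<psi>' \<in> rvec n" "\<psi>' * v0 = 0\<^sub>m (Suc 0) (Suc 0)"
      "transvection n u' \<phi>' = k' * transvection n v0 \<psi>' * inv\<^bsub>?G\<^esub> k'" using conjugate[OF u'] by blast
    \<comment> \<open>Transvections along the common vector \<open>v0\<close> compose by adding
      their forms.\<close>
    have "transvection n v0 \<psi> * transvection n v0 \<psi>' = transvection n v0 \<psi>' * transvection n v0 \<psi>"
      using transvection_mult[OF v0 k(2) k'(2) k(3)] transvection_mult[OF v0 k'(2) k(2) k'(3)]
        comm_add_mat[OF k(2) k'(2)] by simp
    then show ?thesis
      using commute_mod_conjugates[of "transvection n v0 \<psi>" "transvection n v0 \<psi>'" k k']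
        contains_transvectionsD[OF TL v0] k k' by (simp add: GL_simps)
  qed
  show ?thesis unfolding contains_transvections_def
  proof (intro ballI impI)
    fix v \<phi> :: "'a mat"
    assume v: "v \<in> cvec n" and \<phi>: "\<phi> \<in> rvec n" and \<phi>v: "\<phi> * v = 0\<^sub>m (Suc 0) (Suc 0)"
    show "transvection n v \<phi> \<in> K"
    proof (cases "v = 0\<^sub>m n (Suc 0) \<or> \<phi> = 0\<^sub>m (Suc 0) n")
      case True
      then have "transvection n v \<phi> = 1\<^sub>m n"
        using v \<phi> transvection_zero[OF v] by (auto simp: transvection_def zero_mult_dim)
      then show ?thesis using one_K by simp
    next
      case False
      then obtain w \<chi> where "dual_pair n v w \<phi> \<chi>"
        using exists_dual_pair v \<phi> \<phi>v by blast
      then interpret D: dual_pair n v w \<phi> \<chi> .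
      have upL: "D.upper a \<in> L" for a
        unfolding D.upper_def using TL v D.forms_vec(1) D.forms_isotropic(1) by (rule contains_transvectionsD)
      have loL: "D.lower a \<in> L" for a
        unfolding D.lower_def using TL D.w D.forms_vec(2) D.forms_isotropic(2) by (rule contains_transvectionsD)
      have up_up: "commute_mod (D.upper a) (D.upper b)" for a b
        unfolding D.upper_def by (intro comm D.v D.forms_vec D.forms_isotropic)
      have lo_up: "commute_mod (D.lower a) (D.upper b)" for a b
        unfolding D.upper_def D.lower_def by (intro comm D.v D.w D.forms_vec D.forms_isotropic)
      have multL: "x * y \<in> L" if "x \<in> L" "y \<in> L" for x y
        using subgroup.m_closed[OF L that] by (simp add: GL_simps)
      have mult: "commute_mod (x * y) z" if "x \<in> L" "y \<in> L" "z \<in> L" "commute_mod x z" "commute_mod y z" for x y z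
        using commute_mod_mult[OF that] by (simp add: GL_simps)
      define h where "h = D.torus t"
      \<comment> \<open>The commutator of the torus element with \<open>upper b\<close> is
        \<open>upper (t * b * t - b)\<close>; \<open>b\<close> is chosen to make this
        \<open>upper 1\<close>, the given transvection.\<close>
      define b where "b = inverse (t * t - 1)"
      have hL: "h \<in> L" unfolding h_def D.torus_def by (intro multL upL loL)
      have "commute_mod h (D.upper b)"
        unfolding h_def D.torus_def by (intro mult multL upL loL up_up lo_up)
      then have K1: "h * D.upper b * inv\<^bsub>?G\<^esub> h * inv\<^bsub>?G\<^esub> (D.upper b) \<in> K"
        by (simp add: commute_mod_def GL_simps)
      have hc: "h \<in> carrier_mat n n" "inv\<^bsub>?G\<^esub> h \<in> carrier_mat n n" "h * inv\<^bsub>?G\<^esub> h = 1\<^sub>m n"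
        using GL_inv[OF L_carrier[OF hL]] GL_carrierD[OF L_carrier[OF hL]] by auto
      have [simp]: "dim_row h = n" "dim_col h = n" "dim_row (inv\<^bsub>?G\<^esub> h) = n" using hc by auto
      have "mat1 (inverse t) * \<phi> * inv\<^bsub>?G\<^esub> h = \<phi>"
        unfolding D.phi_torus[OF t(1), symmetric] h_def[symmetric]
        by (simp add: mult_assoc_dim hc mult_one_dim)
      then have "mat1 t * (mat1 (inverse t) * \<phi> * inv\<^bsub>?G\<^esub> h) = mat1 t * \<phi>" by simp
      then have \<phi>h: "\<phi> * inv\<^bsub>?G\<^esub> h = mat1 t * \<phi>"
        using t by (simp add: mult_assoc_dim[symmetric] mat1_mult mat1_one[symmetric] one_mult_dim)
      have "h * D.upper b * inv\<^bsub>?G\<^esub> h = transvection n (v * mat1 t) (mat1 b * (mat1 t * \<phi>))"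
        unfolding D.upper_def transvection_conj[OF v D.forms_vec(1) hc]
        by (simp add: mult_assoc_dim \<phi>h) (simp add: h_def D.torus_v[OF t(1)])
      also have "\<dots> = D.upper (t * b * t)"
      proof -
        have "mat1 b * (mat1 t * \<phi>) \<in> rvec n" by (intro carrier_matI; simp)
        then show ?thesis
          unfolding D.upper_def using v
          by (simp add: transvection_scale mult_assoc_dim[symmetric] mat1_mult mult.assoc)
      qed
      finally have conj_upper: "h * D.upper b * inv\<^bsub>?G\<^esub> h = D.upper (t * b * t)" .
      have inv_upper: "inv\<^bsub>?G\<^esub> (D.upper b) = transvection n v (- (mat1 b * \<phi>))"
        unfolding D.upper_def by (rule transvection_GL(2)[OF v D.forms_vec(1) D.forms_isotropic(1)])
      have "D.upper (t * b * t) * transvection n v (- (mat1 b * \<phi>)) =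
          transvection n v (mat1 (t * b * t) * \<phi> + - (mat1 b * \<phi>))"
        unfolding D.upper_def using D.forms_vec(1)
        by (intro transvection_mult v D.forms_isotropic) auto
      also have "mat1 (t * b * t) * \<phi> + - (mat1 b * \<phi>) = \<phi>"
      proof -
        have "t * t - 1 \<noteq> 0" using t by simp
        have "(t * t - 1) * t = t * (t * t - 1)" by (simp add: algebra_simps)
        then have "b * t = t * b" unfolding b_def by (rule inverse_commute)
        then have "t * b * t - b = (t * t - 1) * b" by (simp add: algebra_simps)
        also have "\<dots> = 1" unfolding b_def using \<open>t * t - 1 \<noteq> 0\<close> by simp
        finally have one: "t * b * t - b = 1" .
        show ?thesis
          by (rule eq_matI)
            (simp_all add: mat1_mult_index[OF \<phi>] one flip: left_diff_distrib del: index_mult_mat(1))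
      qed
      finally show ?thesis using K1 unfolding conj_upper inv_upper by simp
    qed
  qed
qed

text \<open>The normal case applies to the normal core \<open>N\<close> of \<open>K\<close> in
  \<open>L\<close> once \<open>N\<close> has an element moving some line. Infinitely many
  \<open>upper c\<close> permute finitely many cosets, so two of them act alike, and their quotient
  is a nontrivial transvection in \<open>N\<close>.\<close>

lemma finite_index_contains_transvections:
  fixes t :: "'a::division_ring"
  assumes K: "subgroup K (GL TYPE('a) n)" and L: "subgroup L (GL TYPE('a) n)"
    and KL: "K \<subseteq> L" and TL: "contains_transvections n L"
    and fin: "finite ((\<lambda>l. K #>\<^bsub>GL TYPE('a) n\<^esub> l) ` L)" and "n \<ge> 2"
    and inf: "infinite (UNIV :: 'a set)" and t: "t \<noteq> 0" "t * t \<noteq> 1"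
  shows "contains_transvections n K"
proof -
  let ?G = "GL TYPE('a) n"
  interpret group ?G by (rule group_GL)
  define N where "N = {x \<in> L. \<forall>l\<in>L. l \<otimes>\<^bsub>?G\<^esub> x \<otimes>\<^bsub>?G\<^esub> inv\<^bsub>?G\<^esub> l \<in> K}"
  have Lc: "x \<in> carrier ?G" if "x \<in> L" for x using subgroup.mem_carrier[OF L that] .
  have NK: "N \<subseteq> K"
  proof
    fix x assume "x \<in> N"
    then have "x \<in> L" "\<one>\<^bsub>?G\<^esub> \<otimes>\<^bsub>?G\<^esub> x \<otimes>\<^bsub>?G\<^esub> inv\<^bsub>?G\<^esub> \<one>\<^bsub>?G\<^esub> \<in> K"
      using subgroup.one_closed[OF L] unfolding N_def by auto
    then show "x \<in> K" using Lc by simp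
  qed
  have conj_mult: "l \<otimes>\<^bsub>?G\<^esub> (x \<otimes>\<^bsub>?G\<^esub> y) \<otimes>\<^bsub>?G\<^esub> inv\<^bsub>?G\<^esub> l =
      (l \<otimes>\<^bsub>?G\<^esub> x \<otimes>\<^bsub>?G\<^esub> inv\<^bsub>?G\<^esub> l) \<otimes>\<^bsub>?G\<^esub> (l \<otimes>\<^bsub>?G\<^esub> y \<otimes>\<^bsub>?G\<^esub> inv\<^bsub>?G\<^esub> l)"
    if "l \<in> L" "x \<in> L" "y \<in> L" for l x y
    using that Lc by (simp add: m_assoc inv_mult_cancel_left)
  have conj_inv: "l \<otimes>\<^bsub>?G\<^esub> inv\<^bsub>?G\<^esub> x \<otimes>\<^bsub>?G\<^esub> inv\<^bsub>?G\<^esub> l = inv\<^bsub>?G\<^esub> (l \<otimes>\<^bsub>?G\<^esub> x \<otimes>\<^bsub>?G\<^esub> inv\<^bsub>?G\<^esub> l)"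
    if "l \<in> L" "x \<in> L" for l x
    using that Lc by (simp add: m_assoc inv_mult_group)
  have Nsub: "subgroup N ?G"
  proof (rule subgroupI)
    show "N \<subseteq> carrier ?G" unfolding N_def using Lc by auto
    have "\<one>\<^bsub>?G\<^esub> \<in> N"
      unfolding N_def using subgroup.one_closed[OF L] subgroup.one_closed[OF K] Lc by simp
    then show "N \<noteq> {}" by blast
    show "inv\<^bsub>?G\<^esub> x \<in> N" if "x \<in> N" for x
      using that subgroup.m_inv_closed[OF L] subgroup.m_inv_closed[OF K] conj_inv unfolding N_def by auto
    show "x \<otimes>\<^bsub>?G\<^esub> y \<in> N" if "x \<in> N" "y \<in> N" for x y
      using that subgroup.m_closed[OF L] subgroup.m_closed[OF K] conj_mult unfolding N_def by auto
  qed
  have normalized: "normalized_subgroup ?G N L"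
  proof (intro normalized_subgroup.intro normalized_subgroup_axioms.intro group_GL)
    show "subgroup N ?G" "subgroup L ?G" by (fact Nsub L)+
    show "N \<subseteq> L" by (auto simp: N_def)
    fix l k assume l: "l \<in> L" and k: "k \<in> N"
    have kL: "k \<in> L" using k by (simp add: N_def)
    have "l' \<otimes>\<^bsub>?G\<^esub> (l \<otimes>\<^bsub>?G\<^esub> k \<otimes>\<^bsub>?G\<^esub> inv\<^bsub>?G\<^esub> l) \<otimes>\<^bsub>?G\<^esub> inv\<^bsub>?G\<^esub> l' \<in> K" if l': "l' \<in> L" for l'
    proof -
      have "(l' \<otimes>\<^bsub>?G\<^esub> l) \<otimes>\<^bsub>?G\<^esub> k \<otimes>\<^bsub>?G\<^esub> inv\<^bsub>?G\<^esub> (l' \<otimes>\<^bsub>?G\<^esub> l) \<in> K"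
        using k subgroup.m_closed[OF L l' l] unfolding N_def by blast
      then show ?thesis using l l' kL Lc by (simp add: m_assoc inv_mult_group)
    qed
    moreover have "l \<otimes>\<^bsub>?G\<^esub> k \<otimes>\<^bsub>?G\<^esub> inv\<^bsub>?G\<^esub> l \<in> L"
      using l kL subgroup.m_closed[OF L] subgroup.m_inv_closed[OF L] by blast
    ultimately show "l \<otimes>\<^bsub>?G\<^esub> k \<otimes>\<^bsub>?G\<^esub> inv\<^bsub>?G\<^esub> l \<in> N" unfolding N_def by blast
  qed
  define e0 where "e0 = (unit_vec_mat n 0 :: 'a mat)"
  define e1 where "e1 = (unit_vec_mat n 1 :: 'a mat)"
  define f0 where "f0 = (unit_form n 0 :: 'a mat)"
  define f1 where "f1 = (unit_form n 1 :: 'a mat)"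
  have E: "e0 \<in> cvec n" "e1 \<in> cvec n" "f0 \<in> rvec n" "f1 \<in> rvec n"
    by (simp_all add: e0_def e1_def f0_def f1_def unit_mats)
  have fe: "f0 * e0 = 1\<^sub>m (Suc 0)" "f0 * e1 = 0\<^sub>m (Suc 0) (Suc 0)"
    "f1 * e0 = 0\<^sub>m (Suc 0) (Suc 0)" "f1 * e1 = 1\<^sub>m (Suc 0)"
    using \<open>n \<ge> 2\<close> by (simp_all add: e0_def e1_def f0_def f1_def unit_form_unit_vec)
  have dual: "dual_pair n e0 e1 f1 f0" using E fe by unfold_locales
  then interpret D: dual_pair n e0 e1 f1 f0 .
  have upL: "D.upper c \<in> L" for c
    unfolding D.upper_def using TL D.v D.forms_vec(1) D.forms_isotropic(1) by (rule contains_transvectionsD)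
  define F where "F c = restrict (\<lambda>C. C #>\<^bsub>?G\<^esub> D.upper c) ((\<lambda>l. K #>\<^bsub>?G\<^esub> l) ` L)" for c
  have Ksub: "K \<subseteq> carrier ?G" by (rule subgroup.subset[OF K])
  have "F c \<in> ((\<lambda>l. K #>\<^bsub>?G\<^esub> l) ` L) \<rightarrow>\<^sub>E ((\<lambda>l. K #>\<^bsub>?G\<^esub> l) ` L)" for c
  proof (rule PiE_I)
    fix C assume "C \<in> (\<lambda>l. K #>\<^bsub>?G\<^esub> l) ` L"
    then obtain l where l: "l \<in> L" "C = K #>\<^bsub>?G\<^esub> l" by blast
    have "C #>\<^bsub>?G\<^esub> D.upper c = K #>\<^bsub>?G\<^esub> (l \<otimes>\<^bsub>?G\<^esub> D.upper c)"
      unfolding l(2) using Ksub Lc l(1) upL by (intro coset_mult_assoc) auto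
    then show "F c C \<in> (\<lambda>l. K #>\<^bsub>?G\<^esub> l) ` L"
      using l subgroup.m_closed[OF L l(1) upL] by (auto simp: F_def)
  qed (auto simp: F_def)
  then have "range F \<subseteq> ((\<lambda>l. K #>\<^bsub>?G\<^esub> l) ` L) \<rightarrow>\<^sub>E ((\<lambda>l. K #>\<^bsub>?G\<^esub> l) ` L)" by blast
  then have "finite (range F)" by (rule finite_subset) (intro finite_PiE fin)
  then have "\<not> inj F" using inf finite_imageD by blast
  then obtain c c' where c: "c \<noteq> c'" "F c = F c'" unfolding inj_def by blast
  define x where "x = D.upper c \<otimes>\<^bsub>?G\<^esub> inv\<^bsub>?G\<^esub> (D.upper c')"
  have "l \<otimes>\<^bsub>?G\<^esub> x \<otimes>\<^bsub>?G\<^esub> inv\<^bsub>?G\<^esub> l \<in> K" if l: "l \<in> L" for l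
  proof -
    have "K #>\<^bsub>?G\<^esub> l #>\<^bsub>?G\<^esub> D.upper c = K #>\<^bsub>?G\<^esub> l #>\<^bsub>?G\<^esub> D.upper c'"
      using fun_cong[OF c(2), of "K #>\<^bsub>?G\<^esub> l"] l by (simp add: F_def)
    then have "K #>\<^bsub>?G\<^esub> (l \<otimes>\<^bsub>?G\<^esub> D.upper c) = K #>\<^bsub>?G\<^esub> (l \<otimes>\<^bsub>?G\<^esub> D.upper c')"
      using coset_mult_assoc[OF Ksub] Lc l upL by simp
    then have "(l \<otimes>\<^bsub>?G\<^esub> D.upper c) \<otimes>\<^bsub>?G\<^esub> inv\<^bsub>?G\<^esub> (l \<otimes>\<^bsub>?G\<^esub> D.upper c') \<in> K"
      using Lc l upL by (intro coset_eq_imp_quotient[OF K]) auto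
    then show ?thesis unfolding x_def using Lc l upL by (simp add: m_assoc inv_mult_group)
  qed
  moreover have "x \<in> L"
    unfolding x_def by (intro subgroup.m_closed[OF L] subgroup.m_inv_closed[OF L] upL)
  ultimately have xN: "x \<in> N" by (simp add: N_def)
  have "x = D.upper (c - c')"
  proof -
    have "x = transvection n e0 (mat1 c * f1) * transvection n e0 (- (mat1 c' * f1))"
      unfolding x_def D.upper_def
      using transvection_GL(2)[OF D.v D.forms_vec(1) D.forms_isotropic(1)] by (simp add: GL_simps)
    also have "\<dots> = transvection n e0 (mat1 c * f1 + - (mat1 c' * f1))"
      using D.forms_vec(1) by (intro transvection_mult D.v D.forms_isotropic) auto
    also have "mat1 c * f1 + - (mat1 c' * f1) = mat1 (c - c') * f1"
      by (rule eq_matI)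
        (simp_all add: mat1_mult_index[OF E(4)] left_diff_distrib del: index_mult_mat(1))
    finally show ?thesis by (simp add: D.upper_def)
  qed
  then have xe1: "x * D.comb_c 0 1 = D.comb_c (c - c') 1" by (simp add: D.upper_comb_c)
  \<comment> \<open>The form \<open>f0\<close> detects the component \<open>c - c'\<close> along
    \<open>e0\<close>, which no multiple of \<open>D.comb_c 0 1\<close> has.\<close>
  have "x * D.comb_c 0 1 \<noteq> D.comb_c 0 1 * s" if s: "s \<in> carrier_mat (Suc 0) (Suc 0)" for s
  proof
    assume "x * D.comb_c 0 1 = D.comb_c 0 1 * s"
    then have "f0 * D.comb_c (c - c') 1 = f0 * D.comb_c 0 1 * s"
      unfolding xe1 using s D.comb_c_vec[of 0 1] E(3) by (simp add: mult_assoc_dim)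
    then have "mat1 (c - c') = mat1 0"
      using s by (simp add: D.form_comb_c mat1_zero[symmetric] zero_mult_dim)
    then show False using c(1) by simp
  qed
  then have "contains_transvections n N"
    using normalized_contains_transvections[OF normalized TL xN D.comb_c_vec _ t] by blast
  then show ?thesis using NK unfolding contains_transvections_def by blast
qed

lemma GL_periodic_almost_subnormal_central:
  fixes H :: "'a::division_ring mat set"
  assumes "n \<ge> 2" and sn: "almost_subnormal H (GL TYPE('a) n)"
    and not_lf: "\<not> locally_finite_field (ring_of_type_algebra :: 'a ring)"
    and per: "periodic_group ((GL TYPE('a) n)\<lparr>carrier := H\<rparr>)"
  shows "H \<subseteq> group_center (GL TYPE('a) n)"
proof
  let ?G = "GL TYPE('a) n"
  interpret group ?G by (rule group_GL)
  fix g assume g: "g \<in> H"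
  have HG: "H \<subseteq> carrier ?G"
    using sn by (rule almost_subnormal_induct) (auto dest: subgroup.subset)
  \<comment> \<open>If every nonzero element had finite order, the division ring would be a locally
    finite field.\<close>
  obtain t :: 'a where t: "t \<noteq> 0" "\<And>k. k > 0 \<Longrightarrow> t ^ k \<noteq> 1"
    using periodic_division_ring_locally_finite not_lf by blast
  have t2: "t * t \<noteq> 1" using t(2)[of 2] by (simp add: power2_eq_square)
  have inf: "infinite (UNIV :: 'a set)"
    using finite_closed_power_one[of UNIV t] t by blast
  show "g \<in> group_center ?G"
  proof (rule ccontr)
    assume "g \<notin> group_center ?G"
    then obtain v0 where v0: "v0 \<in> cvec n" "\<And>s. s \<in> carrier_mat (Suc 0) (Suc 0) \<Longrightarrow> g * v0 \<noteq> v0 * s"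
      using GL_central_if_eigenvectors[of g n] g HG \<open>n \<ge> 2\<close> by blast
    have "contains_transvections n H"
      using sn
    proof (rule almost_subnormal_induct)
      show "contains_transvections n (carrier ?G)"
        unfolding contains_transvections_def using transvection_GL(1) by blast
    next
      fix K L
      assume KL: "subgroup K ?G" "subgroup L ?G" "K \<subseteq> L" "H \<subseteq> K" "contains_transvections n L"
        and conj: "\<And>l k. l \<in> L \<Longrightarrow> k \<in> K \<Longrightarrow> l \<otimes>\<^bsub>?G\<^esub> k \<otimes>\<^bsub>?G\<^esub> inv\<^bsub>?G\<^esub> l \<in> K"
      have "normalized_subgroup ?G K L"
        by (intro normalized_subgroup.intro normalized_subgroup_axioms.intro group_GL KL(1-3) conj)
      moreover have "g \<in> K" using g KL by blast
      ultimately show "contains_transvections n K"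
        using normalized_contains_transvections[OF _ KL(5) _ v0 t(1) t2] by blast
    next
      fix K L
      assume KL: "subgroup K ?G" "subgroup L ?G" "K \<subseteq> L" "contains_transvections n L"
        "finite ((\<lambda>l. K #>\<^bsub>?G\<^esub> l) ` L)"
      then show "contains_transvections n K"
        using \<open>n \<ge> 2\<close> inf t(1) t2 by (rule finite_index_contains_transvections)
    qed
    have nn: "0 < n" "Suc 0 < n" using \<open>n \<ge> 2\<close> by auto
    have "dual_pair n (unit_vec_mat n 0 :: 'a mat) (unit_vec_mat n (Suc 0)) (unit_form n (Suc 0)) (unit_form n 0)"
      by unfold_locales (use nn in \<open>simp_all add: unit_mats unit_form_unit_vec\<close>)
    then interpret D: dual_pair n "unit_vec_mat n 0 :: 'a mat" "unit_vec_mat n (Suc 0)" "unit_form n (Suc 0)" "unit_form n 0" .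
    have H: "subgroup H ?G"
      using sn unfolding almost_subnormal_def by (metis le0)
    have up: "D.upper a \<in> H" and lo: "D.lower a \<in> H" for a
      unfolding D.upper_def D.lower_def using \<open>contains_transvections n H\<close> D.v D.w D.forms_vec D.forms_isotropic
      by (blast intro: contains_transvectionsD)+
    have mult: "x * y \<in> H" if "x \<in> H" "y \<in> H" for x y
      using subgroup.m_closed[OF H that] by (simp add: GL_simps)
    have hH: "D.torus t \<in> H" unfolding D.torus_def by (intro mult up lo)
    obtain k :: nat where k: "k > 0" "D.torus t [^]\<^bsub>?G\<^esub> k = 1\<^sub>m n"
      using periodic_subgroupD[OF per hH] by (auto simp: GL_simps)
    let ?e = "unit_vec_mat n 0 :: 'a mat"
    have hc: "D.torus t \<in> carrier_mat n n" using hH HG GL_carrierD by blast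
    \<comment> \<open>The torus element has the eigenvector \<open>?e\<close> with eigenvalue
      \<open>t\<close>, so finite order would pass from it to \<open>t\<close>.\<close>
    have pow: "(D.torus t [^]\<^bsub>?G\<^esub> j) * ?e = ?e * mat1 (t ^ j)" for j :: nat
    proof (induction j)
      case 0
      show ?case by (simp add: GL_simps mat1_one[symmetric] one_mult_dim mult_one_dim)
    next
      case (Suc j)
      have pc: "D.torus t [^]\<^bsub>?G\<^esub> j \<in> carrier_mat n n"
        using nat_pow_closed[of "D.torus t" j] hH HG GL_carrierD by blast
      have "(D.torus t [^]\<^bsub>?G\<^esub> Suc j) * ?e = (D.torus t [^]\<^bsub>?G\<^esub> j) * (D.torus t * ?e)"
        using pc hc by (simp add: GL_simps mult_assoc_dim)
      also have "\<dots> = (D.torus t [^]\<^bsub>?G\<^esub> j) * ?e * mat1 t"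
        using pc by (simp add: D.torus_v[OF t(1)] mult_assoc_dim)
      also have "\<dots> = ?e * mat1 (t ^ Suc j)"
        by (simp add: Suc mult_assoc_dim mat1_mult power_commutes)
      finally show ?case .
    qed
    have "unit_form n 0 * (?e * mat1 (t ^ k)) = unit_form n 0 * ?e"
      using pow[of k] k(2) by (simp add: one_mult_dim)
    then have "mat1 (t ^ k) = mat1 1"
      by (simp add: D.pair(3) mat1_one mat1_mult mult_assoc_dim[symmetric])
    then show False using t(2)[OF k(1)] by simp
  qed
qed

theorem theorem3p2:
  fixes n :: nat and G :: "'a::division_ring mat set"
  assumes "n \<ge> 1"
    and "almost_subnormal G (GL TYPE('a) n)"
    and "n \<ge> 2 \<Longrightarrow> \<not> locally_finite_field (ring_of_type_algebra :: 'a ring)"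
    and "periodic_group ((GL TYPE('a) n)\<lparr>carrier := G\<rparr>)"
  shows "G \<subseteq> group_center (GL TYPE('a) n)"
proof (cases "n \<ge> 2")
  case True
  then show ?thesis using GL_periodic_almost_subnormal_central assms by blast
next
  case False
  then have "n = Suc 0" using assms(1) by simp
  then show ?thesis using GL1_periodic_almost_subnormal_central assms by blast
qed

end
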